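(* Assume all the assumptions listed below, let $\gamma>0$ be a constant such that $\|\nabla\bar Q(\bar M(\theta)\mid\theta)-\nabla\bar Q(\bar M(\theta)\mid\theta^* )\|_2\le\gamma\|\theta-\theta^*\|_2$ for all $\theta\in\Theta_r$, set $\kappa=\gamma/\lambda$, and suppose $\kappa<1$. Then: (1) For all $\Delta\in(0,(1-\kappa)r]$ and $q\in(0,1)$ there exists $\underline T(\Delta,q)\in\mathbb N_+$ such that if $T\ge\underline T(\Delta,q)$, then with $\mathbb P_{\theta^*,\nu^*}$-probability at least $1-q$, $$\sup_{\theta\in\Theta_r}\sup_{\mu\in\mathcal M}\|M_{\mu,T}(\theta;\omega)-\bar M(\theta)\|_2\le\Delta.$$ (2) If $T\ge\underline T(\Delta,q)$, then for any $\mu\in\mathcal M$ and $\theta^{(0)}\in\Theta_r$, with probability at least $1-q$ the iterates of the algorithm $\theta^{(n)}\in\arg\max_{\theta\in\Theta}Q_{\mu,T}(\theta\mid\theta^{(n-1)};\omega)$ satisfy, for all $n\in\mathbb N_+$, $$\|\theta^{(n)}-\theta^*\|_2\le\kappa^n\|\theta^{(0)}-\theta^*\|_2+(1-\kappa)^{-1}\Delta.$$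
   Context: Setting. $\mathcal S,\mathcal A,\mathcal O$ are finite sets; $\Theta=\Theta_{hi}\times\Theta_{lo}\times\Theta_b$ is a convex compact subset of a Euclidean space, $\theta=(\theta_{hi},\theta_{lo},\theta_b)$. There are policies $\pi_{hi}(o\mid s;\theta_{hi})$ (distribution on $\mathcal O$), $\pi_{lo}(a\mid s,o;\theta_{lo})$ (distribution on $\mathcal A$), $\pi_b(b\mid s,o';\theta_b)$ (distribution on $\{0,1\}$), and an environment kernel $P(s'\mid s,a)$. For a fixed known $\zeta\in(0,1)$, $\bar\pi_{hi}(o_t\mid s_t,o_{t-1},b_t;\theta_{hi})$ equals $\pi_{hi}(o_t\mid s_t;\theta_{hi})$ if $b_t=1$, $1-\zeta+\zeta/|\mathcal O|$ if $b_t=0,o_t=o_{t-1}$, and $\zeta/|\mathcal O|$ if $b_t=0,o_t\ne o_{t-1}$. The options-with-failure process with parameter $\theta$: given $O_{t-1},S_t$, draw $B_t\sim\pi_b(\cdot\mid S_t,O_{t-1};\theta_b)$, $O_t\sim\bar\pi_{hi}(\cdot\mid S_t,O_{t-1},B_t;\theta_{hi})$, $A_t\sim\pi_{lo}(\cdot\mid S_t,O_t;\theta_{lo})$, $S_{t+1}\sim P(\cdot\mid S_t,A_t)$; $\mathbb P_{\theta,o_0,s_1}$ is the law of $(S_{2:T},A_{1:T},O_{1:T},B_{1:T})$ given $(O_0,S_1)=(o_0,s_1)$. Assumptions. (A1) There is an open $\tilde\Theta\supseteq\Theta$ on which $\pi_{hi},\pi_{lo},\pi_b$ are defined and strictly positive.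 (A2) They are continuously differentiable in $\theta$ on $\tilde\Theta$. (A3) For the true parameter $\theta^*\in\Theta$, $\{(O_{t-1},S_t)\}_{t\ge1}$ is a Markov chain and the initial law $\nu^*$ of $(O_0,S_1)$ is an extreme point of its set of stationary distributions. Then $X_t=(S_t,A_t,O_t,B_t)$ is a stationary Markov chain on $\mathcal X=\mathcal S\times\mathcal A\times\mathcal O\times\{0,1\}$; $\mathbb P_{\theta^*,\nu^*}$ ($\mathbb E_{\theta^*,\nu^*}$) is the law on $\mathcal X^{\mathbb Z}$ of its two-sided stationary extension; the observed data are $s_t=\omega(s_t),a_t=\omega(a_t)$, $t\in[1:T]$; $\Omega=\{\omega: P(\omega(s_{t+1})\mid\omega(s_t),\omega(a_t))>0\ \forall t\}$. Finite-sample $Q$-function: $\mathcal M$ = set of conditional pmfs $\mu(\cdot\mid s_1)$ on $\mathcal O$. For $\omega\in\Omega$, $T\ge2$, let $\gamma^\theta_{\mu,t|T}(o_t,b_t)\propto\mathbb E_{O_0\sim\mu(\cdot\mid s_1)}[\mathbb P_{\theta,O_0,s_1}(S_{2:T}=s_{2:T},A_{1:T}=a_{1:T},O_t=o_t,B_t=b_t)]$, $\tilde\gamma^\theta_{\mu,t|T}(o_{t-1},b_t)\propto\mathbb E_{O_0\sim\mu(\cdot\mid s_1)}[\mathbb P_{\theta,O_0,s_1}(S_{2:T}=s_{2:T},A_{1:T}=a_{1:T},O_{t-1}=o_{t-1},B_t=b_t)]$ (pmfs on $\mathcal O\times\{0,1\}$), and $Q_{\mu,T}(\theta'\mid\theta;\omega)=\frac1T\{\sum_{t=2}^T\sum_{o_{t-1},b_t}\tilde\gamma^\theta_{\mu,t|T}(o_{t-1},b_t)\log\pi_b(b_t\mid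 s_t,o_{t-1};\theta'_b)+\sum_{t=1}^T\sum_{o_t,b_t}\gamma^\theta_{\mu,t|T}(o_t,b_t)\log\pi_{lo}(a_t\mid s_t,o_t;\theta'_{lo})+\sum_{t=1}^T\sum_{o_t}\gamma^\theta_{\mu,t|T}(o_t,1)\log\pi_{hi}(o_t\mid s_t;\theta'_{hi})\}$. Population $Q$-function: for $\omega\in\Omega$, $k\in\mathbb N_+$, let $\mathbb P_{\theta,k}$ be the law of the process with parameter $\theta$ over times $1-k,\dots,T+k$ with $(O_{-k},S_{1-k})\sim\nu^*$; let $\gamma^\theta_{k,1}(o_1,b_1)\propto\mathbb P_{\theta,k}(S_{1-k:T+k}=s_{1-k:T+k},A_{1-k:T+k}=a_{1-k:T+k},O_1=o_1,B_1=b_1)$ and $\tilde\gamma^\theta_{k,1}(o_0,b_1)$ analogously with $O_0=o_0,B_1=b_1$. Their total-variation limits $\gamma^\theta_{\infty,1},\tilde\gamma^\theta_{\infty,1}$ as $k\to\infty$ exist. For $\theta\in\Theta,\theta'\in\tilde\Theta$: $\bar Q(\theta'\mid\theta)=\mathbb E_{\theta^*,\nu^*}\big[\sum_{o_0,b_1}\tilde\gamma^\theta_{\infty,1}(o_0,b_1)\log\pi_b(b_1\mid\omega(s_1),o_0;\theta'_b)+\sum_{o_1,b_1}\gamma^\theta_{\infty,1}(o_1,b_1)\log\pi_{lo}(\omega(a_1)\mid\omega(s_1),o_1;\theta'_{lo})+\sum_{o_1}\gamma^\theta_{\infty,1}(o_1,1)\log\pi_{hi}(o_1\mid\omega(s_1);\theta'_{hi})\big]$,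 continuously differentiable in $\theta'\in\tilde\Theta$; $\nabla$ is the gradient in $\theta'$. (A4) There is $\lambda>0$ with $\bar Q(\theta_1\mid\theta^* )-\bar Q(\theta_2\mid\theta^* )-\langle\nabla\bar Q(\theta_2\mid\theta^* ),\theta_1-\theta_2\rangle\le-\frac\lambda2\|\theta_1-\theta_2\|_2^2$ for all $\theta_1,\theta_2\in\Theta$. (A5) There is $r>0$, with $\Theta_r=\{\theta\in\Theta:\|\theta-\theta^*\|_2\le r\}$, such that: (i) for all $\theta\in\Theta_r$, $\arg\max_{\theta'\in\Theta}\bar Q(\theta'\mid\theta)$ has a unique element $\bar M(\theta)$, and for every $\epsilon>0$, $\inf_{\theta\in\Theta_r}[\bar Q(\bar M(\theta)\mid\theta)-\sup_{\theta'\in\Theta,\|\theta'-\bar M(\theta)\|_2\ge\epsilon}\bar Q(\theta'\mid\theta)]>0$ ($\sup\emptyset=-\infty$); (ii) for all $\theta\in\Theta_r$, $T\ge2$, $\mu\in\mathcal M$, $\mathbb P_{\theta^*,\nu^*}$-a.s. $\arg\max_{\theta'\in\Theta}Q_{\mu,T}(\theta'\mid\theta;\omega)$ has a unique element $M_{\mu,T}(\theta;\omega)$. *)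

theory Defs
  imports "HOL-Analysis.Analysis" "HOL-Probability.Probability"
begin

record ('h, 'l, 'b, 's, 'a, 'o) owf_model =
  pi_hi :: "'h \<Rightarrow> 's \<Rightarrow> 'o \<Rightarrow> real"          \<comment> \<open>pi_hi(oc | s; theta_hi)\<close>
  pi_lo :: "'l \<Rightarrow> 's \<Rightarrow> 'o \<Rightarrow> 'a \<Rightarrow> real"   \<comment> \<open>pi_lo(a | s, oc; theta_lo)\<close>
  pi_b  :: "'b \<Rightarrow> 's \<Rightarrow> 'o \<Rightarrow> bool \<Rightarrow> real" \<comment> \<open>pi_b(b | s, oc'; theta_b), b=1 is True\<close>
  kern  :: "'s \<Rightarrow> 'a \<Rightarrow> 's \<Rightarrow> real"          \<comment> \<open>P(s' | s, a)\<close>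
  zeta  :: real

definition th_hi :: "'h \<times> 'l \<times> 'b \<Rightarrow> 'h" where "th_hi th = fst th"
definition th_lo :: "'h \<times> 'l \<times> 'b \<Rightarrow> 'l" where "th_lo th = fst (snd th)"
definition th_b  :: "'h \<times> 'l \<times> 'b \<Rightarrow> 'b" where "th_b th = snd (snd th)"

definition pibar_hi ::
  "('h, 'l, 'b, 's, 'a, 'o::finite) owf_model \<Rightarrow> 'h \<Rightarrow> 's \<Rightarrow> 'o \<Rightarrow> bool \<Rightarrow> 'o \<Rightarrow> real" where
  "pibar_hi Mo th s oprev b oc =
     (if b then pi_hi Mo th s oc
      else if oc = oprev then 1 - zeta Mo + zeta Mo / real CARD('o)
      else zeta Mo / real CARD('o))"

text \<open>Probability factor of time step t: draw B_t, then O_t, then A_t.\<close>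
definition step_w ::
  "('h, 'l, 'b, 's, 'a, 'o::finite) owf_model \<Rightarrow> 'h \<times> 'l \<times> 'b \<Rightarrow>
   (int \<Rightarrow> 's) \<Rightarrow> (int \<Rightarrow> 'a) \<Rightarrow> (int \<Rightarrow> 'o) \<Rightarrow> (int \<Rightarrow> bool) \<Rightarrow> int \<Rightarrow> real" where
  "step_w Mo th s a oc b t =
     pi_b Mo (th_b th) (s t) (oc (t - 1)) (b t)
     * pibar_hi Mo (th_hi th) (s t) (oc (t - 1)) (b t) (oc t)
     * pi_lo Mo (th_lo th) (s t) (oc t) (a t)"

text \<open>Joint weight of a window of times m..n: w is the (possibly unnormalised) weight of
  O_(m-1); the states s_m and actions are observed, S_(t+1) ~ P(. | S_t, A_t) for t < n.\<close>
definition joint_w ::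
  "('h, 'l, 'b, 's, 'a, 'o::finite) owf_model \<Rightarrow> 'h \<times> 'l \<times> 'b \<Rightarrow> ('o \<Rightarrow> real) \<Rightarrow> int \<Rightarrow> int \<Rightarrow>
   (int \<Rightarrow> 's) \<Rightarrow> (int \<Rightarrow> 'a) \<Rightarrow> (int \<Rightarrow> 'o) \<Rightarrow> (int \<Rightarrow> bool) \<Rightarrow> real" where
  "joint_w Mo th w m n s a oc b =
     w (oc (m - 1)) * (\<Prod>t\<in>{m..n}. step_w Mo th s a oc b t)
     * (\<Prod>t\<in>{m..n - 1}. kern Mo (s t) (a t) (s (t + 1)))"

definition hidden_sum ::
  "('h, 'l, 'b, 's, 'a, 'o::finite) owf_model \<Rightarrow> 'h \<times> 'l \<times> 'b \<Rightarrow> ('o \<Rightarrow> real) \<Rightarrow> int \<Rightarrow> int \<Rightarrow>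
   (int \<Rightarrow> 's) \<Rightarrow> (int \<Rightarrow> 'a) \<Rightarrow> ((int \<Rightarrow> 'o) \<Rightarrow> (int \<Rightarrow> bool) \<Rightarrow> bool) \<Rightarrow> real" where
  "hidden_sum Mo th w m n s a evt =
     (\<Sum>oc\<in>PiE {m - 1..n} (\<lambda>_. UNIV). \<Sum>b\<in>PiE {m..n} (\<lambda>_. UNIV).
        if evt oc b then joint_w Mo th w m n s a oc b else 0)"

definition post_ob ::
  "('h, 'l, 'b, 's, 'a, 'o::finite) owf_model \<Rightarrow> 'h \<times> 'l \<times> 'b \<Rightarrow> ('o \<Rightarrow> real) \<Rightarrow> int \<Rightarrow> int \<Rightarrow>
   (int \<Rightarrow> 's) \<Rightarrow> (int \<Rightarrow> 'a) \<Rightarrow> int \<Rightarrow> 'o \<times> bool \<Rightarrow> real" where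
  "post_ob Mo th w m n s a t ob =
     hidden_sum Mo th w m n s a (\<lambda>oc b. oc t = fst ob \<and> b t = snd ob)
     / hidden_sum Mo th w m n s a (\<lambda>_ _. True)"

definition post_prev_ob ::
  "('h, 'l, 'b, 's, 'a, 'o::finite) owf_model \<Rightarrow> 'h \<times> 'l \<times> 'b \<Rightarrow> ('o \<Rightarrow> real) \<Rightarrow> int \<Rightarrow> int \<Rightarrow>
   (int \<Rightarrow> 's) \<Rightarrow> (int \<Rightarrow> 'a) \<Rightarrow> int \<Rightarrow> 'o \<times> bool \<Rightarrow> real" where
  "post_prev_ob Mo th w m n s a t ob =
     hidden_sum Mo th w m n s a (\<lambda>oc b. oc (t - 1) = fst ob \<and> b t = snd ob)
     / hidden_sum Mo th w m n s a (\<lambda>_ _. True)"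

type_synonym ('s, 'a, 'o) path = "int \<Rightarrow> 's \<times> 'a \<times> 'o \<times> bool"

definition obs_s :: "('s, 'a, 'o) path \<Rightarrow> int \<Rightarrow> 's" where "obs_s \<omega> t = fst (\<omega> t)"
definition obs_a :: "('s, 'a, 'o) path \<Rightarrow> int \<Rightarrow> 'a" where "obs_a \<omega> t = fst (snd (\<omega> t))"
definition path_o :: "('s, 'a, 'o) path \<Rightarrow> int \<Rightarrow> 'o" where "path_o \<omega> t = fst (snd (snd (\<omega> t)))"
definition path_b :: "('s, 'a, 'o) path \<Rightarrow> int \<Rightarrow> bool" where "path_b \<omega> t = snd (snd (snd (\<omega> t)))"

text \<open>Transition kernel of the chain (O_(t-1), S_t) under parameter theta.\<close>
definition os_kernel ::
  "('h, 'l, 'b, 's, 'a, 'o::finite) owf_model \<Rightarrow> 'h \<times> 'l \<times> 'b \<Rightarrow> 'o \<times> 's \<Rightarrow> 'o \<times> 's \<Rightarrow> real" where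
  "os_kernel Mo th x y =
     (\<Sum>b\<in>UNIV. \<Sum>a\<in>UNIV.
        pi_b Mo (th_b th) (snd x) (fst x) b * pibar_hi Mo (th_hi th) (snd x) (fst x) b (fst y)
        * pi_lo Mo (th_lo th) (snd x) (fst y) a * kern Mo (snd x) a (snd y))"

definition stationary_dists ::
  "('h, 'l, 'b, 's::finite, 'a::finite, 'o::finite) owf_model \<Rightarrow> 'h \<times> 'l \<times> 'b \<Rightarrow> (real ^ ('o \<times> 's)) set" where
  "stationary_dists Mo th =
     {\<nu>. (\<forall>x. \<nu> $ x \<ge> 0) \<and> (\<Sum>x\<in>UNIV. \<nu> $ x) = 1 \<and>
          (\<forall>y. (\<Sum>x\<in>UNIV. \<nu> $ x * os_kernel Mo th x y) = \<nu> $ y)}"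

definition fd_prob ::
  "('h, 'l, 'b, 's, 'a, 'o::finite) owf_model \<Rightarrow> 'h \<times> 'l \<times> 'b \<Rightarrow> ('o \<times> 's \<Rightarrow> real) \<Rightarrow>
   int \<Rightarrow> int \<Rightarrow> ('s, 'a, 'o) path \<Rightarrow> real" where
  "fd_prob Mo th \<nu> m n x =
     (\<Sum>oc'\<in>UNIV. joint_w Mo th (\<lambda>oc. \<nu> (oc, obs_s x m)) m n (obs_s x) (obs_a x)
                   ((path_o x)(m - 1 := oc')) (path_b x))"

text \<open>M is the law on X^Z of the two-sided stationary extension of X under (theta, nu):
  product sigma-algebra and the finite-dimensional distributions of the chain.\<close>
definition is_stationary_law ::
  "('h, 'l, 'b, 's, 'a, 'o::finite) owf_model \<Rightarrow> 'h \<times> 'l \<times> 'b \<Rightarrow> ('o \<times> 's \<Rightarrow> real) \<Rightarrow>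
   ('s, 'a, 'o) path measure \<Rightarrow> bool" where
  "is_stationary_law Mo th \<nu> M \<longleftrightarrow>
     prob_space M \<and> sets M = sets (PiM UNIV (\<lambda>_::int. count_space UNIV)) \<and>
     (\<forall>m n x. m \<le> n \<longrightarrow>
        measure M {\<omega>\<in>space M. \<forall>t\<in>{m..n}. \<omega> t = x t} = fd_prob Mo th \<nu> m n x)"

definition cond_pmfs :: "('s \<Rightarrow> 'o::finite \<Rightarrow> real) set" where
  "cond_pmfs = {\<mu>. \<forall>s. (\<forall>oc. \<mu> s oc \<ge> 0) \<and> (\<Sum>oc\<in>UNIV. \<mu> s oc) = 1}"

definition Q_fin ::
  "('h, 'l, 'b, 's, 'a, 'o::finite) owf_model \<Rightarrow> ('s \<Rightarrow> 'o \<Rightarrow> real) \<Rightarrow> nat \<Rightarrow>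
   'h \<times> 'l \<times> 'b \<Rightarrow> 'h \<times> 'l \<times> 'b \<Rightarrow> ('s, 'a, 'o) path \<Rightarrow> real" where
  "Q_fin Mo \<mu> T th' th \<omega> =
     (let s = obs_s \<omega>; a = obs_a \<omega>; w = \<mu> (s 1);
          g = post_ob Mo th w 1 (int T) s a; gt = post_prev_ob Mo th w 1 (int T) s a
      in (1 / real T) *
        ((\<Sum>t\<in>{2..int T}. \<Sum>oc'\<in>UNIV. \<Sum>bt\<in>UNIV.
             gt t (oc', bt) * ln (pi_b Mo (th_b th') (s t) oc' bt))
         + (\<Sum>t\<in>{1..int T}. \<Sum>ot\<in>UNIV. \<Sum>bt\<in>UNIV.
             g t (ot, bt) * ln (pi_lo Mo (th_lo th') (s t) ot (a t)))
         + (\<Sum>t\<in>{1..int T}. \<Sum>ot\<in>UNIV.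
             g t (ot, True) * ln (pi_hi Mo (th_hi th') (s t) ot))))"

definition is_argmax_on :: "('p \<Rightarrow> real) \<Rightarrow> 'p set \<Rightarrow> 'p \<Rightarrow> bool" where
  "is_argmax_on f S x \<longleftrightarrow> x \<in> S \<and> (\<forall>y\<in>S. f y \<le> f x)"

text \<open>M_(mu,T)(theta; omega): the (a.s. unique) maximiser over Theta.\<close>
definition M_fin ::
  "('h, 'l, 'b, 's, 'a, 'o::finite) owf_model \<Rightarrow> ('h \<times> 'l \<times> 'b) set \<Rightarrow> ('s \<Rightarrow> 'o \<Rightarrow> real) \<Rightarrow> nat \<Rightarrow>
   'h \<times> 'l \<times> 'b \<Rightarrow> ('s, 'a, 'o) path \<Rightarrow> 'h \<times> 'l \<times> 'b" where
  "M_fin Mo \<Theta> \<mu> T th \<omega> = (THE th'. is_argmax_on (\<lambda>x. Q_fin Mo \<mu> T x th \<omega>) \<Theta> th')"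

definition gamma_k ::
  "('h, 'l, 'b, 's, 'a, 'o::finite) owf_model \<Rightarrow> ('o \<times> 's \<Rightarrow> real) \<Rightarrow> 'h \<times> 'l \<times> 'b \<Rightarrow>
   ('s, 'a, 'o) path \<Rightarrow> nat \<Rightarrow> 'o \<times> bool \<Rightarrow> real" where
  "gamma_k Mo \<nu> th \<omega> k =
     post_ob Mo th (\<lambda>oc. \<nu> (oc, obs_s \<omega> (1 - int k))) (1 - int k) (1 + int k) (obs_s \<omega>) (obs_a \<omega>) 1"

definition gamma_tilde_k ::
  "('h, 'l, 'b, 's, 'a, 'o::finite) owf_model \<Rightarrow> ('o \<times> 's \<Rightarrow> real) \<Rightarrow> 'h \<times> 'l \<times> 'b \<Rightarrow>
   ('s, 'a, 'o) path \<Rightarrow> nat \<Rightarrow> 'o \<times> bool \<Rightarrow> real" where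
  "gamma_tilde_k Mo \<nu> th \<omega> k =
     post_prev_ob Mo th (\<lambda>oc. \<nu> (oc, obs_s \<omega> (1 - int k))) (1 - int k) (1 + int k) (obs_s \<omega>) (obs_a \<omega>) 1"

text \<open>Limits as k tends to infinity (total variation = pointwise, the state space being finite).\<close>
definition gamma_inf where
  "gamma_inf Mo \<nu> th \<omega> ob = lim (\<lambda>k. gamma_k Mo \<nu> th \<omega> k ob)"

definition gamma_tilde_inf where
  "gamma_tilde_inf Mo \<nu> th \<omega> ob = lim (\<lambda>k. gamma_tilde_k Mo \<nu> th \<omega> k ob)"

definition Q_bar ::
  "('h, 'l, 'b, 's, 'a, 'o::finite) owf_model \<Rightarrow> ('o \<times> 's \<Rightarrow> real) \<Rightarrow> ('s, 'a, 'o) path measure \<Rightarrow>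
   'h \<times> 'l \<times> 'b \<Rightarrow> 'h \<times> 'l \<times> 'b \<Rightarrow> real" where
  "Q_bar Mo \<nu> M th' th =
     (\<integral>\<omega>. (\<Sum>o0\<in>UNIV. \<Sum>b1\<in>UNIV. gamma_tilde_inf Mo \<nu> th \<omega> (o0, b1)
               * ln (pi_b Mo (th_b th') (obs_s \<omega> 1) o0 b1))
         + (\<Sum>o1\<in>UNIV. \<Sum>b1\<in>UNIV. gamma_inf Mo \<nu> th \<omega> (o1, b1)
               * ln (pi_lo Mo (th_lo th') (obs_s \<omega> 1) o1 (obs_a \<omega> 1)))
         + (\<Sum>o1\<in>UNIV. gamma_inf Mo \<nu> th \<omega> (o1, True)
               * ln (pi_hi Mo (th_hi th') (obs_s \<omega> 1) o1)) \<partial>M)"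

definition grad_Q_bar where
  "grad_Q_bar Mo \<nu> M th' th =
     (THE D. ((\<lambda>x. Q_bar Mo \<nu> M x th) has_derivative (\<lambda>h. inner h D)) (at th'))"

definition M_bar ::
  "('h, 'l, 'b, 's, 'a, 'o::finite) owf_model \<Rightarrow> ('o \<times> 's \<Rightarrow> real) \<Rightarrow> ('s, 'a, 'o) path measure \<Rightarrow>
   ('h \<times> 'l \<times> 'b) set \<Rightarrow> 'h \<times> 'l \<times> 'b \<Rightarrow> 'h \<times> 'l \<times> 'b" where
  "M_bar Mo \<nu> M \<Theta> th = (THE th'. is_argmax_on (\<lambda>x. Q_bar Mo \<nu> M x th) \<Theta> th')"

definition C1_on :: "('p::real_normed_vector \<Rightarrow> real) \<Rightarrow> 'p set \<Rightarrow> bool" where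
  "C1_on f S \<longleftrightarrow> (\<exists>f'. (\<forall>x\<in>S. (f has_derivative blinfun_apply (f' x)) (at x)) \<and> continuous_on S f')"

end

theory Submission
  imports Defs
begin

text \<open>
  The hidden option chain has transition weights bounded away from \<open>0\<close> uniformly in the parameter, so forward and
  backward recursions started from different weights become proportional at a geometric rate. Hence every smoothing
  distribution at time \<open>t\<close> is, up to an error \<open>forget k\<close> that is uniform in the parameter, the path and the initial
  law, a function of the observations in the window of radius \<open>k\<close> around \<open>t\<close>. Since there are finitely many
  such windows, the convergence of window frequencies in probability (a consequence of \<open>\<nu>\<close> being an extreme stationary
  law) gives \<open>Q_fin \<rightarrow> Q_bar\<close> uniformly in both parameters and in \<open>\<mu>\<close>, without any equicontinuity argument. The
  separation hypothesis turns this into uniform convergence of the maximisers.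

  The true parameter maximises its own population objective by Gibbs' inequality, because under the true law the
  smoothing weights are conditional probabilities. The first-order conditions at \<open>\<theta>\<^sup>*\<close> and at \<open>M_bar \<theta>\<close>, together with
  strong concavity used in both directions, show that \<open>M_bar\<close> contracts towards \<open>\<theta>\<^sup>*\<close> with factor \<open>\<kappa>\<close>.
\<close>

section \<open>Forward and backward weights\<close>

lemma sum_PiE_insert:
  fixes F :: "('i \<Rightarrow> 'x) \<Rightarrow> real"
  assumes "i \<notin> I" "finite I"
  shows "(\<Sum>f\<in>PiE (insert i I) T. F f) = (\<Sum>y\<in>T i. \<Sum>f\<in>PiE I T. F (f(i := y)))"
proof -
  have "(\<Sum>f\<in>PiE (insert i I) T. F f) = (\<Sum>(y, f)\<in>T i \<times> PiE I T. F (f(i := y)))"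
    unfolding PiE_insert_eq
    by (subst sum.reindex[OF inj_combinator[OF assms(1)]]) (auto simp: case_prod_beta intro: sum.cong)
  then show ?thesis
    by (simp add: sum.cartesian_product)
qed

primrec fwd :: "(int \<Rightarrow> 'o \<Rightarrow> 'o \<Rightarrow> real) \<Rightarrow> ('o \<Rightarrow> real) \<Rightarrow> int \<Rightarrow> nat \<Rightarrow> 'o::finite \<Rightarrow> real" where
  "fwd V w m 0 = w"
| "fwd V w m (Suc k) = (\<lambda>j. \<Sum>i\<in>UNIV. fwd V w m k i * V (m + int k) i j)"

primrec bwd :: "(int \<Rightarrow> 'o \<Rightarrow> 'o \<Rightarrow> real) \<Rightarrow> int \<Rightarrow> nat \<Rightarrow> 'o::finite \<Rightarrow> real" where
  "bwd V n 0 = (\<lambda>_. 1)"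
| "bwd V n (Suc k) = (\<lambda>i. \<Sum>j\<in>UNIV. bwd V n k j * V (n - int k) i j)"

lemma path_sum_eq_fwd:
  fixes w :: "'o::finite \<Rightarrow> real"
  shows "(\<Sum>f\<in>PiE {m - 1..m - 1 + int k} (\<lambda>_. UNIV).
      w (f (m - 1)) * (\<Prod>t\<in>{m..m - 1 + int k}. V t (f (t - 1)) (f t)) * g (f (m - 1 + int k)))
    = (\<Sum>j\<in>UNIV. fwd V w m k j * g j)"
proof (induction k arbitrary: g)
  case 0
  have "(\<Sum>f\<in>PiE (insert (m - 1) {}) (\<lambda>_. UNIV :: 'o set). w (f (m - 1)) * g (f (m - 1))) = (\<Sum>j\<in>UNIV. w j * g j)"
    by (subst sum_PiE_insert) auto
  then show ?case by (simp add: atLeastAtMost_singleton')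
next
  case (Suc k)
  have I: "{m - 1..m - 1 + int (Suc k)} = insert (m + int k) {m - 1..m - 1 + int k}"
    "{m..m - 1 + int (Suc k)} = insert (m + int k) {m..m - 1 + int k}" by auto
  have *: "w ((f(m + int k := y)) (m - 1)) *
      (\<Prod>t\<in>{m..m - 1 + int (Suc k)}. V t ((f(m + int k := y)) (t - 1)) ((f(m + int k := y)) t)) *
      g ((f(m + int k := y)) (m - 1 + int (Suc k))) =
    w (f (m - 1)) * (\<Prod>t\<in>{m..m - 1 + int k}. V t (f (t - 1)) (f t)) *
      (V (m + int k) (f (m - 1 + int k)) y * g y)" for f :: "int \<Rightarrow> 'o" and y
  proof -
    have "(\<Prod>t\<in>{m..m - 1 + int k}. V t ((f(m + int k := y)) (t - 1)) ((f(m + int k := y)) t)) =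
      (\<Prod>t\<in>{m..m - 1 + int k}. V t (f (t - 1)) (f t))"
      by (intro prod.cong) auto
    then show ?thesis unfolding I by (simp add: algebra_simps)
  qed
  have "(\<Sum>f\<in>PiE {m - 1..m - 1 + int (Suc k)} (\<lambda>_. UNIV).
      w (f (m - 1)) * (\<Prod>t\<in>{m..m - 1 + int (Suc k)}. V t (f (t - 1)) (f t)) * g (f (m - 1 + int (Suc k)))) =
    (\<Sum>y\<in>UNIV. \<Sum>f\<in>PiE {m - 1..m - 1 + int k} (\<lambda>_. UNIV).
      w (f (m - 1)) * (\<Prod>t\<in>{m..m - 1 + int k}. V t (f (t - 1)) (f t)) *
      (V (m + int k) (f (m - 1 + int k)) y * g y))"
    unfolding I(1) by (subst sum_PiE_insert, simp, simp, intro sum.cong refl *)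
  also have "\<dots> = (\<Sum>y\<in>UNIV. \<Sum>i\<in>UNIV. fwd V w m k i * (V (m + int k) i y * g y))"
    by (intro sum.cong refl Suc.IH)
  also have "\<dots> = (\<Sum>j\<in>UNIV. fwd V w m (Suc k) j * g j)"
    by (simp add: sum_distrib_right mult.assoc)
  finally show ?case .
qed

lemma fwd_cong:
  assumes "\<And>t i j. m \<le> t \<Longrightarrow> t < m + int k \<Longrightarrow> V t i j = V' t i j"
  shows "fwd V w m k = fwd V' w m k"
  using assms by (induction k) (auto intro!: sum.cong ext)

lemma bwd_cong:
  assumes "\<And>t i j. n - int k < t \<Longrightarrow> t \<le> n \<Longrightarrow> V t i j = V' t i j"
  shows "bwd V n k = bwd V' n k"
  using assms by (induction k) (auto intro!: sum.cong ext)

lemma fwd_add: "fwd V w m (k + l) = fwd V (fwd V w m k) (m + int k) l"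
  by (induction l) (auto simp: add.assoc)

lemma fwd_shift: "fwd (\<lambda>t. V (t + d)) w m k = fwd V w (m + d) k"
  by (induction k) (auto simp: algebra_simps)

lemma fwd_bw:
  "(\<Sum>j\<in>UNIV. fwd V w m (k + l) j) = (\<Sum>j\<in>UNIV. fwd V w m k j * bwd V (m + int k + int l - 1) l j)"
proof (induction l arbitrary: k)
  case (Suc l)
  have "(\<Sum>j\<in>UNIV. fwd V w m (k + Suc l) j) = (\<Sum>j\<in>UNIV. fwd V w m (Suc k) j * bwd V (m + int k + int (Suc l) - 1) l j)"
    using Suc.IH[of "Suc k"] by (simp add: algebra_simps)
  also have "\<dots> = (\<Sum>i\<in>UNIV. \<Sum>j\<in>UNIV. fwd V w m k i * V (m + int k) i j * bwd V (m + int k + int (Suc l) - 1) l j)"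
    by (simp add: sum_distrib_right) (rule sum.swap)
  also have "\<dots> = (\<Sum>j\<in>UNIV. fwd V w m k j * bwd V (m + int k + int (Suc l) - 1) (Suc l) j)"
    by (simp add: sum_distrib_left algebra_simps)
  finally show ?case .
qed simp

lemma sum_ratio_bounds:
  fixes x x' u :: "'o::finite \<Rightarrow> real"
  assumes "\<And>i. A * x' i \<le> x i" "\<And>i. x i \<le> B * x' i" "\<And>i. 0 \<le> u i"
  shows "A * (\<Sum>i\<in>UNIV. x' i * u i) \<le> (\<Sum>i\<in>UNIV. x i * u i)"
    and "(\<Sum>i\<in>UNIV. x i * u i) \<le> B * (\<Sum>i\<in>UNIV. x' i * u i)"
  using assms by (auto simp: sum_distrib_left mult.assoc[symmetric] intro!: sum_mono mult_right_mono)

lemma positive_step_ratio_contraction: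
  fixes x x' :: "'o::finite \<Rightarrow> real"
  assumes c: "0 < c" "c \<le> 1" and U: "\<And>i j. c \<le> U i j" "\<And>i j. U i j \<le> 1"
    and AB: "\<And>i. A * x' i \<le> x i" "\<And>i. x i \<le> B * x' i"
    and x': "\<And>i. 0 \<le> x' i" "0 < (\<Sum>i\<in>UNIV. x' i)"
  obtains A' B' where "A \<le> A'" "B' \<le> B" "A' \<le> B'" "B' - A' = (1 - c) * (B - A)"
    "\<And>j. A' * (\<Sum>i\<in>UNIV. x' i * U i j) \<le> (\<Sum>i\<in>UNIV. x i * U i j)"
    "\<And>j. (\<Sum>i\<in>UNIV. x i * U i j) \<le> B' * (\<Sum>i\<in>UNIV. x' i * U i j)"
proof -
  let ?S = "\<Sum>i\<in>UNIV. x i" and ?S' = "\<Sum>i\<in>UNIV. x' i"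
  define p where "p = ?S / ?S'"
  have S: "?S = p * ?S'" using x' by (simp add: p_def)
  have "A * ?S' \<le> ?S" "?S \<le> B * ?S'"
    using AB by (auto simp: sum_distrib_left intro: sum_mono)
  then have p: "A \<le> p" "p \<le> B" using x' by (auto simp: p_def field_simps)
  have le: "(\<Sum>i\<in>UNIV. x' i * U i j) \<le> ?S'" for j
    using U x' by (intro sum_mono) (simp add: mult_left_le)
  have lo: "c * (p - A) * ?S' \<le> (\<Sum>i\<in>UNIV. x i * U i j) - A * (\<Sum>i\<in>UNIV. x' i * U i j)" for j
  proof -
    have "c * (p - A) * ?S' = (\<Sum>i\<in>UNIV. (x i - A * x' i) * c)"
      unfolding sum_distrib_right[symmetric] sum_subtractf sum_distrib_left[symmetric] S by (simp add: algebra_simps)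
    also have "\<dots> \<le> (\<Sum>i\<in>UNIV. (x i - A * x' i) * U i j)"
      using AB U by (intro sum_mono mult_left_mono) auto
    finally show ?thesis by (simp add: sum_distrib_left algebra_simps sum_subtractf)
  qed
  have hi: "c * (B - p) * ?S' \<le> B * (\<Sum>i\<in>UNIV. x' i * U i j) - (\<Sum>i\<in>UNIV. x i * U i j)" for j
  proof -
    have "c * (B - p) * ?S' = (\<Sum>i\<in>UNIV. (B * x' i - x i) * c)"
      unfolding sum_distrib_right[symmetric] sum_subtractf sum_distrib_left[symmetric] S by (simp add: algebra_simps)
    also have "\<dots> \<le> (\<Sum>i\<in>UNIV. (B * x' i - x i) * U i j)"
      using AB U by (intro sum_mono mult_left_mono) auto
    finally show ?thesis by (simp add: sum_distrib_left algebra_simps sum_subtractf)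
  qed
  show ?thesis
  proof (rule that[of "A + c * (p - A)" "B - c * (B - p)"])
    show "A + c * (p - A) \<le> B - c * (B - p)"
      using p c mult_right_mono[of c 1 "B - A"] by (simp add: algebra_simps)
    show "(A + c * (p - A)) * (\<Sum>i\<in>UNIV. x' i * U i j) \<le> (\<Sum>i\<in>UNIV. x i * U i j)" for j
      using lo[of j] mult_left_mono[OF le[of j], of "c * (p - A)"] c p by (simp add: algebra_simps)
    show "(\<Sum>i\<in>UNIV. x i * U i j) \<le> (B - c * (B - p)) * (\<Sum>i\<in>UNIV. x' i * U i j)" for j
      using hi[of j] mult_left_mono[OF le[of j], of "c * (B - p)"] c p by (simp add: algebra_simps)
  qed (use c p in \<open>auto simp: algebra_simps\<close>)
qed

lemma positive_steps_ratio_contraction: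
  fixes x x' :: "nat \<Rightarrow> 'o::finite \<Rightarrow> real"
  assumes c: "0 < c" "c \<le> 1" and U: "\<And>k i j. c \<le> U k i j" "\<And>k i j. U k i j \<le> 1"
    and x: "\<And>i. 0 \<le> x 0 i" "0 < (\<Sum>i\<in>UNIV. x 0 i)"
    and x': "\<And>i. 0 \<le> x' 0 i" "0 < (\<Sum>i\<in>UNIV. x' 0 i)"
    and step: "\<And>k j. x (Suc k) j = (\<Sum>i\<in>UNIV. x k i * U k i j)"
      "\<And>k j. x' (Suc k) j = (\<Sum>i\<in>UNIV. x' k i * U k i j)"
  obtains A B where "0 < A" "B \<le> (1 + (1 - c) ^ k / c\<^sup>2) * A"
    "\<And>j. A * x' (Suc k) j \<le> x (Suc k) j" "\<And>j. x (Suc k) j \<le> B * x' (Suc k) j"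
proof -
  let ?S = "\<Sum>i\<in>UNIV. x 0 i" and ?S' = "\<Sum>i\<in>UNIV. x' 0 i"
  define p where "p = ?S / ?S'"
  have S: "?S = p * ?S'" and p: "0 < p" using x' x by (simp_all add: p_def)
  have U0: "0 < U k i j" for k i j using U(1)[of k i j] c by linarith
  have pos: "0 < x' (Suc k) j" for k j
  proof (induction k arbitrary: j)
    case 0
    have "0 < c * ?S'" using c x' by simp
    also have "\<dots> \<le> x' (Suc 0) j"
      unfolding step sum_distrib_left using U x' by (intro sum_mono) (metis mult.commute mult_left_mono)
    finally show ?case .
  next
    case (Suc k)
    show ?case unfolding step(2)[of "Suc k"] by (intro sum_pos mult_pos_pos Suc U0) auto
  qed
  have "\<exists>A B. c * p \<le> A \<and> A \<le> B \<and> B - A \<le> (1 - c) ^ k * (p / c) \<and>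
    (\<forall>j. A * x' (Suc k) j \<le> x (Suc k) j) \<and> (\<forall>j. x (Suc k) j \<le> B * x' (Suc k) j)" for k
  proof (induction k)
    case 0
    have b: "c * (\<Sum>i\<in>UNIV. y i) \<le> (\<Sum>i\<in>UNIV. y i * U 0 i j)" "(\<Sum>i\<in>UNIV. y i * U 0 i j) \<le> (\<Sum>i\<in>UNIV. y i)"
      if "\<And>i. 0 \<le> y i" for j and y :: "'o \<Rightarrow> real"
    proof -
      show "c * (\<Sum>i\<in>UNIV. y i) \<le> (\<Sum>i\<in>UNIV. y i * U 0 i j)"
        unfolding sum_distrib_left using that U by (intro sum_mono) (metis mult.commute mult_left_mono)
      show "(\<Sum>i\<in>UNIV. y i * U 0 i j) \<le> (\<Sum>i\<in>UNIV. y i)"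
        using that U by (intro sum_mono) (simp add: mult_left_le)
    qed
    have l: "c * p * x' (Suc 0) j \<le> x (Suc 0) j" for j
    proof -
      have "c * p * x' (Suc 0) j \<le> c * p * ?S'" using b(2)[of "x' 0" j] x' c p step(2) by (intro mult_left_mono) auto
      also have "\<dots> = c * ?S" by (simp add: S)
      also have "\<dots> \<le> x (Suc 0) j" using b(1)[of "x 0" j] x step(1) by auto
      finally show ?thesis .
    qed
    have h: "x (Suc 0) j \<le> p / c * x' (Suc 0) j" for j
    proof -
      have "x (Suc 0) j \<le> p * ?S'" using b(2)[of "x 0" j] x step(1) S by auto
      also have "\<dots> = p / c * (c * ?S')" using c by simp
      also have "\<dots> \<le> p / c * x' (Suc 0) j" using b(1)[of "x' 0" j] x' c p step(2) by (intro mult_left_mono) auto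
      finally show ?thesis .
    qed
    have "c * p \<le> p / c" using c p mult_mono[of c 1 c 1] by (simp add: field_simps)
    with l h p c show ?case
      by (intro exI[of _ "c * p"] exI[of _ "p / c"]) auto
  next
    case (Suc k)
    then obtain A B where AB: "c * p \<le> A" "A \<le> B" "B - A \<le> (1 - c) ^ k * (p / c)"
      "\<And>j. A * x' (Suc k) j \<le> x (Suc k) j" "\<And>j. x (Suc k) j \<le> B * x' (Suc k) j" by blast
    obtain A' B' where "A \<le> A'" "B' \<le> B" "A' \<le> B'" and d: "B' - A' = (1 - c) * (B - A)" and
      "\<And>j. A' * (\<Sum>i\<in>UNIV. x' (Suc k) i * U (Suc k) i j) \<le> (\<Sum>i\<in>UNIV. x (Suc k) i * U (Suc k) i j)"
      "\<And>j. (\<Sum>i\<in>UNIV. x (Suc k) i * U (Suc k) i j) \<le> B' * (\<Sum>i\<in>UNIV. x' (Suc k) i * U (Suc k) i j)"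
      by (rule positive_step_ratio_contraction[where U = "U (Suc k)" and x = "x (Suc k)" and x' = "x' (Suc k)",
            OF c U AB(4,5) less_imp_le[OF pos] sum_pos[OF _ _ pos]]) auto
    moreover have "B' - A' \<le> (1 - c) ^ Suc k * (p / c)"
      using d mult_left_mono[OF AB(3), of "1 - c"] c by (simp add: mult.assoc)
    ultimately show ?case using AB(1) step by (intro exI[of _ A'] exI[of _ B']) auto
  qed
  then obtain A B where AB: "c * p \<le> A" "B - A \<le> (1 - c) ^ k * (p / c)"
      "\<And>j. A * x' (Suc k) j \<le> x (Suc k) j" "\<And>j. x (Suc k) j \<le> B * x' (Suc k) j" by blast
  have "(1 - c) ^ k * (p / c) = (1 - c) ^ k / c\<^sup>2 * (c * p)" using c by (simp add: power2_eq_square)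
  also have "\<dots> \<le> (1 - c) ^ k / c\<^sup>2 * A" using AB(1) c by (intro mult_left_mono) auto
  finally have "B \<le> (1 + (1 - c) ^ k / c\<^sup>2) * A" using AB(2) by (simp add: algebra_simps)
  moreover have "0 < A" using AB(1) mult_pos_pos[OF c(1) p] by linarith
  ultimately show ?thesis using AB that by blast
qed

definition step_prob ::
  "('h, 'l, 'b, 's, 'a, 'o::finite) owf_model \<Rightarrow> 'h \<times> 'l \<times> 'b \<Rightarrow> 's \<Rightarrow> 'a \<Rightarrow> 'o \<Rightarrow> 'o \<Rightarrow> bool \<Rightarrow> real" where
  "step_prob Mo th s a i j b =
     pi_b Mo (th_b th) s i b * pibar_hi Mo (th_hi th) s i b j * pi_lo Mo (th_lo th) s j a"

definition kern_prod ::
  "('h, 'l, 'b, 's, 'a, 'o::finite) owf_model \<Rightarrow> int \<Rightarrow> int \<Rightarrow> (int \<Rightarrow> 's) \<Rightarrow> (int \<Rightarrow> 'a) \<Rightarrow> real" where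
  "kern_prod Mo m n s a = (\<Prod>t\<in>{m..n - 1}. kern Mo (s t) (a t) (s (t + 1)))"

definition ev_mat ::
  "('h, 'l, 'b, 's, 'a, 'o::finite) owf_model \<Rightarrow> 'h \<times> 'l \<times> 'b \<Rightarrow> ('o \<Rightarrow> 'o \<Rightarrow> bool \<Rightarrow> bool) \<Rightarrow>
   's \<Rightarrow> 'a \<Rightarrow> 'o \<Rightarrow> 'o \<Rightarrow> real" where
  "ev_mat Mo th \<phi> s a i j = (\<Sum>b\<in>UNIV. if \<phi> i j b then step_prob Mo th s a i j b else 0)"

abbreviation tot_mat where "tot_mat Mo th \<equiv> ev_mat Mo th (\<lambda>_ _ _. True)"

definition ev_mats ::
  "('h, 'l, 'b, 's, 'a, 'o::finite) owf_model \<Rightarrow> 'h \<times> 'l \<times> 'b \<Rightarrow> (int \<Rightarrow> 's) \<Rightarrow> (int \<Rightarrow> 'a) \<Rightarrow> int \<Rightarrow>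
   ('o \<Rightarrow> 'o \<Rightarrow> bool \<Rightarrow> bool) \<Rightarrow> int \<Rightarrow> 'o \<Rightarrow> 'o \<Rightarrow> real" where
  "ev_mats Mo th s a t0 \<phi> t = ev_mat Mo th (if t = t0 then \<phi> else (\<lambda>_ _ _. True)) (s t) (a t)"

definition hidden_ev ::
  "('h, 'l, 'b, 's, 'a, 'o::finite) owf_model \<Rightarrow> 'h \<times> 'l \<times> 'b \<Rightarrow> ('o \<Rightarrow> real) \<Rightarrow> int \<Rightarrow> int \<Rightarrow>
   (int \<Rightarrow> 's) \<Rightarrow> (int \<Rightarrow> 'a) \<Rightarrow> int \<Rightarrow> ('o \<Rightarrow> 'o \<Rightarrow> bool \<Rightarrow> bool) \<Rightarrow> real" where
  "hidden_ev Mo th w m n s a t \<phi> = hidden_sum Mo th w m n s a (\<lambda>oc b. \<phi> (oc (t - 1)) (oc t) (b t))"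

definition post_ev ::
  "('h, 'l, 'b, 's, 'a, 'o::finite) owf_model \<Rightarrow> 'h \<times> 'l \<times> 'b \<Rightarrow> ('o \<Rightarrow> real) \<Rightarrow> int \<Rightarrow> int \<Rightarrow>
   (int \<Rightarrow> 's) \<Rightarrow> (int \<Rightarrow> 'a) \<Rightarrow> int \<Rightarrow> ('o \<Rightarrow> 'o \<Rightarrow> bool \<Rightarrow> bool) \<Rightarrow> real" where
  "post_ev Mo th w m n s a t \<phi> =
     hidden_ev Mo th w m n s a t \<phi> / hidden_ev Mo th w m n s a t (\<lambda>_ _ _. True)"

lemma post_ob_eq_post_ev:
  "post_ob Mo th w m n s a t ob = post_ev Mo th w m n s a t (\<lambda>i j b. j = fst ob \<and> b = snd ob)"
  by (simp add: post_ob_def post_ev_def hidden_ev_def)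

lemma post_prev_ob_eq_post_ev:
  "post_prev_ob Mo th w m n s a t ob = post_ev Mo th w m n s a t (\<lambda>i j b. i = fst ob \<and> b = snd ob)"
  by (simp add: post_prev_ob_def post_ev_def hidden_ev_def)

lemma joint_w_eq:
  "joint_w Mo th w m n s a oc b =
    kern_prod Mo m n s a * (w (oc (m - 1)) * (\<Prod>t\<in>{m..n}. step_prob Mo th (s t) (a t) (oc (t - 1)) (oc t) (b t)))"
  by (simp add: joint_w_def step_w_def step_prob_def kern_prod_def mult_ac)

lemma hidden_ev_eq_fwd:
  fixes Mo :: "('h, 'l, 'b, 's, 'a, 'o::finite) owf_model"
  assumes "m \<le> t0" "t0 \<le> n"
  shows "hidden_ev Mo th w m n s a t0 \<phi> =
    kern_prod Mo m n s a * (\<Sum>j\<in>UNIV. fwd (ev_mats Mo th s a t0 \<phi>) w m (nat (n - m + 1)) j)"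
proof -
  define k where "k = nat (n - m + 1)"
  have n: "n = m - 1 + int k" using assms by (simp add: k_def)
  let ?g = "\<lambda>oc t b. if t = t0 \<longrightarrow> \<phi> (oc (t0 - 1)) (oc t0) b then step_prob Mo th (s t) (a t) (oc (t - 1)) (oc t) b else 0"
  have 1: "(if \<phi> (oc (t0 - 1)) (oc t0) (b t0) then joint_w Mo th w m n s a oc b else 0) =
    kern_prod Mo m n s a * (w (oc (m - 1)) * (\<Prod>t\<in>{m..n}. ?g oc t (b t)))" for oc b
  proof (cases "\<phi> (oc (t0 - 1)) (oc t0) (b t0)")
    case True
    then have "(\<Prod>t\<in>{m..n}. ?g oc t (b t)) = (\<Prod>t\<in>{m..n}. step_prob Mo th (s t) (a t) (oc (t - 1)) (oc t) (b t))"
      by (intro prod.cong) auto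
    with True show ?thesis by (simp add: joint_w_eq)
  next
    case False
    then have "(\<Prod>t\<in>{m..n}. ?g oc t (b t)) = 0" using assms by (intro prod_zero) (auto intro!: bexI[of _ t0])
    with False show ?thesis by simp
  qed
  have 2: "(\<Sum>b\<in>PiE {m..n} (\<lambda>_. UNIV). \<Prod>t\<in>{m..n}. ?g oc t (b t)) =
    (\<Prod>t\<in>{m..n}. ev_mats Mo th s a t0 \<phi> t (oc (t - 1)) (oc t))" for oc
    by (subst prod_sum_PiE[symmetric]) (auto simp: ev_mats_def ev_mat_def intro!: prod.cong sum.cong)
  have "hidden_ev Mo th w m n s a t0 \<phi> =
    kern_prod Mo m n s a * (\<Sum>oc\<in>PiE {m - 1..n} (\<lambda>_. UNIV). w (oc (m - 1)) *
      (\<Prod>t\<in>{m..n}. ev_mats Mo th s a t0 \<phi> t (oc (t - 1)) (oc t)))"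
    unfolding hidden_ev_def hidden_sum_def 1 sum_distrib_left[symmetric] 2 ..
  also have "\<dots> = kern_prod Mo m n s a * (\<Sum>j\<in>UNIV. fwd (ev_mats Mo th s a t0 \<phi>) w m k j)"
    using path_sum_eq_fwd[where m = m and k = k and w = w and g = "\<lambda>_. 1"] by (simp add: n)
  finally show ?thesis by (simp add: k_def)
qed

lemma hidden_ev_eq_split:
  fixes Mo :: "('h, 'l, 'b, 's, 'a, 'o::finite) owf_model"
  assumes "m \<le> t" "t \<le> n"
  shows "hidden_ev Mo th w m n s a t \<phi> = kern_prod Mo m n s a *
    (\<Sum>j\<in>UNIV. (\<Sum>i\<in>UNIV. fwd (\<lambda>t. tot_mat Mo th (s t) (a t)) w m (nat (t - m)) i * ev_mat Mo th \<phi> (s t) (a t) i j)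
       * bwd (\<lambda>t. tot_mat Mo th (s t) (a t)) n (nat (n - t)) j)"
proof -
  let ?V = "ev_mats Mo th s a t \<phi>"
  have k: "nat (n - m + 1) = Suc (nat (t - m)) + nat (n - t)" using assms by auto
  have f: "fwd ?V w m (nat (t - m)) = fwd (\<lambda>t. tot_mat Mo th (s t) (a t)) w m (nat (t - m))"
    by (intro fwd_cong) (auto simp: ev_mats_def)
  have b: "bwd ?V n (nat (n - t)) = bwd (\<lambda>t. tot_mat Mo th (s t) (a t)) n (nat (n - t))"
    using assms by (intro bwd_cong) (auto simp: ev_mats_def)
  have "(\<Sum>j\<in>UNIV. fwd ?V w m (nat (n - m + 1)) j) =
    (\<Sum>j\<in>UNIV. fwd ?V w m (Suc (nat (t - m))) j * bwd ?V n (nat (n - t)) j)"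
    unfolding k fwd_bw using assms by simp
  also have "\<dots> = (\<Sum>j\<in>UNIV. (\<Sum>i\<in>UNIV. fwd ?V w m (nat (t - m)) i * ev_mat Mo th \<phi> (s t) (a t) i j)
       * bwd ?V n (nat (n - t)) j)"
    using assms by (simp add: ev_mats_def)
  finally show ?thesis unfolding hidden_ev_eq_fwd[OF assms] f b by simp
qed

lemma post_ev_shift:
  fixes Mo :: "('h, 'l, 'b, 's, 'a, 'o::finite) owf_model"
  assumes "m \<le> t" "t \<le> n"
  shows "post_ev Mo th w m n (\<lambda>u. s (u + d)) (\<lambda>u. a (u + d)) t \<phi> =
    post_ev Mo th w (m + d) (n + d) s a (t + d) \<phi>"
proof -
  have "hidden_ev Mo th w m n (\<lambda>u. s (u + d)) (\<lambda>u. a (u + d)) t \<phi> =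
    hidden_ev Mo th w (m + d) (n + d) s a (t + d) \<phi>" for \<phi>
  proof -
    have "kern_prod Mo m n (\<lambda>u. s (u + d)) (\<lambda>u. a (u + d)) = kern_prod Mo (m + d) (n + d) s a"
      unfolding kern_prod_def
      by (rule prod.reindex_bij_witness[of _ "\<lambda>t. t - d" "\<lambda>t. t + d"]) (auto simp: algebra_simps)
    moreover have "ev_mats Mo th (\<lambda>u. s (u + d)) (\<lambda>u. a (u + d)) t \<phi> = (\<lambda>u. ev_mats Mo th s a (t + d) \<phi> (u + d))"
      by (auto simp: ev_mats_def fun_eq_iff)
    ultimately show ?thesis
      using assms by (simp add: hidden_ev_eq_fwd fwd_shift)
  qed
  then show ?thesis by (simp add: post_ev_def)
qed

lemma post_ev_cong:
  fixes Mo :: "('h, 'l, 'b, 's, 'a, 'o::finite) owf_model"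
  assumes "m \<le> t" "t \<le> n" "\<And>u. m \<le> u \<Longrightarrow> u \<le> n \<Longrightarrow> s u = s' u" "\<And>u. m \<le> u \<Longrightarrow> u \<le> n \<Longrightarrow> a u = a' u"
  shows "post_ev Mo th w m n s a t \<phi> = post_ev Mo th w m n s' a' t \<phi>"
proof -
  have "hidden_ev Mo th w m n s a t \<phi> = hidden_ev Mo th w m n s' a' t \<phi>" for \<phi>
  proof -
    have "kern_prod Mo m n s a = kern_prod Mo m n s' a'"
      unfolding kern_prod_def using assms by (intro prod.cong) auto
    moreover have "fwd (ev_mats Mo th s a t \<phi>) w m (nat (n - m + 1)) = fwd (ev_mats Mo th s' a' t \<phi>) w m (nat (n - m + 1))"
      using assms by (intro fwd_cong) (auto simp: ev_mats_def)
    ultimately show ?thesis using assms(1,2) by (simp add: hidden_ev_eq_fwd)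
  qed
  then show ?thesis by (simp add: post_ev_def)
qed

locale mixing_params =
  fixes Mo :: "('h, 'l, 'b, 's::finite, 'a::finite, 'o::finite) owf_model" and \<Theta> :: "('h \<times> 'l \<times> 'b) set"
    and c :: real
  assumes c: "0 < c" "c \<le> 1"
    and step_prob_ge: "\<And>th s a i j b. th \<in> \<Theta> \<Longrightarrow> c \<le> step_prob Mo th s a i j b"
    and tot_le: "\<And>th s a i j. th \<in> \<Theta> \<Longrightarrow> tot_mat Mo th s a i j \<le> 1"
    and kern_nonneg: "\<And>s a s'. 0 \<le> kern Mo s a s'"
begin

lemma step_prob_pos: "th \<in> \<Theta> \<Longrightarrow> 0 < step_prob Mo th s a i j b"
  using step_prob_ge[of th s a i j b] c by linarith

lemma ev_mat_nonneg: "th \<in> \<Theta> \<Longrightarrow> 0 \<le> ev_mat Mo th \<phi> s a i j"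
  by (auto simp: ev_mat_def less_imp_le[OF step_prob_pos] intro!: sum_nonneg)

lemma ev_mat_le_tot: "th \<in> \<Theta> \<Longrightarrow> ev_mat Mo th \<phi> s a i j \<le> tot_mat Mo th s a i j"
  by (auto simp: ev_mat_def less_imp_le[OF step_prob_pos] intro!: sum_mono)

lemma tot_ge: "th \<in> \<Theta> \<Longrightarrow> c \<le> tot_mat Mo th s a i j"
  using add_mono[OF step_prob_ge[of th s a i j False] less_imp_le[OF step_prob_pos[of th s a i j True]]]
  by (simp add: ev_mat_def UNIV_bool)

lemma tot_pos: "th \<in> \<Theta> \<Longrightarrow> 0 < tot_mat Mo th s a i j"
  using tot_ge[of th s a i j] c by linarith

lemma fwd_nonneg:
  assumes "th \<in> \<Theta>" "\<And>i. 0 \<le> w i"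
  shows "0 \<le> fwd (\<lambda>t. tot_mat Mo th (s t) (a t)) w m k i"
  using assms by (induction k arbitrary: i) (auto intro!: sum_nonneg mult_nonneg_nonneg ev_mat_nonneg)

lemma fwd_sum_pos:
  assumes "th \<in> \<Theta>" "\<And>i. 0 \<le> w i" "0 < (\<Sum>i\<in>UNIV. w i)"
  shows "0 < (\<Sum>i\<in>UNIV. fwd (\<lambda>t. tot_mat Mo th (s t) (a t)) w m k i)"
proof (induction k)
  case (Suc k)
  let ?f = "fwd (\<lambda>t. tot_mat Mo th (s t) (a t)) w m k"
  have "0 < fwd (\<lambda>t. tot_mat Mo th (s t) (a t)) w m (Suc k) i" for i
  proof -
    have "0 < (\<Sum>i\<in>UNIV. ?f i) * c" using Suc c by simp
    also have "\<dots> \<le> (\<Sum>j\<in>UNIV. ?f j * tot_mat Mo th (s (m + int k)) (a (m + int k)) j i)"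
      unfolding sum_distrib_right using fwd_nonneg[OF assms(1,2)] tot_ge assms(1) by (intro sum_mono mult_left_mono) auto
    finally show ?thesis by simp
  qed
  then show ?case by (intro sum_pos) auto
qed (use assms in simp)

lemma bwd_pos:
  assumes "th \<in> \<Theta>"
  shows "0 < bwd (\<lambda>t. tot_mat Mo th (s t) (a t)) n k i"
  using assms by (induction k arbitrary: i) (auto intro!: sum_pos mult_pos_pos tot_pos)

lemma hidden_ev_nonneg:
  assumes "th \<in> \<Theta>" "\<And>i. 0 \<le> w i" "m \<le> t" "t \<le> n"
  shows "0 \<le> hidden_ev Mo th w m n s a t \<phi>"
  unfolding hidden_ev_eq_split[OF assms(3,4)] kern_prod_def
  by (intro mult_nonneg_nonneg prod_nonneg sum_nonneg kern_nonneg ballI fwd_nonneg assms ev_mat_nonneg less_imp_le[OF bwd_pos])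

lemma hidden_ev_le:
  assumes "th \<in> \<Theta>" "\<And>i. 0 \<le> w i" "m \<le> t" "t \<le> n"
  shows "hidden_ev Mo th w m n s a t \<phi> \<le> hidden_ev Mo th w m n s a t (\<lambda>_ _ _. True)"
  unfolding hidden_ev_eq_split[OF assms(3,4)]
  by (intro mult_left_mono mult_right_mono sum_mono)
    (auto simp: kern_prod_def intro!: ev_mat_le_tot prod_nonneg kern_nonneg fwd_nonneg less_imp_le[OF bwd_pos] assms)

lemma post_ev_bounds:
  assumes "th \<in> \<Theta>" "\<And>i. 0 \<le> w i" "m \<le> t" "t \<le> n"
  shows "0 \<le> post_ev Mo th w m n s a t \<phi>" "post_ev Mo th w m n s a t \<phi> \<le> 1"
  using hidden_ev_nonneg[of th w m t n s a, OF assms] hidden_ev_le[of th w m t n s a, OF assms]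
  by (auto simp: post_ev_def divide_le_eq_1 order_less_le)

definition forget :: "nat \<Rightarrow> real" where
  "forget k = (1 + (1 - c) ^ (k - 1) / c\<^sup>2)\<^sup>2 - 1"

lemma forget_tendsto: "forget \<longlonglongrightarrow> 0"
proof -
  have "(\<lambda>k. (1 - c) ^ k) \<longlonglongrightarrow> 0" using c by (intro LIMSEQ_power_zero) auto
  then have "(\<lambda>k. (1 - c) ^ (k - 1)) \<longlonglongrightarrow> 0"
    by (subst filterlim_sequentially_Suc[symmetric]) simp
  then have "(\<lambda>k. (1 + (1 - c) ^ (k - 1) / c\<^sup>2)\<^sup>2 - 1) \<longlonglongrightarrow> (1 + 0 / c\<^sup>2)\<^sup>2 - 1"
    by (intro tendsto_intros) (use c in auto)
  then show ?thesis by (simp add: forget_def[abs_def])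
qed

lemma forget_nonneg: "0 \<le> forget k"
  using c by (simp add: forget_def)

lemma post_ev_forget:
  assumes th: "th \<in> \<Theta>" and k: "1 \<le> k" "m \<le> m'" "n' \<le> n" "m' + int k \<le> t" "t + int k \<le> n'"
    and kern: "\<And>u. m \<le> u \<Longrightarrow> u < n \<Longrightarrow> 0 < kern Mo (s u) (a u) (s (u + 1))"
    and w: "\<And>i. 0 \<le> w i" "0 < (\<Sum>i\<in>UNIV. w i)"
    and w': "\<And>i. 0 \<le> w' i" "0 < (\<Sum>i\<in>UNIV. w' i)"
  shows "\<bar>post_ev Mo th w m n s a t \<phi> - post_ev Mo th w' m' n' s a t \<phi>\<bar> \<le> forget k"
proof -
  let ?V = "\<lambda>t. tot_mat Mo th (s t) (a t)"
  define x where "x = fwd ?V w m (nat (t - m))"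
  define x' where "x' = fwd ?V w' m' (nat (t - m'))"
  define y where "y = bwd ?V n (nat (n - t))"
  define y' where "y' = bwd ?V n' (nat (n' - t))"
  define \<rho> where "\<rho> = 1 + (1 - c) ^ (k - 1) / c\<^sup>2"
  have rho: "1 \<le> \<rho>" using c by (simp add: \<rho>_def)
  have pow: "(1 - c) ^ l \<le> (1 - c) ^ (k - 1)" if "k - 1 \<le> l" for l
    using that c by (intro power_decreasing) auto
  have "\<exists>A B. 0 < A \<and> B \<le> \<rho> * A \<and> (\<forall>j. A * x' j \<le> x j) \<and> (\<forall>j. x j \<le> B * x' j)"
  proof -
    define l where "l = nat (t - m') - 1"
    have l: "nat (t - m') = Suc l" "k - 1 \<le> l" using k by (auto simp: l_def)
    have x: "x = fwd ?V (fwd ?V w m (nat (m' - m))) m' (Suc l)"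
    proof -
      have "nat (t - m) = nat (m' - m) + Suc l" using l k by auto
      then show ?thesis using k unfolding x_def by (simp only: fwd_add) simp
    qed
    obtain A B where AB: "0 < A" "B \<le> (1 + (1 - c) ^ l / c\<^sup>2) * A"
      "\<And>j. A * fwd ?V w' m' (Suc l) j \<le> fwd ?V (fwd ?V w m (nat (m' - m))) m' (Suc l) j"
      "\<And>j. fwd ?V (fwd ?V w m (nat (m' - m))) m' (Suc l) j \<le> B * fwd ?V w' m' (Suc l) j"
      by (rule positive_steps_ratio_contraction[where c = c and x = "fwd ?V (fwd ?V w m (nat (m' - m))) m'" and
           x' = "fwd ?V w' m'" and U = "\<lambda>k. ?V (m' + int k)" and k = l])
        (use c th w w' in \<open>auto intro: tot_ge tot_le fwd_nonneg fwd_sum_pos\<close>)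
    have "(1 + (1 - c) ^ l / c\<^sup>2) * A \<le> \<rho> * A"
      using pow[OF l(2)] c AB(1) by (intro mult_right_mono) (auto simp: \<rho>_def divide_right_mono)
    with AB(2) have "B \<le> \<rho> * A" by linarith
    with AB(1,3,4) show ?thesis unfolding x x'_def l by blast
  qed
  then obtain A B where AB: "0 < A" "B \<le> \<rho> * A" "\<And>j. A * x' j \<le> x j" "\<And>j. x j \<le> B * x' j" by blast
  have "\<exists>A B. 0 < A \<and> B \<le> \<rho> * A \<and> (\<forall>j. A * y' j \<le> y j) \<and> (\<forall>j. y j \<le> B * y' j)"
  proof -
    define l where "l = nat (n' - t) - 1"
    have l: "nat (n' - t) = Suc l" "k - 1 \<le> l" using k by (auto simp: l_def)
    define z where "z q = bwd ?V n (nat (n - n') + q)" for q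
    have y: "y = z (Suc l)"
    proof -
      have "nat (n - t) = nat (n - n') + Suc l" using l k by auto
      then show ?thesis unfolding y_def z_def by simp
    qed
    have st: "z (Suc q) j = (\<Sum>i\<in>UNIV. z q i * ?V (n' - int q) j i)" for q j
    proof -
      have "n - int (nat (n - n') + q) = n' - int q" using k by simp
      then show ?thesis unfolding z_def add_Suc_right bwd.simps by (simp only:)
    qed
    obtain A B where AB: "0 < A" "B \<le> (1 + (1 - c) ^ l / c\<^sup>2) * A"
      "\<And>j. A * bwd ?V n' (Suc l) j \<le> z (Suc l) j"
      "\<And>j. z (Suc l) j \<le> B * bwd ?V n' (Suc l) j"
      by (rule positive_steps_ratio_contraction[where c = c and x = z and
           x' = "bwd ?V n'" and U = "\<lambda>k i j. ?V (n' - int k) j i" and k = l])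
        (use c th st in \<open>auto intro: tot_ge tot_le less_imp_le[OF bwd_pos] bwd_pos sum_pos simp: z_def\<close>)
    have "(1 + (1 - c) ^ l / c\<^sup>2) * A \<le> \<rho> * A"
      using pow[OF l(2)] c AB(1) by (intro mult_right_mono) (auto simp: \<rho>_def divide_right_mono)
    with AB(2) have "B \<le> \<rho> * A" by linarith
    with AB(1,3,4) show ?thesis unfolding y y'_def l by blast
  qed
  then obtain A2 B2 where AB2: "0 < A2" "B2 \<le> \<rho> * A2" "\<And>j. A2 * y' j \<le> y j" "\<And>j. y j \<le> B2 * y' j" by blast
  have x0: "0 \<le> x j" "0 \<le> x' j" for j unfolding x_def x'_def using th w w' by (auto intro: fwd_nonneg)
  have y0: "0 < y j" "0 < y' j" for j unfolding y_def y'_def using th by (auto intro: bwd_pos)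
  have xs: "0 < (\<Sum>j\<in>UNIV. x j)" "0 < (\<Sum>j\<in>UNIV. x' j)" unfolding x_def x'_def using th w w' by (auto intro: fwd_sum_pos)
  define N where "N \<phi> x y = (\<Sum>j\<in>UNIV. (\<Sum>i\<in>UNIV. x i * ev_mat Mo th \<phi> (s t) (a t) i j) * y j)" for \<phi> x y
  have Nlo: "A * A2 * N \<phi> x' y' \<le> N \<phi> x y" and Nhi: "N \<phi> x y \<le> \<rho>\<^sup>2 * (A * A2) * N \<phi> x' y'" and N0: "0 \<le> N \<phi> x' y'" for \<phi>
  proof -
    let ?E = "ev_mat Mo th \<phi> (s t) (a t)"
    have E: "0 \<le> ?E i j" for i j using th by (rule ev_mat_nonneg)
    have e': "0 \<le> (\<Sum>i\<in>UNIV. x' i * ?E i j)" for j using x0 E by (intro sum_nonneg) auto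
    have e: "0 \<le> (\<Sum>i\<in>UNIV. x i * ?E i j)" for j using x0 E by (intro sum_nonneg) auto
    show "0 \<le> N \<phi> x' y'" unfolding N_def using x0 E y0 by (intro sum_nonneg mult_nonneg_nonneg) (auto simp: less_imp_le)
    have le: "A * (\<Sum>i\<in>UNIV. x' i * ?E i j) \<le> (\<Sum>i\<in>UNIV. x i * ?E i j)"
      "(\<Sum>i\<in>UNIV. x i * ?E i j) \<le> B * (\<Sum>i\<in>UNIV. x' i * ?E i j)" for j
      using sum_ratio_bounds[of A x' x B "\<lambda>i. ?E i j"] AB E by auto
    have B: "x j \<le> \<rho> * A * x' j" for j
      using AB(4)[of j] mult_right_mono[OF AB(2) x0(2)[of j]] by linarith
    have B2: "y j \<le> \<rho> * A2 * y' j" for j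
      using AB2(4)[of j] mult_right_mono[OF AB2(2) less_imp_le[OF y0(2)[of j]]] by linarith
    have leB: "(\<Sum>i\<in>UNIV. x i * ?E i j) \<le> \<rho> * A * (\<Sum>i\<in>UNIV. x' i * ?E i j)" for j
      using sum_ratio_bounds[of A x' x "\<rho> * A" "\<lambda>i. ?E i j"] AB(3) B E by auto
    have "A * A2 * N \<phi> x' y' = (\<Sum>j\<in>UNIV. (A * (\<Sum>i\<in>UNIV. x' i * ?E i j)) * (A2 * y' j))"
      by (simp add: N_def sum_distrib_left mult_ac)
    also have "\<dots> \<le> N \<phi> x y" unfolding N_def
      using le AB2 AB(1) y0 e by (intro sum_mono mult_mono) (auto simp: less_imp_le)
    finally show "A * A2 * N \<phi> x' y' \<le> N \<phi> x y" .
    have "N \<phi> x y \<le> (\<Sum>j\<in>UNIV. (\<rho> * A * (\<Sum>i\<in>UNIV. x' i * ?E i j)) * (\<rho> * A2 * y' j))" unfolding N_def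
      using leB B2 AB(1) rho y0 e' by (intro sum_mono mult_mono mult_nonneg_nonneg) (auto simp: less_imp_le)
    also have "\<dots> = \<rho>\<^sup>2 * (A * A2) * N \<phi> x' y'"
      by (simp add: N_def sum_distrib_left mult_ac power2_eq_square)
    finally show "N \<phi> x y \<le> \<rho>\<^sup>2 * (A * A2) * N \<phi> x' y'" .
  qed
  let ?T = "\<lambda>_ _ _. True"
  have Npos: "0 < N ?T u v" if "\<And>i. 0 \<le> u i" "0 < (\<Sum>i\<in>UNIV. u i)" "\<And>j. 0 < v j" for u v
  proof -
    have "0 < (\<Sum>i\<in>UNIV. u i) * c" using that c by simp
    also have "\<dots> \<le> (\<Sum>i\<in>UNIV. u i * tot_mat Mo th (s t) (a t) i j)" for j
      unfolding sum_distrib_right using that tot_ge th by (intro sum_mono mult_left_mono) auto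
    finally have "0 < (\<Sum>i\<in>UNIV. u i * tot_mat Mo th (s t) (a t) i j) * v j" for j using that(3) by simp
    then show ?thesis unfolding N_def by (intro sum_pos) auto
  qed
  have D: "0 < N ?T x y" "0 < N ?T x' y'" using x0 xs y0 by (auto intro!: Npos)
  define P where "P = N \<phi> x y / N ?T x y"
  define P' where "P' = N \<phi> x' y' / N ?T x' y'"
  have kp: "0 < kern_prod Mo m n s a" "0 < kern_prod Mo m' n' s a"
    unfolding kern_prod_def using k by (auto intro!: prod_pos kern)
  have post: "post_ev Mo th w m n s a t \<phi> = P" "post_ev Mo th w' m' n' s a t \<phi> = P'"
    using k kp unfolding post_ev_def by (simp_all add: hidden_ev_eq_split P_def P'_def N_def x_def x'_def y_def y'_def)
  have P01: "0 \<le> P" "P \<le> 1" "0 \<le> P'" "P' \<le> 1"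
    unfolding post[symmetric] using k th w w' by (auto intro!: post_ev_bounds)
  have q: "0 < A * A2" using AB AB2 by simp
  have "P \<le> \<rho>\<^sup>2 * P'"
  proof -
    have "P \<le> (\<rho>\<^sup>2 * (A * A2) * N \<phi> x' y') / (A * A2 * N ?T x' y')"
      unfolding P_def using Nhi[of \<phi>] Nlo[of ?T] D q N0[of \<phi>] by (intro frac_le) auto
    also have "\<dots> = \<rho>\<^sup>2 * P'" using AB AB2 by (simp add: P'_def)
    finally show ?thesis .
  qed
  moreover have "P' \<le> \<rho>\<^sup>2 * P"
  proof -
    have "P' = (\<rho>\<^sup>2 * (A * A2 * N \<phi> x' y')) / (\<rho>\<^sup>2 * (A * A2) * N ?T x' y')"
      unfolding P'_def using AB AB2 rho by simp
    also have "\<dots> \<le> (\<rho>\<^sup>2 * N \<phi> x y) / N ?T x y"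
      using Nhi[of ?T] Nlo[of \<phi>] D q rho order_trans[OF mult_nonneg_nonneg[OF less_imp_le[OF q] N0] Nlo[of \<phi>]] by (intro frac_le mult_left_mono) auto
    finally show ?thesis by (simp add: P_def)
  qed
  moreover have "(\<rho>\<^sup>2 - 1) * P \<le> \<rho>\<^sup>2 - 1" "(\<rho>\<^sup>2 - 1) * P' \<le> \<rho>\<^sup>2 - 1"
    using P01 rho by (auto intro!: mult_left_le simp: one_le_power)
  ultimately have "\<bar>P - P'\<bar> \<le> \<rho>\<^sup>2 - 1" by (auto simp: algebra_simps)
  then show ?thesis unfolding post forget_def \<rho>_def .
qed

end

section \<open>Finite Markov chains and the weak law of large numbers\<close>

primrec Kpow :: "('x::finite \<Rightarrow> 'x \<Rightarrow> real) \<Rightarrow> nat \<Rightarrow> 'x \<Rightarrow> 'x \<Rightarrow> real" where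
  "Kpow K 0 x y = of_bool (x = y)"
| "Kpow K (Suc n) x y = (\<Sum>z\<in>UNIV. K x z * Kpow K n z y)"

lemma Kpow_Suc_right: "Kpow K (Suc n) x y = (\<Sum>z\<in>UNIV. Kpow K n x z * K z y)"
proof (induction n arbitrary: x)
  case (Suc n)
  have "Kpow K (Suc (Suc n)) x y = (\<Sum>u\<in>UNIV. K x u * (\<Sum>z\<in>UNIV. Kpow K n u z * K z y))"
    using Suc by (simp del: Kpow.simps add: Kpow.simps(2)[of K "Suc n"])
  also have "\<dots> = (\<Sum>z\<in>UNIV. Kpow K (Suc n) x z * K z y)"
    by (simp add: sum_distrib_left sum_distrib_right mult.assoc) (rule sum.swap)
  finally show ?case .
qed (auto simp: of_bool_def if_distrib if_distribR cong: if_cong)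

definition stationary_pmf :: "('x::finite \<Rightarrow> 'x \<Rightarrow> real) \<Rightarrow> ('x \<Rightarrow> real) \<Rightarrow> bool" where
  "stationary_pmf K p \<longleftrightarrow> (\<forall>x. 0 \<le> p x) \<and> (\<Sum>x\<in>UNIV. p x) = 1 \<and> (\<forall>y. (\<Sum>x\<in>UNIV. p x * K x y) = p y)"

locale stochastic_kernel =
  fixes K :: "'x::finite \<Rightarrow> 'x \<Rightarrow> real"
  assumes K_nonneg: "0 \<le> K x y" and K_sum: "(\<Sum>y\<in>UNIV. K x y) = 1"
begin

lemma Kpow_nonneg: "0 \<le> Kpow K n x y"
  by (induction n arbitrary: x) (auto intro!: sum_nonneg mult_nonneg_nonneg K_nonneg)

lemma Kpow_sum: "(\<Sum>y\<in>UNIV. Kpow K n x y) = 1"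
proof (induction n arbitrary: x)
  case (Suc n)
  have "(\<Sum>y\<in>UNIV. Kpow K (Suc n) x y) = (\<Sum>z\<in>UNIV. K x z * (\<Sum>y\<in>UNIV. Kpow K n z y))"
    by (simp add: sum_distrib_left) (rule sum.swap)
  then show ?case by (simp add: Suc K_sum)
qed simp

lemma Kpow_le_1: "Kpow K n x y \<le> 1"
  using member_le_sum[of y UNIV "Kpow K n x"] by (simp add: Kpow_nonneg Kpow_sum)

lemma Kpow_stationary:
  assumes "stationary_pmf K p"
  shows "(\<Sum>x\<in>UNIV. p x * Kpow K n x y) = p y"
proof (induction n arbitrary: y)
  case 0
  show ?case by (simp add: of_bool_def if_distrib cong: if_cong)
next
  case (Suc n)
  have "(\<Sum>x\<in>UNIV. p x * Kpow K (Suc n) x y) = (\<Sum>z\<in>UNIV. (\<Sum>x\<in>UNIV. p x * K x z) * Kpow K n z y)"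
    by (simp add: sum_distrib_left sum_distrib_right mult.assoc) (rule sum.swap)
  then show ?case using assms by (simp add: stationary_pmf_def Suc)
qed

definition cesaro :: "nat \<Rightarrow> 'x \<Rightarrow> 'x \<Rightarrow> real" where
  "cesaro N x y = (\<Sum>n<N. Kpow K n x y) / real N"

lemma cesaro_nonneg: "0 \<le> cesaro N x y"
  by (auto simp: cesaro_def intro!: divide_nonneg_nonneg sum_nonneg Kpow_nonneg)

lemma cesaro_sum: "N \<noteq> 0 \<Longrightarrow> (\<Sum>y\<in>UNIV. cesaro N x y) = 1"
  unfolding cesaro_def sum_divide_distrib[symmetric] by (subst sum.swap) (simp add: Kpow_sum)

lemma cesaro_le_1: "cesaro N x y \<le> 1"
proof (cases "N = 0")
  case False
  then show ?thesis using member_le_sum[of y UNIV "cesaro N x"] by (simp add: cesaro_nonneg cesaro_sum)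
qed (simp add: cesaro_def)

lemma cesaro_stationary:
  assumes "stationary_pmf K p" "N \<noteq> 0"
  shows "(\<Sum>x\<in>UNIV. p x * cesaro N x y) = p y"
proof -
  have "(\<Sum>x\<in>UNIV. p x * cesaro N x y) = (\<Sum>n<N. \<Sum>x\<in>UNIV. p x * Kpow K n x y) / real N"
    unfolding cesaro_def by (subst sum.swap) (simp add: sum_distrib_left sum_divide_distrib)
  then show ?thesis using assms by (simp add: Kpow_stationary)
qed

lemma cesaro_almost_stationary:
  "(\<Sum>z\<in>UNIV. cesaro N x z * K z y) = cesaro N x y + (Kpow K N x y - of_bool (x = y)) / real N"
proof -
  have "(\<Sum>z\<in>UNIV. cesaro N x z * K z y) = (\<Sum>n<N. Kpow K (Suc n) x y) / real N"
    unfolding cesaro_def Kpow_Suc_right by (subst sum.swap) (simp add: sum_distrib_right sum_divide_distrib)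
  moreover have "(\<Sum>n<N. Kpow K (Suc n) x y) = (\<Sum>n<N. Kpow K n x y) + (Kpow K N x y - Kpow K 0 x y)"
    by (induction N) (simp_all del: Kpow.simps(2))
  ultimately show ?thesis by (simp add: cesaro_def add_divide_distrib)
qed

text \<open>Every subsequential limit of the Cesaro means is a family of stationary laws whose mixture is \<open>p\<close>;
  extremality of \<open>p\<close> then identifies the limit.\<close>
lemma cesaro_tendsto:
  assumes p: "stationary_pmf K p"
    and extremal: "\<And>\<sigma> x. (\<And>x. stationary_pmf K (\<sigma> x)) \<Longrightarrow> (\<And>y. (\<Sum>x\<in>UNIV. p x * \<sigma> x y) = p y) \<Longrightarrow>
       0 < p x \<Longrightarrow> \<sigma> x = p"
    and x0: "0 < p x0"
  shows "(\<lambda>N. cesaro N x0 y0) \<longlonglongrightarrow> p y0"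
proof (rule ccontr)
  assume "\<not> ?thesis"
  then obtain \<epsilon> where eps: "\<epsilon> > 0" "\<And>no. \<exists>n\<ge>no. \<not> dist (cesaro n x0 y0) (p y0) < \<epsilon>"
    unfolding LIMSEQ_def by blast
  then have "infinite {n. \<not> dist (cesaro n x0 y0) (p y0) < \<epsilon>}"
    unfolding infinite_nat_iff_unbounded_le by auto
  then obtain r :: "nat \<Rightarrow> nat" where r: "strict_mono r" "\<And>n. \<not> dist (cesaro (r n) x0 y0) (p y0) < \<epsilon>"
    using infinite_enumerate by blast
  define v :: "nat \<Rightarrow> real ^ ('x \<times> 'x)" where "v n = (\<chi> i. cesaro (r n) (fst i) (snd i))" for n
  have "norm (v n) \<le> (\<Sum>i\<in>(UNIV :: ('x \<times> 'x) set). 1)" for n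
    by (rule order_trans[OF norm_le_l1_cart sum_mono]) (auto simp: v_def cesaro_nonneg cesaro_le_1)
  then have "bounded (range v)" unfolding bounded_iff by blast
  then obtain l q where q: "strict_mono q" "(v \<circ> q) \<longlonglongrightarrow> l"
    using bounded_imp_convergent_subsequence by blast
  define N where "N = r \<circ> q"
  define \<sigma> where "\<sigma> x y = l $ (x, y)" for x y
  have N: "strict_mono N" using r(1) q(1) unfolding N_def by (rule strict_mono_o)
  have lim: "(\<lambda>n. cesaro (N n) x y) \<longlonglongrightarrow> \<sigma> x y" for x y
    using tendsto_vec_nth[OF q(2), of "(x, y)"] by (simp add: v_def \<sigma>_def N_def o_def)
  have ev: "eventually (\<lambda>n. N n \<noteq> 0) sequentially"
    using eventually_gt_at_top[of 0]
  proof eventually_elim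
    case (elim n)
    then show ?case using seq_suble[OF N, of n] by simp
  qed
  have "stationary_pmf K (\<sigma> x)" for x
    unfolding stationary_pmf_def
  proof (intro conjI allI)
    show "0 \<le> \<sigma> x y" for y
      by (rule tendsto_lowerbound[OF lim]) (auto simp: cesaro_nonneg)
    have "(\<lambda>n. \<Sum>y\<in>UNIV. cesaro (N n) x y) \<longlonglongrightarrow> (\<Sum>y\<in>UNIV. \<sigma> x y)"
      by (intro tendsto_sum lim)
    moreover have "(\<lambda>n. \<Sum>y\<in>UNIV. cesaro (N n) x y) \<longlonglongrightarrow> 1"
      by (rule tendsto_eventually) (use ev in \<open>auto elim!: eventually_mono simp: cesaro_sum\<close>)
    ultimately show "(\<Sum>y\<in>UNIV. \<sigma> x y) = 1" by (rule LIMSEQ_unique)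
  next
    fix y
    have "(\<lambda>n. (Kpow K n x y - of_bool (x = y)) / real n) \<longlonglongrightarrow> 0"
    proof (rule Lim_null_comparison[OF _ lim_inverse_n'])
      show "eventually (\<lambda>n. norm ((Kpow K n x y - of_bool (x = y)) / real n) \<le> 1 / real n) sequentially"
        using Kpow_nonneg Kpow_le_1 by (intro always_eventually allI) (auto simp: of_bool_def intro!: divide_right_mono)
    qed
    from LIMSEQ_subseq_LIMSEQ[OF this N]
    have "(\<lambda>n. cesaro (N n) x y + (Kpow K (N n) x y - of_bool (x = y)) / real (N n)) \<longlonglongrightarrow> \<sigma> x y + 0"
      by (intro tendsto_add lim) (simp add: o_def)
    moreover have "(\<lambda>n. \<Sum>z\<in>UNIV. cesaro (N n) x z * K z y) \<longlonglongrightarrow> (\<Sum>z\<in>UNIV. \<sigma> x z * K z y)"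
      by (intro tendsto_sum tendsto_mult lim tendsto_const)
    ultimately show "(\<Sum>z\<in>UNIV. \<sigma> x z * K z y) = \<sigma> x y"
      unfolding cesaro_almost_stationary by (auto dest: LIMSEQ_unique)
  qed
  moreover have "(\<Sum>x\<in>UNIV. p x * \<sigma> x y) = p y" for y
  proof -
    have "(\<lambda>n. \<Sum>x\<in>UNIV. p x * cesaro (N n) x y) \<longlonglongrightarrow> (\<Sum>x\<in>UNIV. p x * \<sigma> x y)"
      by (intro tendsto_sum tendsto_mult lim tendsto_const)
    moreover have "(\<lambda>n. \<Sum>x\<in>UNIV. p x * cesaro (N n) x y) \<longlonglongrightarrow> p y"
      by (rule tendsto_eventually) (use ev in \<open>auto elim!: eventually_mono simp: cesaro_stationary[OF p]\<close>)
    ultimately show ?thesis by (rule LIMSEQ_unique)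
  qed
  ultimately have "\<sigma> x0 = p" using x0 by (rule extremal)
  then have "(\<lambda>n. cesaro (N n) x0 y0) \<longlonglongrightarrow> p y0" using lim[of x0 y0] by simp
  then obtain n where "dist (cesaro (N n) x0 y0) (p y0) < \<epsilon>"
    using eps(1) unfolding LIMSEQ_def by blast
  then show False using r(2)[of "q n"] by (simp add: N_def)
qed

end

locale path_space = prob_space M for M :: "(int \<Rightarrow> 'x::finite) measure" +
  assumes sets_M: "sets M = sets (PiM UNIV (\<lambda>_. count_space UNIV))"
begin

lemma space_M: "space M = UNIV"
  using sets_eq_imp_space_eq[OF sets_M] by (simp add: space_PiM)

definition cyl :: "int set \<Rightarrow> (int \<Rightarrow> 'x) \<Rightarrow> (int \<Rightarrow> 'x) set" where
  "cyl I x = {\<omega>. \<forall>i\<in>I. \<omega> i = x i}"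

definition window_fun :: "int set \<Rightarrow> ((int \<Rightarrow> 'x) \<Rightarrow> 'c) \<Rightarrow> bool" where
  "window_fun I f \<longleftrightarrow> (\<forall>\<omega> \<omega>'. (\<forall>i\<in>I. \<omega> i = \<omega>' i) \<longrightarrow> f \<omega> = f \<omega>')"

lemma window_fun_comp: "window_fun I f \<Longrightarrow> window_fun I (\<lambda>\<omega>. g (f \<omega>))"
  unfolding window_fun_def by (intro allI impI arg_cong[of _ _ g]) blast

lemma cyl_sets [measurable]:
  assumes "finite I" shows "cyl I x \<in> sets M"
proof -
  have [measurable]: "(\<lambda>\<omega>. \<omega> i) \<in> measurable M (count_space UNIV)" for i
    using measurable_component_singleton[of i UNIV "\<lambda>_. count_space UNIV"]
    by (simp add: measurable_cong_sets[OF sets_M refl])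
  have "cyl I x = {\<omega>\<in>space M. \<forall>i\<in>I. \<omega> i \<in> {x i}}"
    by (auto simp: cyl_def space_M)
  also have "\<dots> \<in> sets M" using assms by measurable
  finally show ?thesis .
qed

lemma window_fun_eq_sum:
  fixes f :: "(int \<Rightarrow> 'x) \<Rightarrow> real"
  assumes "finite I" "window_fun I f"
  shows "f \<omega> = (\<Sum>x\<in>PiE I (\<lambda>_. UNIV). f x * indicator (cyl I x) \<omega>)"
proof -
  have r: "restrict \<omega> I \<in> PiE I (\<lambda>_. UNIV)" by auto
  have "f x * indicator (cyl I x) \<omega> = (if x = restrict \<omega> I then f \<omega> else 0)" if "x \<in> PiE I (\<lambda>_. UNIV)" for x
  proof (cases "\<omega> \<in> cyl I x")
    case True
    then have "x = restrict \<omega> I" using that by (auto simp: cyl_def fun_eq_iff restrict_def PiE_iff extensional_def)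
    moreover have "f (restrict \<omega> I) = f \<omega>" using assms(2) unfolding window_fun_def by (metis restrict_apply')
    ultimately show ?thesis using True by simp
  next
    case False
    then have "x \<noteq> restrict \<omega> I" by (auto simp: cyl_def)
    then show ?thesis using False by simp
  qed
  then have "(\<Sum>x\<in>PiE I (\<lambda>_. UNIV). f x * indicator (cyl I x) \<omega>) =
    (\<Sum>x\<in>PiE I (\<lambda>_. UNIV). if x = restrict \<omega> I then f \<omega> else 0)" by (intro sum.cong) auto
  also have "\<dots> = f \<omega>" using r assms(1) by (simp add: finite_PiE)
  finally show ?thesis ..
qed

lemma window_fun_measurable:
  fixes f :: "(int \<Rightarrow> 'x) \<Rightarrow> real"
  assumes "finite I" "window_fun I f"
  shows "f \<in> borel_measurable M"
proof -
  have "(\<lambda>\<omega>. \<Sum>x\<in>PiE I (\<lambda>_. UNIV). f x * indicator (cyl I x) \<omega>) \<in> borel_measurable M"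
    using assms(1) by measurable
  then show ?thesis by (simp only: window_fun_eq_sum[OF assms, symmetric])
qed

lemma window_fun_integrable:
  fixes f :: "(int \<Rightarrow> 'x) \<Rightarrow> real"
  assumes "finite I" "window_fun I f"
  shows "integrable M f"
proof -
  have "integrable M (\<lambda>\<omega>. \<Sum>x\<in>PiE I (\<lambda>_. UNIV). f x * indicator (cyl I x) \<omega>)"
    using cyl_sets[OF assms(1)]
    by (intro Bochner_Integration.integrable_sum integrable_mult_right integrable_real_indicator)
      (auto simp: emeasure_eq_measure)
  then show ?thesis by (simp only: window_fun_eq_sum[OF assms, symmetric])
qed

lemma window_fun_integral:
  fixes f :: "(int \<Rightarrow> 'x) \<Rightarrow> real"
  assumes "finite I" "window_fun I f"
  shows "(\<integral>\<omega>. f \<omega> \<partial>M) = (\<Sum>x\<in>PiE I (\<lambda>_. UNIV). f x * prob (cyl I x))"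
proof -
  have "(\<integral>\<omega>. f \<omega> \<partial>M) = (\<integral>\<omega>. (\<Sum>x\<in>PiE I (\<lambda>_. UNIV). f x * indicator (cyl I x) \<omega>) \<partial>M)"
    by (intro Bochner_Integration.integral_cong refl window_fun_eq_sum assms)
  also have "\<dots> = (\<Sum>x\<in>PiE I (\<lambda>_. UNIV). f x * prob (cyl I x))"
    using cyl_sets[OF assms(1)]
    by (subst Bochner_Integration.integral_sum)
      (auto simp: emeasure_eq_measure space_M intro!: integrable_mult_right integrable_real_indicator)
  finally show ?thesis .
qed

lemma window_event:
  assumes "finite I" "window_fun I P"
  shows "{\<omega>. P \<omega>} \<in> sets M"
proof -
  have "window_fun I (\<lambda>\<omega>. of_bool (P \<omega>) :: real)" using assms(2) by (rule window_fun_comp)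
  then have [measurable]: "(\<lambda>\<omega>. of_bool (P \<omega>) :: real) \<in> borel_measurable M" by (rule window_fun_measurable[OF assms(1)])
  have "{\<omega>\<in>space M. (of_bool (P \<omega>) :: real) = 1} \<in> sets M" by measurable
  then show ?thesis by (simp add: space_M)
qed

end

locale markov_path = path_space M + stochastic_kernel K
  for M :: "(int \<Rightarrow> 'x::finite) measure" and K :: "'x \<Rightarrow> 'x \<Rightarrow> real" +
  fixes p :: "'x \<Rightarrow> real"
  assumes prob_cyl: "m \<le> n \<Longrightarrow> prob (cyl {m..n} x) = p (x m) * (\<Prod>t\<in>{m..n - 1}. K (x t) (x (t + 1)))"
begin

lemma prob_single: "prob {\<omega>. \<omega> t = y} = p y"
  using prob_cyl[of t t "\<lambda>_. y"] by (simp add: cyl_def)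

lemma p_nonneg: "0 \<le> p y"
  using prob_single[of 0 y, symmetric] by simp

lemma coord_sets: "{\<omega>. \<omega> t = y} \<in> sets M"
  using cyl_sets[of "{t}" "\<lambda>_. y"] by (simp add: cyl_def)

lemma prob_split_coord:
  assumes "A \<in> sets M"
  shows "prob A = (\<Sum>y\<in>UNIV. prob (A \<inter> {\<omega>. \<omega> t = y}))"
proof -
  have "prob (\<Union>y\<in>UNIV. A \<inter> {\<omega>. \<omega> t = y}) = (\<Sum>y\<in>UNIV. prob (A \<inter> {\<omega>. \<omega> t = y}))"
  proof (rule measure_finite_Union)
    show "range (\<lambda>y. A \<inter> {\<omega>. \<omega> t = y}) \<subseteq> sets M" using assms coord_sets by blast
    show "disjoint_family (\<lambda>y. A \<inter> {\<omega>. \<omega> t = y})" unfolding disjoint_family_on_def by blast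
  qed (simp_all add: emeasure_eq_measure)
  moreover have "(\<Union>y\<in>UNIV. A \<inter> {\<omega>. \<omega> t = y}) = A" by blast
  ultimately show ?thesis by (simp only:)
qed

lemma prob_Un_cyl:
  assumes "m \<le> n" "n + 1 + int d \<le> n'"
  shows "prob {\<omega>. (\<forall>t\<in>{m..n}. \<omega> t = x t) \<and> (\<forall>t\<in>{n + 1 + int d..n'}. \<omega> t = x t)} =
    p (x m) * (\<Prod>t\<in>{m..n - 1}. K (x t) (x (t + 1))) * Kpow K (Suc d) (x n) (x (n + 1 + int d)) *
    (\<Prod>t\<in>{n + 1 + int d..n' - 1}. K (x t) (x (t + 1)))"
  using assms
proof (induction d arbitrary: n x)
  case 0
  have "{\<omega>. (\<forall>t\<in>{m..n}. \<omega> t = x t) \<and> (\<forall>t\<in>{n + 1 + int 0..n'}. \<omega> t = x t)} = cyl {m..n'} x"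
  proof -
    have "{m..n'} = {m..n} \<union> {n + 1..n'}" using 0 by auto
    then show ?thesis unfolding cyl_def by (simp add: ball_Un)
  qed
  moreover have "(\<Prod>t\<in>{m..n' - 1}. K (x t) (x (t + 1))) =
    (\<Prod>t\<in>{m..n - 1}. K (x t) (x (t + 1))) * K (x n) (x (n + 1)) * (\<Prod>t\<in>{n + 1..n' - 1}. K (x t) (x (t + 1)))"
  proof -
    let ?f = "\<lambda>t. K (x t) (x (t + 1))"
    have "{m..n' - 1} = {m..n} \<union> {n + 1..n' - 1}" "{m..n} = insert n {m..n - 1}" using 0 by auto
    moreover have "prod ?f ({m..n} \<union> {n + 1..n' - 1}) = prod ?f {m..n} * prod ?f {n + 1..n' - 1}"
      by (rule prod.union_disjoint) auto
    moreover have "prod ?f (insert n {m..n - 1}) = ?f n * prod ?f {m..n - 1}"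
      by (rule prod.insert) auto
    ultimately show ?thesis by (simp only: mult_ac)
  qed
  ultimately show ?case using prob_cyl[of m n' x] 0
    by (simp add: mult.assoc of_bool_def if_distrib cong: if_cong)
next
  case (Suc d)
  have m: "m \<le> n + 1" "n + 1 + 1 + int d \<le> n'" using Suc.prems by auto
  define S where "S = {\<omega>. (\<forall>t\<in>{m..n}. \<omega> t = x t) \<and> (\<forall>t\<in>{n + 1 + int (Suc d)..n'}. \<omega> t = x t)}"
  define R where "R z = {\<omega>. (\<forall>t\<in>{m..n + 1}. \<omega> t = (x(n + 1 := z)) t) \<and>
     (\<forall>t\<in>{n + 1 + 1 + int d..n'}. \<omega> t = (x(n + 1 := z)) t)}" for z
  have R: "R z = {\<omega>\<in>S. \<omega> (n + 1) = z}" for z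
  proof -
    have "{m..n + 1} = insert (n + 1) {m..n}" using m by auto
    then have "(\<forall>t\<in>{m..n + 1}. P t) \<longleftrightarrow> P (n + 1) \<and> (\<forall>t\<in>{m..n}. P t)" for P by simp
    moreover have "(\<forall>t\<in>{m..n}. \<omega> t = (x(n + 1 := z)) t) \<longleftrightarrow> (\<forall>t\<in>{m..n}. \<omega> t = x t)" for \<omega>
      by (intro ball_cong) auto
    moreover have "(\<forall>t\<in>{n + 1 + 1 + int d..n'}. \<omega> t = (x(n + 1 := z)) t) \<longleftrightarrow>
      (\<forall>t\<in>{n + 1 + int (Suc d)..n'}. \<omega> t = x t)" for \<omega>
      by (intro ball_cong) auto
    ultimately show ?thesis unfolding R_def S_def by (simp only: fun_upd_same) blast
  qed
  have "S \<in> sets M"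
  proof -
    have "S = cyl {m..n} x \<inter> cyl {n + 1 + int (Suc d)..n'} x" unfolding S_def cyl_def by blast
    then show ?thesis by simp
  qed
  moreover have "S \<inter> {\<omega>. \<omega> (n + 1) = z} = R z" for z unfolding R by blast
  ultimately have "prob S = (\<Sum>z\<in>UNIV. prob (R z))"
    using prob_split_coord[of S "n + 1"] by simp
  also have "\<dots> = (\<Sum>z\<in>UNIV. p (x m) * ((\<Prod>t\<in>{m..n - 1}. K (x t) (x (t + 1))) * K (x n) z) *
     Kpow K (Suc d) z (x (n + 1 + int (Suc d))) *
     (\<Prod>t\<in>{n + 1 + int (Suc d)..n' - 1}. K (x t) (x (t + 1))))"
  proof (intro sum.cong refl)
    fix z
    let ?x = "x(n + 1 := z)"
    have e: "n + 1 + 1 + int d = n + 1 + int (Suc d)" by simp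
    have "{m..n + 1 - 1} = insert n {m..n - 1}" using Suc.prems by auto
    then have 1: "(\<Prod>t\<in>{m..n + 1 - 1}. K (?x t) (?x (t + 1))) = (\<Prod>t\<in>{m..n - 1}. K (x t) (x (t + 1))) * K (x n) z"
    proof -
      have "(\<Prod>t\<in>{m..n - 1}. K (?x t) (?x (t + 1))) = (\<Prod>t\<in>{m..n - 1}. K (x t) (x (t + 1)))"
        by (intro prod.cong) auto
      then show ?thesis using \<open>{m..n + 1 - 1} = insert n {m..n - 1}\<close> by (simp add: mult.commute)
    qed
    have 2: "(\<Prod>t\<in>{n + 1 + 1 + int d..n' - 1}. K (?x t) (?x (t + 1))) = (\<Prod>t\<in>{n + 1 + 1 + int d..n' - 1}. K (x t) (x (t + 1)))"
      by (intro prod.cong) auto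
    have 3: "?x m = x m" "?x (n + 1) = z" "?x (n + 1 + int (Suc d)) = x (n + 1 + int (Suc d))" using Suc.prems by auto
    show "prob (R z) = p (x m) * ((\<Prod>t\<in>{m..n - 1}. K (x t) (x (t + 1))) * K (x n) z) *
     Kpow K (Suc d) z (x (n + 1 + int (Suc d))) *
     (\<Prod>t\<in>{n + 1 + int (Suc d)..n' - 1}. K (x t) (x (t + 1)))"
      unfolding R_def Suc.IH[OF m, of ?x] 1 2 unfolding 3 e ..
  qed
  also have "\<dots> = p (x m) * (\<Prod>t\<in>{m..n - 1}. K (x t) (x (t + 1))) * Kpow K (Suc (Suc d)) (x n) (x (n + 1 + int (Suc d))) *
    (\<Prod>t\<in>{n + 1 + int (Suc d)..n' - 1}. K (x t) (x (t + 1)))"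
    unfolding Kpow.simps(2)[of K "Suc d"] by (simp add: sum_distrib_left sum_distrib_right mult_ac del: Kpow.simps)
  finally show ?case unfolding S_def .
qed

lemma stationary_p: "stationary_pmf K p"
  unfolding stationary_pmf_def
proof (intro conjI allI p_nonneg)
  show "(\<Sum>y\<in>UNIV. p y) = 1"
    using prob_split_coord[of "space M" 0] by (simp add: prob_single prob_space) (simp add: space_M prob_single)
  fix y
  have "{\<omega>. \<omega> 1 = y} \<inter> {\<omega>. \<omega> 0 = x} = cyl {0..1} (\<lambda>t. if t = 0 then x else y)" for x
  proof -
    have "{0..1::int} = {0, 1}" by auto
    then show ?thesis by (auto simp: cyl_def)
  qed
  then have "prob ({\<omega>. \<omega> 1 = y} \<inter> {\<omega>. \<omega> 0 = x}) = p x * K x y" for x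
    using prob_cyl[of 0 1 "\<lambda>t. if t = 0 then x else y"] by simp
  then show "(\<Sum>x\<in>UNIV. p x * K x y) = p y"
    using prob_split_coord[OF coord_sets, of 1 y 0] by (simp add: prob_single)
qed

definition occurs :: "int \<Rightarrow> int \<Rightarrow> (int \<Rightarrow> 'x) \<Rightarrow> nat \<Rightarrow> (int \<Rightarrow> 'x) set" where
  "occurs lo hi x t = {\<omega>. \<forall>i\<in>{lo..hi}. \<omega> (i + int t) = x i}"

lemma occurs_sets [measurable]: "occurs lo hi x t \<in> sets M"
  unfolding occurs_def
  by (rule window_event[where I = "(\<lambda>i. i + int t) ` {lo..hi}"]) (auto simp: window_fun_def)

lemma occurs_eq_cyl: "occurs lo hi x t = cyl {lo + int t..hi + int t} (\<lambda>i. x (i - int t))"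
proof -
  have "(\<forall>i\<in>{lo..hi}. \<omega> (i + int t) = x i) \<longleftrightarrow> (\<forall>i\<in>{lo + int t..hi + int t}. \<omega> i = x (i - int t))" (is "?l \<longleftrightarrow> ?r") for \<omega>
  proof
    assume ?l
    show ?r
    proof
      fix i assume "i \<in> {lo + int t..hi + int t}"
      then show "\<omega> i = x (i - int t)" using bspec[OF \<open>?l\<close>, of "i - int t"] by simp
    qed
  next
    assume ?r
    show ?l
    proof
      fix i assume "i \<in> {lo..hi}"
      then show "\<omega> (i + int t) = x i" using bspec[OF \<open>?r\<close>, of "i + int t"] by simp
    qed
  qed
  then show ?thesis unfolding occurs_def cyl_def by simp
qed

definition freq :: "int \<Rightarrow> int \<Rightarrow> (int \<Rightarrow> 'x) \<Rightarrow> nat \<Rightarrow> (int \<Rightarrow> 'x) \<Rightarrow> real" where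
  "freq lo hi x T \<omega> = (\<Sum>t<T. indicator (occurs lo hi x t) \<omega>) / real T"

lemma prob_occurs:
  assumes "lo \<le> hi"
  shows "prob (occurs lo hi x t) = p (x lo) * (\<Prod>i\<in>{lo..hi - 1}. K (x i) (x (i + 1)))"
proof -
  have "prob (occurs lo hi x t) = p (x lo) * (\<Prod>i\<in>{lo + int t..hi + int t - 1}. K (x (i - int t)) (x (i + 1 - int t)))"
    unfolding occurs_eq_cyl using assms by (subst prob_cyl) auto
  also have "(\<Prod>i\<in>{lo + int t..hi + int t - 1}. K (x (i - int t)) (x (i + 1 - int t))) =
    (\<Prod>i\<in>{lo..hi - 1}. K (x i) (x (i + 1)))"
    by (rule prod.reindex_bij_witness[of _ "\<lambda>i. i + int t" "\<lambda>i. i - int t"]) (auto simp: algebra_simps)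
  finally show ?thesis .
qed

lemma prob_occurs_twice:
  assumes "lo \<le> hi" and t: "int t = int s + (hi - lo) + 1 + int d"
  shows "prob (occurs lo hi x s \<inter> occurs lo hi x t) =
    prob (occurs lo hi x 0) * (\<Prod>i\<in>{lo..hi - 1}. K (x i) (x (i + 1))) * Kpow K (Suc d) (x hi) (x lo)"
proof -
  define y where "y u = (if u \<le> hi + int s then x (u - int s) else x (u - int t))" for u
  have b: "lo + int s \<le> hi + int s" "(hi + int s) + 1 + int d \<le> hi + int t" using assms by auto
  have l: "(hi + int s) + 1 + int d = lo + int t" using t by simp
  have ys: "y (lo + int s) = x lo" "y (hi + int s) = x hi" "y (lo + int t) = x lo"
    using assms by (auto simp: y_def)
  have "occurs lo hi x s \<inter> occurs lo hi x t =
    {\<omega>. (\<forall>u\<in>{lo + int s..hi + int s}. \<omega> u = y u) \<and> (\<forall>u\<in>{hi + int s + 1 + int d..hi + int t}. \<omega> u = y u)}"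
  proof -
    have "(\<forall>u\<in>{lo + int s..hi + int s}. \<omega> u = x (u - int s)) \<longleftrightarrow> (\<forall>u\<in>{lo + int s..hi + int s}. \<omega> u = y u)" for \<omega>
      by (intro ball_cong) (auto simp: y_def)
    moreover have "(\<forall>u\<in>{lo + int t..hi + int t}. \<omega> u = x (u - int t)) \<longleftrightarrow> (\<forall>u\<in>{lo + int t..hi + int t}. \<omega> u = y u)" for \<omega>
      using t by (intro ball_cong) (auto simp: y_def)
    ultimately show ?thesis unfolding occurs_eq_cyl cyl_def l by blast
  qed
  then have "prob (occurs lo hi x s \<inter> occurs lo hi x t) =
    p (y (lo + int s)) * (\<Prod>u\<in>{lo + int s..hi + int s - 1}. K (y u) (y (u + 1))) *
    Kpow K (Suc d) (y (hi + int s)) (y (lo + int t)) *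
    (\<Prod>u\<in>{lo + int t..hi + int t - 1}. K (y u) (y (u + 1)))"
    using prob_Un_cyl[OF b, of y] unfolding l by simp
  also have "(\<Prod>u\<in>{lo + int s..hi + int s - 1}. K (y u) (y (u + 1))) = (\<Prod>i\<in>{lo..hi - 1}. K (x i) (x (i + 1)))"
    by (rule prod.reindex_bij_witness[of _ "\<lambda>i. i + int s" "\<lambda>i. i - int s"]) (auto simp: algebra_simps y_def)
  also have "(\<Prod>u\<in>{lo + int t..hi + int t - 1}. K (y u) (y (u + 1))) = (\<Prod>i\<in>{lo..hi - 1}. K (x i) (x (i + 1)))"
    using t by (intro prod.reindex_bij_witness[of _ "\<lambda>i. i + int t" "\<lambda>i. i - int t"]) (auto simp: algebra_simps y_def)
  finally show ?thesis using prob_occurs[OF assms(1), of x 0] unfolding ys by (simp add: mult_ac)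
qed

end

locale ergodic_markov_path = markov_path +
  assumes extremal: "\<And>\<sigma> x. (\<And>x. stationary_pmf K (\<sigma> x)) \<Longrightarrow> (\<And>y. (\<Sum>x\<in>UNIV. p x * \<sigma> x y) = p y) \<Longrightarrow>
       0 < p x \<Longrightarrow> \<sigma> x = p"
begin

lemma sum_Kpow_deviation_bound:
  assumes "0 < p x" "\<epsilon> > 0"
  obtains C where "0 \<le> C" "\<And>N. \<bar>\<Sum>n<N. Kpow K n x y - p y\<bar> \<le> \<epsilon> * real N + C"
proof -
  have "(\<lambda>N. cesaro N x y) \<longlonglongrightarrow> p y"
  proof (rule cesaro_tendsto[OF stationary_p _ assms(1)])
    fix \<sigma> z
    assume "\<And>x. stationary_pmf K (\<sigma> x)" "\<And>y. (\<Sum>x\<in>UNIV. p x * \<sigma> x y) = p y" "0 < p z"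
    then show "\<sigma> z = p" by (rule extremal)
  qed
  then obtain N0 where N0: "\<And>N. N \<ge> N0 \<Longrightarrow> \<bar>cesaro N x y - p y\<bar> < \<epsilon>"
    using assms(2) unfolding LIMSEQ_def dist_real_def by blast
  have p1: "p y \<le> 1" using prob_single[of 0 y, symmetric] by simp
  have "\<bar>\<Sum>n<N. Kpow K n x y - p y\<bar> \<le> \<epsilon> * real N + real N0" for N
  proof (cases "N \<ge> N0 \<and> N \<noteq> 0")
    case True
    then have "(\<Sum>n<N. Kpow K n x y - p y) = real N * (cesaro N x y - p y)"
      by (simp add: cesaro_def sum_subtractf field_simps)
    then have "\<bar>\<Sum>n<N. Kpow K n x y - p y\<bar> = real N * \<bar>cesaro N x y - p y\<bar>" by (simp add: abs_mult)
    also have "\<dots> \<le> real N * \<epsilon>" using N0[of N] True by (intro mult_left_mono) auto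
    finally show ?thesis by (simp add: mult.commute)
  next
    case False
    have "\<bar>\<Sum>n<N. Kpow K n x y - p y\<bar> \<le> (\<Sum>n<N. 1)"
    proof (rule order_trans[OF sum_abs sum_mono])
      show "\<bar>Kpow K n x y - p y\<bar> \<le> 1" for n
        using Kpow_nonneg[of n x y] Kpow_le_1[of n x y] p_nonneg[of y] p1 by (simp add: abs_le_iff)
    qed
    also have "\<dots> \<le> real N0" using False by auto
    also have "\<dots> \<le> \<epsilon> * real N + real N0" using assms(2) by simp
    finally show ?thesis .
  qed
  then show ?thesis using that[of "real N0"] by simp
qed

definition cov :: "int \<Rightarrow> int \<Rightarrow> (int \<Rightarrow> 'a) \<Rightarrow> nat \<Rightarrow> nat \<Rightarrow> real" where
  "cov lo hi x s t = prob (occurs lo hi x s \<inter> occurs lo hi x t) - (prob (occurs lo hi x 0))\<^sup>2"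

lemma abs_cov_le: "\<bar>cov lo hi x s t\<bar> \<le> 1"
proof -
  have "(prob (occurs lo hi x 0))\<^sup>2 \<le> 1" by (intro power_le_one) auto
  moreover have "0 \<le> (prob (occurs lo hi x 0))\<^sup>2" by simp
  moreover have "prob (occurs lo hi x s \<inter> occurs lo hi x t) \<le> 1" "0 \<le> prob (occurs lo hi x s \<inter> occurs lo hi x t)" by auto
  ultimately show ?thesis unfolding cov_def by linarith
qed

lemma sum_cov_bound:
  assumes lh: "lo \<le> hi" and eps: "\<epsilon> > 0"
  obtains C where "0 \<le> C" "\<And>T. \<bar>\<Sum>s<T. cov lo hi x s T\<bar> \<le> \<epsilon> * real T + C"
proof -
  define L where "L = nat (hi - lo)"
  define q where "q = prob (occurs lo hi x 0)"
  define w where "w = (\<Prod>i\<in>{lo..hi - 1}. K (x i) (x (i + 1)))"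
  have K1: "K u v \<le> 1" for u v using Kpow_le_1[of 1 u v] by (simp add: of_bool_def if_distrib cong: if_cong)
  have w: "0 \<le> w" "w \<le> 1" unfolding w_def using K_nonneg K1 by (auto intro: prod_nonneg prod_le_1)
  have q: "q = p (x lo) * w" unfolding q_def w_def using prob_occurs[OF lh] by simp
  have q01: "0 \<le> q" "q \<le> 1" by (auto simp: q_def)
  have cov: "cov lo hi x s (s + L + 1 + d) = q * w * (Kpow K (Suc d) (x hi) (x lo) - p (x lo))" for s d
  proof -
    have "int (s + L + 1 + d) = int s + (hi - lo) + 1 + int d" using lh by (simp add: L_def)
    from prob_occurs_twice[OF lh this, of x] show ?thesis
      unfolding cov_def q_def[symmetric] w_def[symmetric] using q by (simp add: power2_eq_square algebra_simps)
  qed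
  obtain C where C: "0 \<le> C" "\<And>N. \<bar>q * w * (\<Sum>d<N. Kpow K (Suc d) (x hi) (x lo) - p (x lo))\<bar> \<le> \<epsilon> * real N + C"
  proof (cases "q = 0")
    case False
    have "q \<le> prob {\<omega>. \<omega> hi = x hi}"
      unfolding q_def using lh window_event[of "{hi}" "\<lambda>\<omega>. \<omega> hi = x hi"]
      by (intro finite_measure_mono) (auto simp: occurs_def window_fun_def)
    then have pos: "0 < p (x hi)" using False q01 by (simp add: prob_single)
    obtain C where C: "0 \<le> C" "\<And>N. \<bar>\<Sum>n<N. Kpow K n (x hi) (x lo) - p (x lo)\<bar> \<le> \<epsilon> * real N + C"
      using sum_Kpow_deviation_bound[OF pos eps, of "x lo"] by blast
    show ?thesis
    proof (rule that[of "C + \<epsilon> + 1"])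
      fix N
      let ?f = "\<lambda>n. Kpow K n (x hi) (x lo) - p (x lo)"
      have "\<bar>\<Sum>d<N. ?f (Suc d)\<bar> \<le> \<epsilon> * real N + (C + \<epsilon> + 1)"
      proof -
        have "(\<Sum>n<Suc N. ?f n) = ?f 0 + (\<Sum>d<N. ?f (Suc d))" by (rule sum.lessThan_Suc_shift)
        moreover have "\<bar>?f 0\<bar> \<le> 1"
          using Kpow_nonneg[of 0 "x hi" "x lo"] Kpow_le_1[of 0 "x hi" "x lo"] prob_single[of 0 "x lo", symmetric] by simp
        ultimately show ?thesis using C(2)[of "Suc N"] by (simp add: algebra_simps del: sum.lessThan_Suc)
      qed
      moreover have "\<bar>q * w * (\<Sum>d<N. ?f (Suc d))\<bar> \<le> \<bar>\<Sum>d<N. ?f (Suc d)\<bar>"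
      proof -
        have "q * w \<le> 1" using q01 w by (simp add: mult_le_one)
        then show ?thesis using q01 w by (simp add: abs_mult mult_left_le_one_le)
      qed
      ultimately show "\<bar>q * w * (\<Sum>d<N. ?f (Suc d))\<bar> \<le> \<epsilon> * real N + (C + \<epsilon> + 1)" by linarith
    qed (use C eps in auto)
  qed (use eps in \<open>auto intro!: that[of 0]\<close>)
  show ?thesis
  proof (rule that[of "C + real L + 1"])
    fix T
    show "\<bar>\<Sum>s<T. cov lo hi x s T\<bar> \<le> \<epsilon> * real T + (C + real L + 1)"
    proof (cases "T \<ge> L + 1")
      case False
      have "\<bar>\<Sum>s<T. cov lo hi x s T\<bar> \<le> (\<Sum>s<T. 1)" by (rule order_trans[OF sum_abs sum_mono]) (rule abs_cov_le)
      then have "\<bar>\<Sum>s<T. cov lo hi x s T\<bar> \<le> real L" using False by simp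
      moreover have "0 \<le> \<epsilon> * real T" using eps by simp
      ultimately show ?thesis using C(1) by linarith
    next
      case True
      define N where "N = T - L"
      have N: "T = N + L" using True by (simp add: N_def)
      have "(\<Sum>s<T. cov lo hi x s T) = (\<Sum>s<N. cov lo hi x s T) + (\<Sum>s\<in>{N..<T}. cov lo hi x s T)"
        unfolding lessThan_atLeast0 by (rule sum.atLeastLessThan_concat[symmetric]) (auto simp: N)
      moreover have "(\<Sum>s<N. cov lo hi x s T) = q * w * (\<Sum>d<N. Kpow K (Suc d) (x hi) (x lo) - p (x lo))"
      proof -
        have "(\<Sum>s<N. cov lo hi x s T) = (\<Sum>s<N. q * w * (Kpow K (Suc (N - Suc s)) (x hi) (x lo) - p (x lo)))"
        proof (rule sum.cong[OF refl])
          fix s assume "s \<in> {..<N}"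
          then have "T = s + L + 1 + (N - Suc s)" using N by auto
          then show "cov lo hi x s T = q * w * (Kpow K (Suc (N - Suc s)) (x hi) (x lo) - p (x lo))"
            using cov[of s "N - Suc s"] by simp
        qed
        also have "\<dots> = (\<Sum>d<N. q * w * (Kpow K (Suc d) (x hi) (x lo) - p (x lo)))"
          by (rule sum.nat_diff_reindex)
        finally show ?thesis by (simp add: sum_distrib_left)
      qed
      moreover have "\<bar>\<Sum>s\<in>{N..<T}. cov lo hi x s T\<bar> \<le> real L"
      proof -
        have "\<bar>\<Sum>s\<in>{N..<T}. cov lo hi x s T\<bar> \<le> (\<Sum>s\<in>{N..<T}. 1)" by (rule order_trans[OF sum_abs sum_mono]) (rule abs_cov_le)
        then show ?thesis by (simp add: N)
      qed
      moreover have "\<epsilon> * real N \<le> \<epsilon> * real T" using eps N by simp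
      ultimately show ?thesis using C(2)[of N] by linarith
    qed
  qed (use C in auto)
qed

lemma sum_sum_cov_bound:
  assumes lh: "lo \<le> hi" and eps: "\<epsilon> > 0"
  obtains C where "\<And>T. (\<Sum>s<T. \<Sum>t<T. cov lo hi x s t) \<le> \<epsilon> * (real T)\<^sup>2 + C * real T"
proof -
  obtain C where C: "0 \<le> C" "\<And>T. \<bar>\<Sum>s<T. cov lo hi x s T\<bar> \<le> \<epsilon> * real T + C"
    using sum_cov_bound[OF assms] by blast
  have "(\<Sum>s<T. \<Sum>t<T. cov lo hi x s t) \<le> \<epsilon> * (real T)\<^sup>2 + (2 * C + 1) * real T" for T
  proof (induction T)
    case (Suc T)
    have sym: "cov lo hi x s t = cov lo hi x t s" for s t by (simp add: cov_def Int_commute)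
    have "(\<Sum>s<Suc T. \<Sum>t<Suc T. cov lo hi x s t) =
      (\<Sum>s<T. \<Sum>t<T. cov lo hi x s t) + 2 * (\<Sum>s<T. cov lo hi x s T) + cov lo hi x T T"
    proof -
      have "(\<Sum>t<T. cov lo hi x T t) = (\<Sum>t<T. cov lo hi x t T)" by (intro sum.cong refl sym)
      then show ?thesis by (simp add: sum.distrib)
    qed
    also have "\<dots> \<le> (\<epsilon> * (real T)\<^sup>2 + (2 * C + 1) * real T) + 2 * (\<epsilon> * real T + C) + 1"
      using Suc abs_le_D1[OF C(2)[of T]] abs_le_D1[OF abs_cov_le[of lo hi x T T]]
      by (intro add_mono mult_left_mono) auto
    also have "\<dots> \<le> \<epsilon> * (real (Suc T))\<^sup>2 + (2 * C + 1) * real (Suc T)"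
      using eps by (simp add: power2_eq_square algebra_simps)
    finally show ?case .
  qed simp
  then show ?thesis using that by blast
qed

lemma freq_variance:
  assumes lh: "lo \<le> hi"
  shows "expectation (freq lo hi x T) = (if T = 0 then 0 else prob (occurs lo hi x 0))"
    and "variance (freq lo hi x T) = (\<Sum>s<T. \<Sum>t<T. cov lo hi x s t) / (real T)\<^sup>2"
proof -
  define q where "q = prob (occurs lo hi x 0)"
  have q: "prob (occurs lo hi x t) = q" for t unfolding q_def using prob_occurs[OF lh] by simp
  have int [simp]: "integrable M (indicator (occurs lo hi x t) :: _ \<Rightarrow> real)" for t
    by (rule integrable_real_indicator) (auto simp: emeasure_eq_measure)
  have int2 [simp]: "integrable M (\<lambda>\<omega>. indicator (occurs lo hi x s) \<omega> * indicator (occurs lo hi x t) \<omega> :: real)" for s t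
    unfolding indicator_inter_arith[symmetric] by (rule integrable_real_indicator) (auto simp: emeasure_eq_measure)
  have "expectation (freq lo hi x T) = (\<Sum>t<T. q) / real T"
    unfolding freq_def by (simp add: Bochner_Integration.integral_sum q space_M)
  then show E: "expectation (freq lo hi x T) = (if T = 0 then 0 else prob (occurs lo hi x 0))" by (simp add: q)
  let ?g = "\<lambda>t \<omega>. indicator (occurs lo hi x t) \<omega> - q"
  have g: "expectation (\<lambda>\<omega>. ?g s \<omega> * ?g t \<omega>) = cov lo hi x s t" for s t
  proof -
    have "(\<lambda>\<omega>. ?g s \<omega> * ?g t \<omega>) = (\<lambda>\<omega>. indicator (occurs lo hi x s) \<omega> * indicator (occurs lo hi x t) \<omega>
      - q * indicator (occurs lo hi x s) \<omega> - q * indicator (occurs lo hi x t) \<omega> + q\<^sup>2)"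
      by (auto simp: algebra_simps power2_eq_square)
    moreover have "expectation (\<lambda>\<omega>. indicator (occurs lo hi x s) \<omega> * indicator (occurs lo hi x t) \<omega>) = prob (occurs lo hi x s \<inter> occurs lo hi x t)"
      unfolding indicator_inter_arith[symmetric] by (simp add: space_M)
    ultimately show ?thesis by (simp add: q space_M cov_def prob_space[unfolded space_M] power2_eq_square)
  qed
  have gint: "integrable M (\<lambda>\<omega>. ?g s \<omega> * ?g t \<omega>)" for s t
    by (simp add: algebra_simps)
  show "variance (freq lo hi x T) = (\<Sum>s<T. \<Sum>t<T. cov lo hi x s t) / (real T)\<^sup>2"
  proof (cases "T = 0")
    case False
    have "(freq lo hi x T \<omega> - q)\<^sup>2 = (\<Sum>s<T. \<Sum>t<T. ?g s \<omega> * ?g t \<omega>) / (real T)\<^sup>2" for \<omega>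
    proof -
      have "freq lo hi x T \<omega> - q = (\<Sum>t<T. ?g t \<omega>) / real T"
        using False by (simp add: freq_def sum_subtractf field_simps)
      then show ?thesis by (simp add: power_divide) (simp add: power2_eq_square sum_product)
    qed
    then have "variance (freq lo hi x T) = expectation (\<lambda>\<omega>. (\<Sum>s<T. \<Sum>t<T. ?g s \<omega> * ?g t \<omega>) / (real T)\<^sup>2)"
      unfolding E q using False by simp
    also have "\<dots> = (\<Sum>s<T. \<Sum>t<T. cov lo hi x s t) / (real T)\<^sup>2"
      using gint by (simp add: Bochner_Integration.integral_sum Bochner_Integration.integrable_sum g)
    finally show ?thesis .
  qed (simp add: freq_def[abs_def])
qed

lemma freq_tendsto_in_prob:
  assumes lh: "lo \<le> hi" and eta: "\<eta> > 0"
  shows "(\<lambda>T. prob {\<omega>\<in>space M. \<eta> \<le> \<bar>freq lo hi x T \<omega> - prob (occurs lo hi x 0)\<bar>}) \<longlonglongrightarrow> 0"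
proof (rule LIMSEQ_I)
  fix \<delta> :: real assume "\<delta> > 0"
  define \<epsilon> where "\<epsilon> = \<delta> * \<eta>\<^sup>2 / 2"
  have eps: "\<epsilon> > 0" using eta \<open>\<delta> > 0\<close> by (simp add: \<epsilon>_def)
  obtain C where C: "\<And>T. (\<Sum>s<T. \<Sum>t<T. cov lo hi x s t) \<le> \<epsilon> * (real T)\<^sup>2 + C * real T"
    using sum_sum_cov_bound[OF lh eps] by blast
  obtain T0 :: nat where T0: "C / \<epsilon> < real T0" using reals_Archimedean2 by blast
  show "\<exists>no. \<forall>T\<ge>no. norm (prob {\<omega>\<in>space M. \<eta> \<le> \<bar>freq lo hi x T \<omega> - prob (occurs lo hi x 0)\<bar>} - 0) < \<delta>"
  proof (intro exI allI impI)
    fix T assume T: "Suc T0 \<le> T"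
    then have T': "0 < real T" "C / \<epsilon> < real T" using T0 by auto
    have [measurable]: "freq lo hi x T \<in> borel_measurable M" unfolding freq_def by measurable
    have "integrable M (\<lambda>\<omega>. (freq lo hi x T \<omega>)\<^sup>2)"
    proof (rule integrable_const_bound[where B = 1])
      have "\<bar>freq lo hi x T \<omega>\<bar> \<le> 1" for \<omega>
      proof -
        have "(\<Sum>t<T. indicator (occurs lo hi x t) \<omega>) \<le> (\<Sum>t<T. 1 :: real)" by (intro sum_mono) (auto simp: indicator_def)
        moreover have "0 \<le> (\<Sum>t<T. indicator (occurs lo hi x t) \<omega> :: real)" by (intro sum_nonneg) auto
        ultimately show ?thesis using T' by (simp add: freq_def)
      qed
      then show "AE \<omega> in M. norm ((freq lo hi x T \<omega>)\<^sup>2) \<le> 1" by (simp add: abs_square_le_1)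
    qed measurable
    from Chebyshev_inequality[OF _ this eta]
    have "prob {\<omega>\<in>space M. \<eta> \<le> \<bar>freq lo hi x T \<omega> - prob (occurs lo hi x 0)\<bar>} \<le>
      (\<Sum>s<T. \<Sum>t<T. cov lo hi x s t) / (real T)\<^sup>2 / \<eta>\<^sup>2"
      unfolding freq_variance(2)[OF lh] unfolding freq_variance(1)[OF lh] using T' by simp
    also have "\<dots> \<le> (\<epsilon> * (real T)\<^sup>2 + C * real T) / (real T)\<^sup>2 / \<eta>\<^sup>2"
      by (intro divide_right_mono C) auto
    also have "\<dots> = (\<epsilon> + C / real T) / \<eta>\<^sup>2" using T' by (simp add: add_divide_distrib power2_eq_square)
    also have "\<dots> < (\<epsilon> + \<epsilon>) / \<eta>\<^sup>2"
      using T' eps eta by (intro divide_strict_right_mono add_strict_left_mono) (auto simp: field_simps)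
    also have "\<dots> = \<delta>" using eta by (simp add: \<epsilon>_def)
    finally show "norm (prob {\<omega>\<in>space M. \<eta> \<le> \<bar>freq lo hi x T \<omega> - prob (occurs lo hi x 0)\<bar>} - 0) < \<delta>" by simp
  qed
qed

definition freq_dev :: "int \<Rightarrow> int \<Rightarrow> nat \<Rightarrow> (int \<Rightarrow> 'a) \<Rightarrow> real" where
  "freq_dev lo hi T \<omega> = (\<Sum>x\<in>PiE {lo..hi} (\<lambda>_. UNIV). \<bar>freq lo hi x T \<omega> - prob (occurs lo hi x 0)\<bar>)"

lemma freq_dev_tendsto_in_prob:
  assumes lh: "lo \<le> hi" and eta: "\<eta> > 0"
  shows "(\<lambda>T. prob {\<omega>\<in>space M. \<eta> \<le> freq_dev lo hi T \<omega>}) \<longlonglongrightarrow> 0"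
proof -
  let ?X = "PiE {lo..hi} (\<lambda>_. UNIV :: 'a set)"
  have fin: "finite ?X" by (simp add: finite_PiE)
  define \<eta>' where "\<eta>' = \<eta> / (real (card ?X) + 1)"
  have eta': "\<eta>' > 0" using eta by (simp add: \<eta>'_def add_pos_pos)
  let ?B = "\<lambda>x T. {\<omega>\<in>space M. \<eta>' \<le> \<bar>freq lo hi x T \<omega> - prob (occurs lo hi x 0)\<bar>}"
  have [measurable]: "freq lo hi x T \<in> borel_measurable M" for x T unfolding freq_def by measurable
  have B: "?B x T \<in> sets M" for x T by measurable
  have le: "prob {\<omega>\<in>space M. \<eta> \<le> freq_dev lo hi T \<omega>} \<le> (\<Sum>x\<in>?X. prob (?B x T))" for T
  proof -
    have "{\<omega>\<in>space M. \<eta> \<le> freq_dev lo hi T \<omega>} \<subseteq> (\<Union>x\<in>?X. ?B x T)"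
    proof (rule subsetI, rule ccontr)
      fix \<omega> assume 1: "\<omega> \<in> {\<omega>\<in>space M. \<eta> \<le> freq_dev lo hi T \<omega>}" and 2: "\<omega> \<notin> (\<Union>x\<in>?X. ?B x T)"
      have "freq_dev lo hi T \<omega> \<le> (\<Sum>x\<in>?X. \<eta>')"
        unfolding freq_dev_def using 1 2 by (intro sum_mono) force
      also have "\<dots> < \<eta>" using eta by (simp add: \<eta>'_def field_simps)
      finally show False using 1 by simp
    qed
    then have "prob {\<omega>\<in>space M. \<eta> \<le> freq_dev lo hi T \<omega>} \<le> prob (\<Union>x\<in>?X. ?B x T)"
      using B fin by (intro finite_measure_mono) auto
    also have "\<dots> \<le> (\<Sum>x\<in>?X. prob (?B x T))" using B fin by (intro finite_measure_subadditive_finite) auto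
    finally show ?thesis .
  qed
  have "(\<lambda>T. \<Sum>x\<in>?X. prob (?B x T)) \<longlonglongrightarrow> (\<Sum>x\<in>?X. 0)"
    by (intro tendsto_sum freq_tendsto_in_prob[OF lh eta'])
  then have lim: "(\<lambda>T. \<Sum>x\<in>?X. prob (?B x T)) \<longlonglongrightarrow> 0" by simp
  show ?thesis
    by (rule tendsto_sandwich[OF _ _ tendsto_const lim]) (auto intro!: always_eventually le)
qed

lemma time_average_dev:
  fixes F :: "(int \<Rightarrow> 'a) \<Rightarrow> real"
  assumes lh: "lo \<le> hi" and F: "window_fun {lo..hi} F" "\<And>\<omega>. \<bar>F \<omega>\<bar> \<le> C" and T: "T \<noteq> 0"
  shows "\<bar>(\<Sum>t<T. F (\<lambda>i. \<omega> (i + int t))) / real T - (\<integral>\<omega>. F \<omega> \<partial>M)\<bar> \<le> C * freq_dev lo hi T \<omega>"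
proof -
  let ?X = "PiE {lo..hi} (\<lambda>_. UNIV :: 'a set)"
  have fin: "finite {lo..hi}" by simp
  have "F (\<lambda>i. \<omega> (i + int t)) = (\<Sum>x\<in>?X. F x * indicator (occurs lo hi x t) \<omega>)" for t
    by (subst window_fun_eq_sum[OF fin F(1)]) (auto simp: cyl_def occurs_def indicator_def intro!: sum.cong)
  then have "(\<Sum>t<T. F (\<lambda>i. \<omega> (i + int t))) / real T = (\<Sum>x\<in>?X. F x * freq lo hi x T \<omega>)"
    unfolding freq_def by (simp, subst sum.swap) (simp add: sum_distrib_left sum_divide_distrib)
  moreover have "(\<integral>\<omega>. F \<omega> \<partial>M) = (\<Sum>x\<in>?X. F x * prob (occurs lo hi x 0))"
    by (simp add: window_fun_integral[OF fin F(1)] occurs_eq_cyl)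
  ultimately have "(\<Sum>t<T. F (\<lambda>i. \<omega> (i + int t))) / real T - (\<integral>\<omega>. F \<omega> \<partial>M) =
    (\<Sum>x\<in>?X. F x * (freq lo hi x T \<omega> - prob (occurs lo hi x 0)))"
    by (simp add: sum_subtractf algebra_simps)
  also have "\<bar>\<dots>\<bar> \<le> (\<Sum>x\<in>?X. C * \<bar>freq lo hi x T \<omega> - prob (occurs lo hi x 0)\<bar>)"
    by (rule order_trans[OF sum_abs sum_mono]) (auto simp: abs_mult intro!: mult_right_mono F(2))
  finally show ?thesis by (simp add: freq_dev_def sum_distrib_left)
qed

end

section \<open>The chain of states, actions and options\<close>

lemma sum_UNIV_prod: "(\<Sum>x\<in>(UNIV :: ('x::finite \<times> 'y::finite) set). f x) = (\<Sum>a\<in>UNIV. \<Sum>b\<in>UNIV. f (a, b))"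
  by (simp add: sum.cartesian_product)

lemma extreme_point_convex_combination:
  fixes v :: "'x::finite \<Rightarrow> 'e::real_vector"
  assumes e: "e extreme_point_of S" and S: "convex S" and v: "\<And>x. v x \<in> S"
    and p: "\<And>x. 0 \<le> p x" "(\<Sum>x\<in>UNIV. p x) = 1" and eq: "(\<Sum>x\<in>UNIV. p x *\<^sub>R v x) = e"
    and x: "0 < p x"
  shows "v x = e"
proof -
  let ?U = "UNIV - {x}"
  have split: "p x + (\<Sum>y\<in>?U. p y) = 1" "p x *\<^sub>R v x + (\<Sum>y\<in>?U. p y *\<^sub>R v y) = e"
    using p(2) eq by (simp_all add: sum.remove[of UNIV x])
  show ?thesis
  proof (cases "p x = 1")
    case True
    then have "(\<Sum>y\<in>?U. p y) = 0" using split by simp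
    then have "p y = 0" if "y \<in> ?U" for y using that p by (simp add: sum_nonneg_eq_0_iff)
    then have "(\<Sum>y\<in>?U. p y *\<^sub>R v y) = 0" by (intro sum.neutral) auto
    then show ?thesis using split True by simp
  next
    case False
    have s0: "0 \<le> (\<Sum>y\<in>?U. p y)" by (intro sum_nonneg p)
    then have lt: "p x < 1" using split(1) False by linarith
    define b where "b = (\<Sum>y\<in>?U. (p y / (1 - p x)) *\<^sub>R v y)"
    have b: "b \<in> S"
      unfolding b_def using split(1) lt p v
      by (intro convex_sum S) (auto simp: sum_divide_distrib[symmetric] field_simps)
    have "(1 - p x) *\<^sub>R b = (\<Sum>y\<in>?U. p y *\<^sub>R v y)" unfolding b_def using lt by (simp add: scaleR_sum_right)
    then have e_eq: "e = (1 - (1 - p x)) *\<^sub>R v x + (1 - p x) *\<^sub>R b" using split(2) by simp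
    have "e \<notin> open_segment (v x) b" using e v b by (simp add: extreme_point_of_def)
    moreover have "0 < 1 - p x" "1 - p x < 1" using lt x by auto
    ultimately have "v x = b" using e_eq unfolding in_segment by blast
    then show ?thesis using e_eq by (simp add: scaleR_left_distrib[symmetric])
  qed
qed

lemma stationary_dists_balance:
  "w \<in> stationary_dists Mo th \<Longrightarrow> (\<Sum>x\<in>UNIV. w $ x * os_kernel Mo th x y) = w $ y"
  unfolding stationary_dists_def by blast

lemma convex_stationary_dists: "convex (stationary_dists Mo th)"
proof (rule convexI)
  fix x y and u v :: real
  assume x: "x \<in> stationary_dists Mo th" and y: "y \<in> stationary_dists Mo th" and uv: "0 \<le> u" "0 \<le> v" "u + v = 1"
  have "(\<Sum>z\<in>UNIV. (u * x $ z + v * y $ z) * os_kernel Mo th z w) = u * x $ w + v * y $ w" for w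
  proof -
    have "(\<Sum>z\<in>UNIV. (u * x $ z + v * y $ z) * os_kernel Mo th z w) =
      u * (\<Sum>z\<in>UNIV. x $ z * os_kernel Mo th z w) + v * (\<Sum>z\<in>UNIV. y $ z * os_kernel Mo th z w)"
      by (simp add: sum_distrib_left sum.distrib[symmetric] algebra_simps)
    then show ?thesis by (simp add: stationary_dists_balance[OF x] stationary_dists_balance[OF y])
  qed
  moreover have "(\<Sum>z\<in>UNIV. u * x $ z + v * y $ z) = 1"
    using x y uv by (simp add: stationary_dists_def sum.distrib sum_distrib_left[symmetric])
  ultimately show "u *\<^sub>R x + v *\<^sub>R y \<in> stationary_dists Mo th"
    using x y uv by (simp add: stationary_dists_def)
qed

locale owf_setting =
  fixes Mo :: "('h::euclidean_space, 'l::euclidean_space, 'b::euclidean_space,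
                's::finite, 'a::finite, 'o::finite) owf_model"
    and \<Theta> \<Theta>' :: "('h \<times> 'l \<times> 'b) set"
    and th_star :: "'h \<times> 'l \<times> 'b"
    and \<nu> :: "real ^ ('o \<times> 's)"
    and M :: "('s, 'a, 'o) path measure"
    and c0 :: real
  assumes zeta: "0 < zeta Mo" "zeta Mo < 1"
    and kern: "\<And>s a s'. kern Mo s a s' \<ge> 0" "\<And>s a. (\<Sum>s'\<in>UNIV. kern Mo s a s') = 1"
    and pmf_hi: "\<And>th s. th \<in> \<Theta>' \<Longrightarrow> (\<Sum>oc\<in>UNIV. pi_hi Mo (th_hi th) s oc) = 1"
    and pmf_lo: "\<And>th s oc. th \<in> \<Theta>' \<Longrightarrow> (\<Sum>a\<in>UNIV. pi_lo Mo (th_lo th) s oc a) = 1"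
    and pmf_b: "\<And>th s oc. th \<in> \<Theta>' \<Longrightarrow> (\<Sum>b\<in>UNIV. pi_b Mo (th_b th) s oc b) = 1"
    and Theta_sub: "\<Theta> \<subseteq> \<Theta>'"
    and pos_hi: "\<And>th s oc. th \<in> \<Theta>' \<Longrightarrow> pi_hi Mo (th_hi th) s oc > 0"
    and pos_lo: "\<And>th s oc a. th \<in> \<Theta>' \<Longrightarrow> pi_lo Mo (th_lo th) s oc a > 0"
    and pos_b: "\<And>th s oc b. th \<in> \<Theta>' \<Longrightarrow> pi_b Mo (th_b th) s oc b > 0"
    and C1_hi: "\<And>s oc. C1_on (\<lambda>th. pi_hi Mo (th_hi th) s oc) \<Theta>'"
    and C1_lo: "\<And>s oc a. C1_on (\<lambda>th. pi_lo Mo (th_lo th) s oc a) \<Theta>'"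
    and C1_b: "\<And>s oc b. C1_on (\<lambda>th. pi_b Mo (th_b th) s oc b) \<Theta>'"
    and th_star: "th_star \<in> \<Theta>"
    and extreme: "\<nu> extreme_point_of (stationary_dists Mo th_star)"
    and law: "is_stationary_law Mo th_star (\<lambda>x. \<nu> $ x) M"
    and c0_pos: "0 < c0"
    and c0_hi: "\<And>th s oc. th \<in> \<Theta> \<Longrightarrow> c0 \<le> pi_hi Mo (th_hi th) s oc"
    and c0_lo: "\<And>th s oc a. th \<in> \<Theta> \<Longrightarrow> c0 \<le> pi_lo Mo (th_lo th) s oc a"
    and c0_b: "\<And>th s oc b. th \<in> \<Theta> \<Longrightarrow> c0 \<le> pi_b Mo (th_b th) s oc b"
    and c0_zeta: "c0 \<le> zeta Mo / real CARD('o)"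
begin

lemma Theta': "th \<in> \<Theta> \<Longrightarrow> th \<in> \<Theta>'"
  using Theta_sub by blast

lemma pi_le_1:
  assumes "th \<in> \<Theta>'"
  shows "pi_hi Mo (th_hi th) s oc \<le> 1" "pi_lo Mo (th_lo th) s oc a \<le> 1" "pi_b Mo (th_b th) s oc b \<le> 1"
  using member_le_sum[of oc UNIV "pi_hi Mo (th_hi th) s"] member_le_sum[of a UNIV "pi_lo Mo (th_lo th) s oc"]
    member_le_sum[of b UNIV "pi_b Mo (th_b th) s oc"] pmf_hi[OF assms] pmf_lo[OF assms] pmf_b[OF assms]
    pos_hi[OF assms] pos_lo[OF assms] pos_b[OF assms]
  by (simp_all add: less_imp_le)

lemma zeta_card: "0 < zeta Mo / real CARD('o)" "zeta Mo / real CARD('o) \<le> 1" "zeta Mo / real CARD('o) \<le> zeta Mo"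
proof -
  have "1 \<le> real CARD('o)" by simp
  then show "0 < zeta Mo / real CARD('o)" "zeta Mo / real CARD('o) \<le> zeta Mo" using zeta by (auto simp: field_simps)
  then show "zeta Mo / real CARD('o) \<le> 1" using zeta by linarith
qed

lemma pibar_pos: "th \<in> \<Theta>' \<Longrightarrow> 0 < pibar_hi Mo (th_hi th) s i b j"
  using pos_hi[of th s j] zeta_card zeta by (simp add: pibar_hi_def add_pos_pos)

lemma pibar_le_1: "th \<in> \<Theta>' \<Longrightarrow> pibar_hi Mo (th_hi th) s i b j \<le> 1"
  using pi_le_1(1)[of th s j] zeta_card by (simp add: pibar_hi_def)

lemma pibar_ge: "th \<in> \<Theta> \<Longrightarrow> c0 \<le> pibar_hi Mo (th_hi th) s i b j"
  using c0_hi[of th s j] c0_zeta zeta by (simp add: pibar_hi_def)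

lemma pibar_sum:
  assumes "th \<in> \<Theta>'"
  shows "(\<Sum>j\<in>UNIV. pibar_hi Mo (th_hi th) s i b j) = 1"
proof (cases b)
  case False
  then have "(\<Sum>j\<in>UNIV. pibar_hi Mo (th_hi th) s i b j) = (\<Sum>j\<in>UNIV. zeta Mo / real CARD('o) + (if j = i then 1 - zeta Mo else 0))"
    by (intro sum.cong) (auto simp: pibar_hi_def)
  also have "\<dots> = 1" by (simp add: sum.distrib)
  finally show ?thesis .
qed (simp add: pibar_hi_def pmf_hi[OF assms])

lemma step_prob_sum:
  assumes "th \<in> \<Theta>'"
  shows "(\<Sum>a\<in>UNIV. \<Sum>j\<in>UNIV. \<Sum>b\<in>UNIV. step_prob Mo th s a i j b) = 1"
proof -
  have "(\<Sum>a\<in>UNIV. \<Sum>j\<in>UNIV. \<Sum>b\<in>UNIV. step_prob Mo th s a i j b) =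
    (\<Sum>j\<in>UNIV. \<Sum>b\<in>UNIV. \<Sum>a\<in>UNIV. step_prob Mo th s a i j b)"
    by (subst sum.swap, intro sum.cong refl sum.swap)
  also have "\<dots> = (\<Sum>j\<in>UNIV. \<Sum>b\<in>UNIV. pi_b Mo (th_b th) s i b * pibar_hi Mo (th_hi th) s i b j)"
    unfolding step_prob_def sum_distrib_left[symmetric] by (simp add: pmf_lo[OF assms])
  also have "\<dots> = (\<Sum>b\<in>UNIV. pi_b Mo (th_b th) s i b * (\<Sum>j\<in>UNIV. pibar_hi Mo (th_hi th) s i b j))"
    by (subst sum.swap) (simp add: sum_distrib_left)
  finally show ?thesis by (simp add: pibar_sum[OF assms] pmf_b[OF assms])
qed

lemma step_prob_pos_ext: "th \<in> \<Theta>' \<Longrightarrow> 0 < step_prob Mo th s a i j b"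
  using pos_b pos_lo pibar_pos by (simp add: step_prob_def)

sublocale mixing_params Mo \<Theta> "c0 ^ 3"
proof
  have "c0 \<le> 1" using c0_zeta zeta_card by linarith
  then show "c0 ^ 3 \<le> 1" using c0_pos by (intro power_le_one) auto
  show "0 < c0 ^ 3" using c0_pos by simp
  show "0 \<le> kern Mo s a s'" for s a s' by (rule kern)
  fix th s a i j assume th: "th \<in> \<Theta>"
  show "c0 ^ 3 \<le> step_prob Mo th s a i j b" for b
  proof -
    have "c0 * c0 * c0 \<le> step_prob Mo th s a i j b"
      unfolding step_prob_def using c0_pos c0_b[OF th] c0_lo[OF th] pibar_ge[OF th] less_imp_le[OF pos_b[OF Theta'[OF th]]]
        less_imp_le[OF pibar_pos[OF Theta'[OF th]]]
      by (intro mult_mono mult_nonneg_nonneg) auto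
    then show ?thesis by (simp add: power3_eq_cube)
  qed
  have "tot_mat Mo th s a i j \<le> (\<Sum>b\<in>UNIV. pi_b Mo (th_b th) s i b)"
  proof -
    have "step_prob Mo th s a i j b \<le> pi_b Mo (th_b th) s i b * 1 * 1" for b
      unfolding step_prob_def using less_imp_le[OF pos_b[OF Theta'[OF th]]] less_imp_le[OF pibar_pos[OF Theta'[OF th]]]
        less_imp_le[OF pos_lo[OF Theta'[OF th]]] pi_le_1[OF Theta'[OF th]] pibar_le_1[OF Theta'[OF th]]
      by (intro mult_mono) auto
    then show ?thesis unfolding ev_mat_def by (intro sum_mono) simp
  qed
  then show "tot_mat Mo th s a i j \<le> 1" using pmf_b[OF Theta'[OF th]] by simp
qed

definition K :: "'h \<times> 'l \<times> 'b \<Rightarrow> 's \<times> 'a \<times> 'o \<times> bool \<Rightarrow> 's \<times> 'a \<times> 'o \<times> bool \<Rightarrow> real" where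
  "K th = (\<lambda>(s, a, i, b) (s', a', i', b'). kern Mo s a s' * step_prob Mo th s' a' i i' b')"

definition p :: "'s \<times> 'a \<times> 'o \<times> bool \<Rightarrow> real" where
  "p = (\<lambda>(s, a, i, b). \<Sum>i'\<in>UNIV. \<nu> $ (i', s) * step_prob Mo th_star s a i' i b)"

lemma stochastic_K: "th \<in> \<Theta>' \<Longrightarrow> stochastic_kernel (K th)"
proof
  assume th: "th \<in> \<Theta>'"
  show "0 \<le> K th x y" for x y
    using less_imp_le[OF step_prob_pos_ext[OF th]] kern by (auto simp: K_def split: prod.splits)
  show "(\<Sum>y\<in>UNIV. K th x y) = 1" for x
  proof -
    obtain s a i b where x: "x = (s, a, i, b)" by (cases x)
    have "(\<Sum>y\<in>UNIV. K th x y) = (\<Sum>s'\<in>UNIV. kern Mo s a s' *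
      (\<Sum>a'\<in>UNIV. \<Sum>i'\<in>UNIV. \<Sum>b'\<in>UNIV. step_prob Mo th s' a' i i' b'))"
      unfolding x K_def sum_UNIV_prod by (simp add: sum_distrib_left)
    then show ?thesis by (simp add: step_prob_sum[OF th] kern)
  qed
qed

lemma fd_prob_eq:
  assumes "m \<le> n"
  shows "fd_prob Mo th_star (\<lambda>x. \<nu> $ x) m n x = p (x m) * (\<Prod>t\<in>{m..n - 1}. K th_star (x t) (x (t + 1)))"
proof -
  let ?s = "obs_s x" and ?a = "obs_a x" and ?o = "path_o x" and ?b = "path_b x"
  have xt: "x t = (?s t, ?a t, ?o t, ?b t)" for t by (simp add: obs_s_def obs_a_def path_o_def path_b_def)
  have Kx: "K th_star (x t) (x (t + 1)) =
    kern Mo (?s t) (?a t) (?s (t + 1)) * step_prob Mo th_star (?s (t + 1)) (?a (t + 1)) (?o t) (?o (t + 1)) (?b (t + 1))" for t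
    by (subst (1 2) xt) (simp add: K_def)
  have "(\<Prod>t\<in>{m..n}. step_prob Mo th_star (?s t) (?a t) ((?o(m - 1 := i)) (t - 1)) ((?o(m - 1 := i)) t) (?b t)) =
    step_prob Mo th_star (?s m) (?a m) i (?o m) (?b m) *
    (\<Prod>t\<in>{m..n - 1}. step_prob Mo th_star (?s (t + 1)) (?a (t + 1)) (?o t) (?o (t + 1)) (?b (t + 1)))" for i
  proof -
    let ?f = "\<lambda>t. step_prob Mo th_star (?s t) (?a t) ((?o(m - 1 := i)) (t - 1)) ((?o(m - 1 := i)) t) (?b t)"
    have "{m..n} = insert m {m + 1..n}" using assms by auto
    then have "prod ?f {m..n} = ?f m * prod ?f {m + 1..n}" by simp
    moreover have "prod ?f {m + 1..n} =
      (\<Prod>t\<in>{m..n - 1}. step_prob Mo th_star (?s (t + 1)) (?a (t + 1)) (?o t) (?o (t + 1)) (?b (t + 1)))"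
      by (rule prod.reindex_bij_witness[of _ "\<lambda>t. t + 1" "\<lambda>t. t - 1"]) auto
    ultimately show ?thesis by simp
  qed
  then have "fd_prob Mo th_star (\<lambda>x. \<nu> $ x) m n x = (\<Sum>i\<in>UNIV. kern_prod Mo m n ?s ?a *
    (\<nu> $ (i, ?s m) * (step_prob Mo th_star (?s m) (?a m) i (?o m) (?b m) *
    (\<Prod>t\<in>{m..n - 1}. step_prob Mo th_star (?s (t + 1)) (?a (t + 1)) (?o t) (?o (t + 1)) (?b (t + 1))))))"
    unfolding fd_prob_def joint_w_eq by simp
  also have "\<dots> = p (x m) * (\<Prod>t\<in>{m..n - 1}. K th_star (x t) (x (t + 1)))"
    unfolding Kx prod.distrib by (subst xt) (simp add: p_def kern_prod_def sum_distrib_right sum_distrib_left mult_ac)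
  finally show ?thesis .
qed

lemma path_space_M: "path_space M"
  using law by (simp add: is_stationary_law_def path_space_def path_space_axioms_def)

sublocale markov_path M "K th_star" p
proof -
  interpret path_space M by (rule path_space_M)
  interpret stochastic_kernel "K th_star" using stochastic_K Theta'[OF th_star] by blast
  show "markov_path M (K th_star) p"
  proof
    fix m n :: int and x :: "('s, 'a, 'o) path" assume "m \<le> n"
    then have "prob {\<omega> \<in> space M. \<forall>t\<in>{m..n}. \<omega> t = x t} = fd_prob Mo th_star (\<lambda>x. \<nu> $ x) m n x"
      using law by (simp add: is_stationary_law_def)
    then show "prob (cyl {m..n} x) = p (x m) * (\<Prod>t\<in>{m..n - 1}. K th_star (x t) (x (t + 1)))"
      using fd_prob_eq[OF \<open>m \<le> n\<close>] by (simp add: cyl_def space_M)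
  qed
qed

definition push :: "('s \<times> 'a \<times> 'o \<times> bool \<Rightarrow> real) \<Rightarrow> real ^ ('o \<times> 's)" where
  "push \<tau> = (\<chi> z. \<Sum>s\<in>UNIV. \<Sum>a\<in>UNIV. \<Sum>b\<in>UNIV. \<tau> (s, a, fst z, b) * kern Mo s a (snd z))"

lemma os_kernel_eq:
  "os_kernel Mo th (i, s) (j, s') = (\<Sum>a\<in>UNIV. \<Sum>b\<in>UNIV. step_prob Mo th s a i j b * kern Mo s a s')"
  unfolding os_kernel_def step_prob_def fst_conv snd_conv by (rule sum.swap)

lemma stationary_eq_push:
  assumes "stationary_pmf (K th_star) \<tau>"
  shows "\<tau> (s, a, i, b) = (\<Sum>i'\<in>UNIV. push \<tau> $ (i', s) * step_prob Mo th_star s a i' i b)"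
proof -
  have "\<tau> (s, a, i, b) = (\<Sum>x\<in>UNIV. \<tau> x * K th_star x (s, a, i, b))"
    using assms by (simp add: stationary_pmf_def)
  also have "\<dots> = (\<Sum>s0\<in>UNIV. \<Sum>a0\<in>UNIV. \<Sum>i'\<in>UNIV. \<Sum>b0\<in>UNIV.
      \<tau> (s0, a0, i', b0) * kern Mo s0 a0 s * step_prob Mo th_star s a i' i b)"
    unfolding sum_UNIV_prod K_def by (simp add: mult.assoc)
  also have "\<dots> = (\<Sum>i'\<in>UNIV. \<Sum>s0\<in>UNIV. \<Sum>a0\<in>UNIV. \<Sum>b0\<in>UNIV.
      \<tau> (s0, a0, i', b0) * kern Mo s0 a0 s * step_prob Mo th_star s a i' i b)"
    by (rule trans[OF sum.cong[OF refl sum.swap] sum.swap])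
  also have "\<dots> = (\<Sum>i'\<in>UNIV. push \<tau> $ (i', s) * step_prob Mo th_star s a i' i b)"
    by (simp add: push_def sum_distrib_right)
  finally show ?thesis .
qed

lemma sum_os_kernel:
  assumes "\<And>s a i b. \<tau> (s, a, i, b) = (\<Sum>i'\<in>UNIV. w $ (i', s) * step_prob Mo th_star s a i' i b)"
  shows "(\<Sum>x\<in>UNIV. w $ x * os_kernel Mo th_star x y) = push \<tau> $ y"
proof -
  obtain j s' where y: "y = (j, s')" by (cases y)
  have "(\<Sum>x\<in>UNIV. w $ x * os_kernel Mo th_star x y) =
    (\<Sum>i\<in>UNIV. \<Sum>s\<in>UNIV. \<Sum>a\<in>UNIV. \<Sum>b\<in>UNIV. w $ (i, s) * step_prob Mo th_star s a i j b * kern Mo s a s')"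
    unfolding sum_UNIV_prod y os_kernel_eq by (simp add: sum_distrib_left mult.assoc)
  also have "\<dots> = (\<Sum>s\<in>UNIV. \<Sum>a\<in>UNIV. \<Sum>b\<in>UNIV. \<Sum>i\<in>UNIV. w $ (i, s) * step_prob Mo th_star s a i j b * kern Mo s a s')"
    by (subst sum.swap, intro sum.cong refl, subst sum.swap, intro sum.cong refl sum.swap)
  also have "\<dots> = push \<tau> $ y"
    unfolding push_def y assms by (simp add: sum_distrib_right)
  finally show ?thesis .
qed

lemma push_stationary:
  assumes "stationary_pmf (K th_star) \<tau>"
  shows "push \<tau> \<in> stationary_dists Mo th_star"
proof -
  have "(\<Sum>z\<in>UNIV. push \<tau> $ z) = (\<Sum>i\<in>UNIV. \<Sum>s'\<in>UNIV. \<Sum>s\<in>UNIV. \<Sum>a\<in>UNIV. \<Sum>b\<in>UNIV. \<tau> (s, a, i, b) * kern Mo s a s')"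
    unfolding sum_UNIV_prod by (simp add: push_def)
  also have "\<dots> = (\<Sum>i\<in>UNIV. \<Sum>s\<in>UNIV. \<Sum>a\<in>UNIV. \<Sum>b\<in>UNIV. \<Sum>s'\<in>UNIV. \<tau> (s, a, i, b) * kern Mo s a s')"
    by (rule sum.cong[OF refl], rule trans[OF sum.swap], rule sum.cong[OF refl], rule trans[OF sum.swap],
        rule sum.cong[OF refl], rule sum.swap)
  also have "\<dots> = (\<Sum>i\<in>UNIV. \<Sum>s\<in>UNIV. \<Sum>a\<in>UNIV. \<Sum>b\<in>UNIV. \<tau> (s, a, i, b))"
    unfolding sum_distrib_left[symmetric] by (simp add: kern)
  also have "\<dots> = (\<Sum>x\<in>UNIV. \<tau> x)"
    unfolding sum_UNIV_prod by (subst sum.swap, intro sum.cong refl sum.swap)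
  also have "\<dots> = 1" using assms by (simp add: stationary_pmf_def)
  finally have "(\<Sum>z\<in>UNIV. push \<tau> $ z) = 1" .
  moreover have "0 \<le> push \<tau> $ z" for z
    using assms kern unfolding push_def stationary_pmf_def by (auto intro!: sum_nonneg mult_nonneg_nonneg)
  moreover have "(\<Sum>x\<in>UNIV. push \<tau> $ x * os_kernel Mo th_star x y) = push \<tau> $ y" for y
    by (rule sum_os_kernel[OF stationary_eq_push[OF assms]])
  ultimately show ?thesis by (simp add: stationary_dists_def)
qed

lemma nu_stationary: "\<nu> \<in> stationary_dists Mo th_star"
  using extreme by (simp add: extreme_point_of_def)

lemma push_p: "push p = \<nu>"
proof (rule vec_eq_iff[THEN iffD2], rule allI)
  fix y
  have "(\<Sum>x\<in>UNIV. \<nu> $ x * os_kernel Mo th_star x y) = push p $ y"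
    by (rule sum_os_kernel) (simp add: p_def)
  then show "push p $ y = \<nu> $ y" by (simp add: stationary_dists_balance[OF nu_stationary])
qed

sublocale ergodic_markov_path M "K th_star" p
proof
  fix \<sigma> x
  assume st: "\<And>x. stationary_pmf (K th_star) (\<sigma> x)" and mix: "\<And>y. (\<Sum>x\<in>UNIV. p x * \<sigma> x y) = p y" and x: "0 < p x"
  have "(\<Sum>x\<in>UNIV. p x *\<^sub>R push (\<sigma> x)) = \<nu>"
  proof -
    have "(\<Sum>x\<in>UNIV. p x *\<^sub>R push (\<sigma> x)) $ z = push p $ z" for z
    proof -
      have "(\<Sum>x\<in>UNIV. p x *\<^sub>R push (\<sigma> x)) $ z =
        (\<Sum>x\<in>UNIV. \<Sum>s\<in>UNIV. \<Sum>a\<in>UNIV. \<Sum>b\<in>UNIV. p x * \<sigma> x (s, a, fst z, b) * kern Mo s a (snd z))"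
        by (simp add: push_def sum_distrib_left mult.assoc)
      also have "\<dots> = (\<Sum>s\<in>UNIV. \<Sum>a\<in>UNIV. \<Sum>b\<in>UNIV. \<Sum>x\<in>UNIV. p x * \<sigma> x (s, a, fst z, b) * kern Mo s a (snd z))"
        by (subst sum.swap, intro sum.cong refl, subst sum.swap, intro sum.cong refl sum.swap)
      also have "\<dots> = push p $ z"
        unfolding push_def vec_lambda_beta sum_distrib_right[symmetric] mix ..
      finally show ?thesis .
    qed
    then show ?thesis by (simp add: push_p vec_eq_iff)
  qed
  moreover have "(\<Sum>x\<in>UNIV. p x) = 1" using stationary_p by (simp add: stationary_pmf_def)
  ultimately have "push (\<sigma> x) = \<nu>"
    using extreme_point_convex_combination[where p = p and v = "\<lambda>x. push (\<sigma> x)",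
        OF extreme convex_stationary_dists push_stationary[OF st] p_nonneg _ _ x] by blast
  then show "\<sigma> x = p"
    using stationary_eq_push[OF st, of x] by (auto simp: p_def fun_eq_iff)
qed

end

section \<open>Uniform convergence of the finite-sample objective\<close>

lemma lim_dist_le:
  fixes G :: "nat \<Rightarrow> real"
  assumes d: "\<And>k l. 1 \<le> k \<Longrightarrow> k \<le> l \<Longrightarrow> \<bar>G l - G k\<bar> \<le> d k" and d0: "d \<longlonglongrightarrow> 0" and k: "1 \<le> k"
  shows "\<bar>lim G - G k\<bar> \<le> d k"
proof -
  have "Cauchy G"
  proof (rule metric_CauchyI)
    fix e :: real assume e: "e > 0"
    then have "eventually (\<lambda>k. d k < e / 2) sequentially" using d0 by (intro order_tendstoD) auto
    then obtain N where N: "\<And>k. k \<ge> N \<Longrightarrow> d k < e / 2" unfolding eventually_sequentially by blast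
    show "\<exists>N. \<forall>m\<ge>N. \<forall>n\<ge>N. dist (G m) (G n) < e"
    proof (intro exI allI impI)
      fix m n assume m: "N + 1 \<le> m" and n: "N + 1 \<le> n"
      have "\<bar>G m - G (N + 1)\<bar> < e / 2" "\<bar>G n - G (N + 1)\<bar> < e / 2"
        using d[of "N + 1" m] d[of "N + 1" n] N[of "N + 1"] m n by auto
      then show "dist (G m) (G n) < e" unfolding dist_real_def by linarith
    qed
  qed
  then have "G \<longlonglongrightarrow> lim G" by (simp add: Cauchy_convergent_iff convergent_LIMSEQ_iff)
  then have "(\<lambda>l. \<bar>G l - G k\<bar>) \<longlonglongrightarrow> \<bar>lim G - G k\<bar>" by (intro tendsto_intros)
  then show ?thesis
    by (rule tendsto_upperbound) (use d[OF k] in \<open>auto simp: eventually_sequentially\<close>)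
qed

context owf_setting
begin

abbreviation "\<nu>f \<equiv> (\<lambda>x. \<nu> $ x)"

lemma nu_nonneg: "0 \<le> \<nu> $ z"
  using nu_stationary unfolding stationary_dists_def by blast

definition good :: "('s, 'a, 'o) path \<Rightarrow> bool" where
  "good \<omega> \<longleftrightarrow> (\<forall>m n. m \<le> n \<longrightarrow> 0 < prob (cyl {m..n} \<omega>))"

lemma AE_good: "AE \<omega> in M. good \<omega>"
proof -
  have "AE \<omega> in M. 0 < prob (cyl {m..n} \<omega>)" for m n
  proof -
    let ?P = "\<lambda>\<omega>. prob (cyl {m..n} \<omega>) = 0"
    have "window_fun {m..n} (\<lambda>\<omega>. cyl {m..n} \<omega>)" by (auto simp: window_fun_def cyl_def)
    then have w: "window_fun {m..n} ?P" by (rule window_fun_comp)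
    have f: "window_fun {m..n} (\<lambda>\<omega>. of_bool (?P \<omega>) :: real)" using w by (rule window_fun_comp)
    have "prob {\<omega>. ?P \<omega>} = (\<integral>\<omega>. indicator {\<omega>. ?P \<omega>} \<omega> \<partial>M)" by (simp add: space_M)
    also have "\<dots> = (\<integral>\<omega>. of_bool (?P \<omega>) \<partial>M)" by (simp add: indicator_def)
    also have "\<dots> = (\<Sum>x\<in>PiE {m..n} (\<lambda>_. UNIV). of_bool (?P x) * prob (cyl {m..n} x))"
      by (rule window_fun_integral[OF _ f]) simp
    also have "\<dots> = 0" by (intro sum.neutral) auto
    finally have "AE \<omega> in M. \<omega> \<notin> {\<omega>. ?P \<omega>}"
      using prob_eq_0[OF window_event[OF _ w]] by simp
    then show ?thesis by eventually_elim (simp add: order_less_le)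
  qed
  then have "AE \<omega> in M. \<forall>m n. 0 < prob (cyl {m..n} \<omega>)" by (simp add: AE_all_countable)
  then show ?thesis by eventually_elim (simp add: good_def)
qed

lemma path_eq: "\<omega> t = (obs_s \<omega> t, obs_a \<omega> t, path_o \<omega> t, path_b \<omega> t)"
  by (simp add: obs_s_def obs_a_def path_o_def path_b_def)

lemma good_kern:
  assumes "good \<omega>"
  shows "0 < kern Mo (obs_s \<omega> t) (obs_a \<omega> t) (obs_s \<omega> (t + 1))"
proof -
  have "0 < prob (cyl {t..t + 1} \<omega>)" using assms by (simp add: good_def)
  then have "K th_star (\<omega> t) (\<omega> (t + 1)) \<noteq> 0" by (auto simp: prob_cyl)
  then have "kern Mo (obs_s \<omega> t) (obs_a \<omega> t) (obs_s \<omega> (t + 1)) \<noteq> 0"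
    by (subst (asm) (1 2) path_eq) (simp add: K_def)
  then show ?thesis using kern(1) by (simp add: order_less_le)
qed

lemma good_nu:
  assumes "good \<omega>"
  shows "0 < (\<Sum>i\<in>UNIV. \<nu> $ (i, obs_s \<omega> t))"
proof -
  have "0 < prob (cyl {t..t} \<omega>)" using assms by (simp only: good_def)
  then have "p (\<omega> t) \<noteq> 0" using prob_cyl[of t t \<omega>] by auto
  then have "(\<Sum>i\<in>UNIV. \<nu> $ (i, obs_s \<omega> t) * step_prob Mo th_star (obs_s \<omega> t) (obs_a \<omega> t) i (path_o \<omega> t) (path_b \<omega> t)) \<noteq> 0"
    by (subst (asm) path_eq) (simp add: p_def)
  then have "\<exists>i. \<nu> $ (i, obs_s \<omega> t) \<noteq> 0" by (rule contrapos_np) simp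
  then obtain i where "\<nu> $ (i, obs_s \<omega> t) \<noteq> 0" ..
  then show ?thesis using nu_nonneg by (intro sum_pos2[of _ i]) (auto simp: order_less_le)
qed

definition weighted_ll :: "'h \<times> 'l \<times> 'b \<Rightarrow> 's \<Rightarrow> 'a \<Rightarrow> ('o \<times> bool \<Rightarrow> real) \<Rightarrow> ('o \<times> bool \<Rightarrow> real) \<Rightarrow> real" where
  "weighted_ll th s a G Gt =
     (\<Sum>i\<in>UNIV. \<Sum>b\<in>UNIV. Gt (i, b) * ln (pi_b Mo (th_b th) s i b))
     + (\<Sum>j\<in>UNIV. \<Sum>b\<in>UNIV. G (j, b) * ln (pi_lo Mo (th_lo th) s j a))
     + (\<Sum>j\<in>UNIV. G (j, True) * ln (pi_hi Mo (th_hi th) s j))"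

definition B :: real where "B = 5 * real CARD('o) * (- ln c0)"

lemma ln_bounds:
  assumes "th \<in> \<Theta>"
  shows "\<bar>ln (pi_b Mo (th_b th) s i b)\<bar> \<le> - ln c0" "\<bar>ln (pi_lo Mo (th_lo th) s i a)\<bar> \<le> - ln c0"
    "\<bar>ln (pi_hi Mo (th_hi th) s i)\<bar> \<le> - ln c0"
proof -
  have *: "\<bar>ln x\<bar> \<le> - ln c0" if "c0 \<le> x" "x \<le> 1" for x
  proof -
    have "ln c0 \<le> ln x" "ln x \<le> 0" using that c0_pos by auto
    then show ?thesis by linarith
  qed
  show "\<bar>ln (pi_b Mo (th_b th) s i b)\<bar> \<le> - ln c0" "\<bar>ln (pi_lo Mo (th_lo th) s i a)\<bar> \<le> - ln c0"
    "\<bar>ln (pi_hi Mo (th_hi th) s i)\<bar> \<le> - ln c0"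
    using assms Theta'[OF assms] by (auto intro!: * c0_b c0_lo c0_hi pi_le_1)
qed

lemma B_nonneg: "0 \<le> B"
  unfolding B_def by (intro mult_nonneg_nonneg order_trans[OF abs_ge_zero ln_bounds(3)[OF th_star]]) auto

lemma weighted_ll_diff:
  assumes th: "th \<in> \<Theta>" and G: "\<And>z. \<bar>G z - G' z\<bar> \<le> \<delta>" "\<And>z. \<bar>Gt z - Gt' z\<bar> \<le> \<delta>"
  shows "\<bar>weighted_ll th s a G Gt - weighted_ll th s a G' Gt'\<bar> \<le> B * \<delta>"
proof -
  let ?L = "- ln c0"
  have L: "0 \<le> ?L" using ln_bounds(3)[OF th] by (rule order_trans[OF abs_ge_zero])
  have d: "0 \<le> \<delta>" using G(1) by (rule order_trans[OF abs_ge_zero])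
  have 1: "\<bar>\<Sum>i\<in>(UNIV::'o set). \<Sum>b\<in>(UNIV::bool set). (u (i, b) - u' (i, b)) * v i b\<bar> \<le> 2 * real CARD('o) * (\<delta> * ?L)"
    if "\<And>z. \<bar>u z - u' z\<bar> \<le> \<delta>" "\<And>i b. \<bar>v i b\<bar> \<le> ?L" for u u' v
  proof -
    have "\<bar>\<Sum>i\<in>(UNIV::'o set). \<Sum>b\<in>(UNIV::bool set). (u (i, b) - u' (i, b)) * v i b\<bar> \<le>
      (\<Sum>i\<in>(UNIV::'o set). \<Sum>b\<in>(UNIV::bool set). \<delta> * ?L)"
      by (rule order_trans[OF sum_abs sum_mono[OF order_trans[OF sum_abs sum_mono]]])
        (unfold abs_mult, intro mult_mono that, auto simp: d)
    then show ?thesis by simp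
  qed
  have 2: "\<bar>\<Sum>i\<in>(UNIV::'o set). (u (i, True) - u' (i, True)) * v i\<bar> \<le> real CARD('o) * (\<delta> * ?L)"
    if "\<And>z. \<bar>u z - u' z\<bar> \<le> \<delta>" "\<And>i. \<bar>v i\<bar> \<le> ?L" for u u' :: "'o \<times> bool \<Rightarrow> real" and v
  proof -
    have "\<bar>\<Sum>i\<in>(UNIV::'o set). (u (i, True) - u' (i, True)) * v i\<bar> \<le> (\<Sum>i\<in>(UNIV::'o set). \<delta> * ?L)"
      by (rule order_trans[OF sum_abs sum_mono]) (unfold abs_mult, intro mult_mono that, auto simp: d)
    then show ?thesis by simp
  qed
  have "weighted_ll th s a G Gt - weighted_ll th s a G' Gt' =
    (\<Sum>i\<in>UNIV. \<Sum>b\<in>UNIV. (Gt (i, b) - Gt' (i, b)) * ln (pi_b Mo (th_b th) s i b))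
     + (\<Sum>j\<in>UNIV. \<Sum>b\<in>UNIV. (G (j, b) - G' (j, b)) * ln (pi_lo Mo (th_lo th) s j a))
     + (\<Sum>j\<in>UNIV. (G (j, True) - G' (j, True)) * ln (pi_hi Mo (th_hi th) s j))"
    unfolding weighted_ll_def left_diff_distrib sum_subtractf by simp
  also have "\<bar>\<dots>\<bar> \<le> 2 * real CARD('o) * (\<delta> * ?L) + 2 * real CARD('o) * (\<delta> * ?L) + real CARD('o) * (\<delta> * ?L)"
    by (intro order_trans[OF abs_triangle_ineq] add_mono 1 2 G ln_bounds th)
  also have "\<dots> = B * \<delta>" by (simp add: B_def algebra_simps)
  finally show ?thesis .
qed

lemma weighted_ll_abs:
  assumes "th \<in> \<Theta>" "\<And>z. \<bar>G z\<bar> \<le> 1" "\<And>z. \<bar>Gt z\<bar> \<le> 1"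
  shows "\<bar>weighted_ll th s a G Gt\<bar> \<le> B"
proof -
  have "weighted_ll th s a (\<lambda>_. 0) (\<lambda>_. 0) = 0" by (simp add: weighted_ll_def)
  then show ?thesis using weighted_ll_diff[OF assms(1), of G "\<lambda>_. 0" 1 Gt "\<lambda>_. 0" s a] assms by simp
qed

lemma gamma_k_eq:
  "gamma_k Mo \<nu>f th \<omega> k ob = post_ev Mo th (\<lambda>i. \<nu> $ (i, obs_s \<omega> (1 - int k))) (1 - int k) (1 + int k)
     (obs_s \<omega>) (obs_a \<omega>) 1 (\<lambda>i j b. j = fst ob \<and> b = snd ob)"
  by (simp add: gamma_k_def post_ob_eq_post_ev)

lemma gamma_tilde_k_eq:
  "gamma_tilde_k Mo \<nu>f th \<omega> k ob = post_ev Mo th (\<lambda>i. \<nu> $ (i, obs_s \<omega> (1 - int k))) (1 - int k) (1 + int k)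
     (obs_s \<omega>) (obs_a \<omega>) 1 (\<lambda>i j b. i = fst ob \<and> b = snd ob)"
  by (simp add: gamma_tilde_k_def post_prev_ob_eq_post_ev)

lemma gamma_k_abs:
  assumes "th \<in> \<Theta>"
  shows "\<bar>gamma_k Mo \<nu>f th \<omega> k ob\<bar> \<le> 1" "\<bar>gamma_tilde_k Mo \<nu>f th \<omega> k ob\<bar> \<le> 1"
proof -
  have "\<bar>post_ev Mo th (\<lambda>i. \<nu> $ (i, obs_s \<omega> (1 - int k))) (1 - int k) (1 + int k) (obs_s \<omega>) (obs_a \<omega>) 1 \<phi>\<bar> \<le> 1" for \<phi>
    using post_ev_bounds[of th "\<lambda>i. \<nu> $ (i, obs_s \<omega> (1 - int k))" "1 - int k" 1 "1 + int k" "obs_s \<omega>" "obs_a \<omega>" \<phi>]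
      assms nu_nonneg by simp
  then show "\<bar>gamma_k Mo \<nu>f th \<omega> k ob\<bar> \<le> 1" "\<bar>gamma_tilde_k Mo \<nu>f th \<omega> k ob\<bar> \<le> 1"
    unfolding gamma_k_eq gamma_tilde_k_eq by auto
qed

lemma post_ev_window:
  assumes "\<forall>i\<in>{m..n}. \<omega> i = \<omega>' i" "m \<le> t" "t \<le> n"
  shows "post_ev Mo th (w (obs_s \<omega> m)) m n (obs_s \<omega>) (obs_a \<omega>) t \<phi> = post_ev Mo th (w (obs_s \<omega>' m)) m n (obs_s \<omega>') (obs_a \<omega>') t \<phi>"
proof -
  have "obs_s \<omega> m = obs_s \<omega>' m" using assms by (simp add: obs_s_def)
  then show ?thesis using assms by (simp, intro post_ev_cong) (auto simp: obs_s_def obs_a_def)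
qed

lemma gamma_k_window:
  assumes "\<forall>i\<in>{1 - int k..1 + int k}. \<omega> i = \<omega>' i"
  shows "gamma_k Mo \<nu>f th \<omega> k = gamma_k Mo \<nu>f th \<omega>' k" "gamma_tilde_k Mo \<nu>f th \<omega> k = gamma_tilde_k Mo \<nu>f th \<omega>' k"
  unfolding fun_eq_iff gamma_k_eq gamma_tilde_k_eq
  using post_ev_window[OF assms, where w = "\<lambda>s i. \<nu> $ (i, s)"] by auto

lemma gamma_k_forget:
  assumes "good \<omega>" "th \<in> \<Theta>" "1 \<le> k" "k \<le> l"
  shows "\<bar>gamma_k Mo \<nu>f th \<omega> l ob - gamma_k Mo \<nu>f th \<omega> k ob\<bar> \<le> forget k"
    "\<bar>gamma_tilde_k Mo \<nu>f th \<omega> l ob - gamma_tilde_k Mo \<nu>f th \<omega> k ob\<bar> \<le> forget k"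
  unfolding gamma_k_eq gamma_tilde_k_eq
  using assms by (auto intro!: post_ev_forget nu_nonneg good_nu good_kern)

lemma gamma_inf_forget:
  assumes "good \<omega>" "th \<in> \<Theta>" "1 \<le> k"
  shows "\<bar>gamma_k Mo \<nu>f th \<omega> k ob - gamma_inf Mo \<nu>f th \<omega> ob\<bar> \<le> forget k"
    "\<bar>gamma_tilde_k Mo \<nu>f th \<omega> k ob - gamma_tilde_inf Mo \<nu>f th \<omega> ob\<bar> \<le> forget k"
proof -
  have "\<bar>lim (\<lambda>k. gamma_k Mo \<nu>f th \<omega> k ob) - gamma_k Mo \<nu>f th \<omega> k ob\<bar> \<le> forget k"
    by (rule lim_dist_le[OF gamma_k_forget(1)[OF assms(1,2)] forget_tendsto assms(3)])
  moreover have "\<bar>lim (\<lambda>k. gamma_tilde_k Mo \<nu>f th \<omega> k ob) - gamma_tilde_k Mo \<nu>f th \<omega> k ob\<bar> \<le> forget k"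
    by (rule lim_dist_le[OF gamma_k_forget(2)[OF assms(1,2)] forget_tendsto assms(3)])
  ultimately show "\<bar>gamma_k Mo \<nu>f th \<omega> k ob - gamma_inf Mo \<nu>f th \<omega> ob\<bar> \<le> forget k"
    "\<bar>gamma_tilde_k Mo \<nu>f th \<omega> k ob - gamma_tilde_inf Mo \<nu>f th \<omega> ob\<bar> \<le> forget k"
    unfolding gamma_inf_def gamma_tilde_inf_def by (simp_all add: abs_minus_commute)
qed

definition local_ll :: "nat \<Rightarrow> 'h \<times> 'l \<times> 'b \<Rightarrow> 'h \<times> 'l \<times> 'b \<Rightarrow> ('s, 'a, 'o) path \<Rightarrow> real" where
  "local_ll k th' th \<omega> = weighted_ll th' (obs_s \<omega> 1) (obs_a \<omega> 1) (gamma_k Mo \<nu>f th \<omega> k) (gamma_tilde_k Mo \<nu>f th \<omega> k)"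

definition limit_ll :: "'h \<times> 'l \<times> 'b \<Rightarrow> 'h \<times> 'l \<times> 'b \<Rightarrow> ('s, 'a, 'o) path \<Rightarrow> real" where
  "limit_ll th' th \<omega> = weighted_ll th' (obs_s \<omega> 1) (obs_a \<omega> 1) (gamma_inf Mo \<nu>f th \<omega>) (gamma_tilde_inf Mo \<nu>f th \<omega>)"

lemma Q_bar_eq: "Q_bar Mo \<nu>f M th' th = (\<integral>\<omega>. limit_ll th' th \<omega> \<partial>M)"
  unfolding Q_bar_def limit_ll_def weighted_ll_def ..

lemma local_ll_window: "window_fun {1 - int k..1 + int k} (local_ll k th' th)"
  unfolding window_fun_def
proof (intro allI impI)
  fix \<omega> \<omega>' :: "('s, 'a, 'o) path" assume a: "\<forall>i\<in>{1 - int k..1 + int k}. \<omega> i = \<omega>' i"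
  then have "\<omega> 1 = \<omega>' 1" by simp
  then show "local_ll k th' th \<omega> = local_ll k th' th \<omega>'"
    unfolding local_ll_def gamma_k_window[OF a] by (simp add: obs_s_def obs_a_def)
qed

lemma local_ll_abs: "th \<in> \<Theta> \<Longrightarrow> th' \<in> \<Theta> \<Longrightarrow> \<bar>local_ll k th' th \<omega>\<bar> \<le> B"
  unfolding local_ll_def by (intro weighted_ll_abs gamma_k_abs)

lemma gamma_inf_measurable [measurable]:
  "(\<lambda>\<omega>. gamma_inf Mo \<nu>f th \<omega> ob) \<in> borel_measurable M"
  "(\<lambda>\<omega>. gamma_tilde_inf Mo \<nu>f th \<omega> ob) \<in> borel_measurable M"
proof -
  have "(\<lambda>\<omega>. gamma_k Mo \<nu>f th \<omega> k ob) \<in> borel_measurable M" "(\<lambda>\<omega>. gamma_tilde_k Mo \<nu>f th \<omega> k ob) \<in> borel_measurable M" for k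
    using gamma_k_window[where th = th]
    by (auto intro!: window_fun_measurable[of "{1 - int k..1 + int k}"] simp: window_fun_def) metis+
  then show "(\<lambda>\<omega>. gamma_inf Mo \<nu>f th \<omega> ob) \<in> borel_measurable M"
    "(\<lambda>\<omega>. gamma_tilde_inf Mo \<nu>f th \<omega> ob) \<in> borel_measurable M"
    unfolding gamma_inf_def gamma_tilde_inf_def by (auto intro!: borel_measurable_lim_metric)
qed

lemma obs1_measurable: "(\<lambda>\<omega>. f (obs_s \<omega> 1) (obs_a \<omega> 1) :: real) \<in> borel_measurable M"
  by (rule window_fun_measurable[of "{1}"]) (auto simp: window_fun_def obs_s_def obs_a_def)

lemma limit_ll_measurable [measurable]: "limit_ll th' th \<in> borel_measurable M"
  unfolding limit_ll_def weighted_ll_def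
  by (intro borel_measurable_add borel_measurable_sum borel_measurable_times gamma_inf_measurable obs1_measurable)

lemma limit_ll_forget:
  assumes "good \<omega>" "th \<in> \<Theta>" "th' \<in> \<Theta>" "1 \<le> k"
  shows "\<bar>local_ll k th' th \<omega> - limit_ll th' th \<omega>\<bar> \<le> B * forget k"
  unfolding local_ll_def limit_ll_def by (intro weighted_ll_diff gamma_inf_forget assms)

lemma Q_bar_approx:
  assumes th: "th \<in> \<Theta>" "th' \<in> \<Theta>" and k: "1 \<le> k"
  shows "\<bar>(\<integral>\<omega>. local_ll k th' th \<omega> \<partial>M) - Q_bar Mo \<nu>f M th' th\<bar> \<le> B * forget k"
proof -
  have Fi: "integrable M (local_ll k th' th)" by (rule window_fun_integrable[OF _ local_ll_window]) simp
  have ae: "AE \<omega> in M. \<bar>local_ll k th' th \<omega> - limit_ll th' th \<omega>\<bar> \<le> B * forget k"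
    using AE_good by eventually_elim (rule limit_ll_forget[OF _ th k])
  have Gi: "integrable M (limit_ll th' th)"
  proof (rule integrable_const_bound)
    show "AE \<omega> in M. norm (limit_ll th' th \<omega>) \<le> B + B * forget k"
      using ae
    proof eventually_elim
      case (elim \<omega>)
      then show ?case using local_ll_abs[OF th, of k \<omega>] unfolding real_norm_def by linarith
    qed
  qed measurable
  have "\<bar>(\<integral>\<omega>. local_ll k th' th \<omega> \<partial>M) - Q_bar Mo \<nu>f M th' th\<bar> = \<bar>\<integral>\<omega>. local_ll k th' th \<omega> - limit_ll th' th \<omega> \<partial>M\<bar>"
    unfolding Q_bar_eq using Fi Gi by simp
  also have "\<dots> \<le> (\<integral>\<omega>. \<bar>local_ll k th' th \<omega> - limit_ll th' th \<omega>\<bar> \<partial>M)" by (rule integral_abs_bound)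
  also have "\<dots> \<le> (\<integral>\<omega>. B * forget k \<partial>M)"
    using Fi Gi ae by (intro integral_mono_AE) auto
  also have "\<dots> = B * forget k" by (simp add: prob_space)
  finally show ?thesis .
qed

lemma Q_fin_eq:
  assumes "1 \<le> T"
  shows "Q_fin Mo \<mu> T th' th \<omega> = (\<Sum>t<T. weighted_ll th' (obs_s \<omega> (1 + int t)) (obs_a \<omega> (1 + int t))
     (post_ob Mo th (\<mu> (obs_s \<omega> 1)) 1 (int T) (obs_s \<omega>) (obs_a \<omega>) (1 + int t))
     (\<lambda>z. if t = 0 then 0 else post_prev_ob Mo th (\<mu> (obs_s \<omega> 1)) 1 (int T) (obs_s \<omega>) (obs_a \<omega>) (1 + int t) z)) / real T"
proof -
  have r: "(\<Sum>t\<in>{1..int T}. f t) = (\<Sum>t<T. f (1 + int t))" for f :: "int \<Rightarrow> real"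
    by (rule sum.reindex_bij_witness[of _ "\<lambda>t. 1 + int t" "\<lambda>t. nat (t - 1)"]) auto
  have r2: "(\<Sum>t\<in>{2..int T}. f t) = (\<Sum>t<T. if t = 0 then 0 else f (1 + int t))" for f :: "int \<Rightarrow> real"
  proof -
    have "(\<Sum>t\<in>{2..int T}. f t) = (\<Sum>t\<in>{2..int T}. if t = 1 then 0 else f t)" by (intro sum.cong) auto
    also have "\<dots> = (\<Sum>t\<in>{1..int T}. if t = 1 then 0 else f t)"
      by (rule sum.mono_neutral_left) auto
    also have "\<dots> = (\<Sum>t<T. if t = 0 then 0 else f (1 + int t))" unfolding r by (intro sum.cong) auto
    finally show ?thesis .
  qed
  show ?thesis
    unfolding Q_fin_def Let_def r r2 weighted_ll_def sum.distrib
    by (auto simp: add_divide_distrib sum_divide_distrib intro!: sum.cong)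
qed

lemma Q_fin_approx:
  assumes g: "good \<omega>" and th: "th \<in> \<Theta>" "th' \<in> \<Theta>" and k: "1 \<le> k" and T: "1 \<le> T" and mu: "\<mu> \<in> cond_pmfs"
  shows "\<bar>Q_fin Mo \<mu> T th' th \<omega> - (\<Sum>t<T. local_ll k th' th (\<lambda>i. \<omega> (i + int t))) / real T\<bar> \<le>
     B * forget k + B * (2 * real k) / real T"
proof -
  let ?w = "\<mu> (obs_s \<omega> 1)"
  let ?P = "\<lambda>t. post_ev Mo th ?w 1 (int T) (obs_s \<omega>) (obs_a \<omega>) (1 + int t)"
  let ?R = "\<lambda>t. post_ev Mo th (\<lambda>i. \<nu> $ (i, obs_s \<omega> (1 + int t - int k))) (1 + int t - int k) (1 + int t + int k) (obs_s \<omega>) (obs_a \<omega>) (1 + int t)"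
  have w: "0 \<le> ?w i" "0 < (\<Sum>i\<in>UNIV. ?w i)" for i using mu by (auto simp: cond_pmfs_def)
  define e where "e t = (if k \<le> t \<and> t + k < T then forget k else 1)" for t
  have d: "\<bar>?P t \<phi> - ?R t \<phi>\<bar> \<le> e t" if "t < T" for t \<phi>
  proof (cases "k \<le> t \<and> t + k < T")
    case True
    then have "\<bar>?P t \<phi> - ?R t \<phi>\<bar> \<le> forget k"
      using th k by (intro post_ev_forget w good_nu[OF g] good_kern[OF g] nu_nonneg) auto
    then show ?thesis using True by (simp add: e_def)
  next
    case False
    have "0 \<le> ?P t \<phi>" "?P t \<phi> \<le> 1" using that by (auto intro!: post_ev_bounds th w)
    moreover have "0 \<le> ?R t \<phi>" "?R t \<phi> \<le> 1" by (auto intro!: post_ev_bounds th nu_nonneg)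
    moreover have "e t = 1" using False by (auto simp: e_def)
    ultimately show ?thesis by linarith
  qed
  have sh: "gamma_k Mo \<nu>f th (\<lambda>i. \<omega> (i + int t)) k z = ?R t (\<lambda>i j b. j = fst z \<and> b = snd z)"
    "gamma_tilde_k Mo \<nu>f th (\<lambda>i. \<omega> (i + int t)) k z = ?R t (\<lambda>i j b. i = fst z \<and> b = snd z)" for t z
  proof -
    have o: "obs_s (\<lambda>i. \<omega> (i + int t)) = (\<lambda>u. obs_s \<omega> (u + int t))" "obs_a (\<lambda>i. \<omega> (i + int t)) = (\<lambda>u. obs_a \<omega> (u + int t))"
      by (auto simp: obs_s_def obs_a_def)
    have eq: "1 - int k + int t = 1 + int t - int k" "1 + int k + int t = 1 + int t + int k" by auto
    show "gamma_k Mo \<nu>f th (\<lambda>i. \<omega> (i + int t)) k z = ?R t (\<lambda>i j b. j = fst z \<and> b = snd z)"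
      "gamma_tilde_k Mo \<nu>f th (\<lambda>i. \<omega> (i + int t)) k z = ?R t (\<lambda>i j b. i = fst z \<and> b = snd z)"
      unfolding gamma_k_eq gamma_tilde_k_eq o by (subst post_ev_shift; simp add: eq)+
  qed
  let ?E = "\<lambda>t. weighted_ll th' (obs_s \<omega> (1 + int t)) (obs_a \<omega> (1 + int t))
     (post_ob Mo th ?w 1 (int T) (obs_s \<omega>) (obs_a \<omega>) (1 + int t))
     (\<lambda>z. if t = 0 then 0 else post_prev_ob Mo th ?w 1 (int T) (obs_s \<omega>) (obs_a \<omega>) (1 + int t) z)"
  have E: "\<bar>?E t - local_ll k th' th (\<lambda>i. \<omega> (i + int t))\<bar> \<le> B * e t" if t: "t < T" for t
  proof -
    have "\<bar>(if t = 0 then 0 else ?P t \<phi>) - ?R t \<phi>\<bar> \<le> e t" for \<phi>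
    proof (cases "t = 0")
      case True
      then have "e t = 1" using k by (simp add: e_def)
      moreover have "0 \<le> ?R t \<phi>" "?R t \<phi> \<le> 1" by (auto intro!: post_ev_bounds th nu_nonneg)
      ultimately show ?thesis using True by simp
    next
      case False
      then show ?thesis using d[OF t, of \<phi>] by simp
    qed
    moreover have "obs_s (\<lambda>i. \<omega> (i + int t)) 1 = obs_s \<omega> (1 + int t)" "obs_a (\<lambda>i. \<omega> (i + int t)) 1 = obs_a \<omega> (1 + int t)"
      by (simp_all add: obs_s_def obs_a_def)
    ultimately show ?thesis
      using d[OF t] th by (simp only: local_ll_def, intro weighted_ll_diff) (auto simp: sh post_ob_eq_post_ev post_prev_ob_eq_post_ev)
  qed
  have sum_e: "(\<Sum>t<T. e t) \<le> real T * forget k + 2 * real k"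
  proof -
    have "e t \<le> forget k + ((if t < k then 1 else 0) + (if T - k \<le> t then 1 else 0))" for t
      using forget_nonneg[of k] by (auto simp: e_def)
    then have "(\<Sum>t<T. e t) \<le> (\<Sum>t<T. forget k + ((if t < k then 1 else 0) + (if T - k \<le> t then 1 else 0)))"
      by (intro sum_mono)
    also have "\<dots> = real T * forget k + ((\<Sum>t<T. if t < k then 1 else 0) + (\<Sum>t<T. if T - k \<le> t then 1 else 0))"
      by (simp add: sum.distrib)
    also have "(\<Sum>t<T. if t < k then 1 else 0 :: real) \<le> real k"
    proof -
      have "card ({..<T} \<inter> {t. t < k}) \<le> card {..<k}" by (rule card_mono) auto
      then show ?thesis by (simp add: sum.If_cases)
    qed
    also have "(\<Sum>t<T. if T - k \<le> t then 1 else 0 :: real) \<le> real k"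
    proof -
      have "card ({..<T} \<inter> {t. T - k \<le> t}) \<le> card {T - k..<T}" by (rule card_mono) auto
      also have "\<dots> \<le> k" by simp
      finally have "card ({..<T} \<inter> {t. T - k \<le> t}) \<le> k" .
      then show ?thesis by (simp add: sum.If_cases)
    qed
    finally show ?thesis by simp
  qed
  have "\<bar>Q_fin Mo \<mu> T th' th \<omega> - (\<Sum>t<T. local_ll k th' th (\<lambda>i. \<omega> (i + int t))) / real T\<bar> =
    \<bar>\<Sum>t<T. ?E t - local_ll k th' th (\<lambda>i. \<omega> (i + int t))\<bar> / real T"
    unfolding Q_fin_eq[OF T] by (simp add: diff_divide_distrib[symmetric] sum_subtractf abs_divide)
  also have "\<dots> \<le> (\<Sum>t<T. B * e t) / real T"
    using E by (intro divide_right_mono order_trans[OF sum_abs sum_mono]) auto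
  also have "\<dots> \<le> B * (real T * forget k + 2 * real k) / real T"
    unfolding sum_distrib_left[symmetric] using sum_e B_nonneg by (intro divide_right_mono mult_left_mono) auto
  also have "\<dots> = B * forget k + B * (2 * real k) / real T"
    using T by (simp add: field_simps)
  finally show ?thesis .
qed

lemma Q_uniform:
  assumes "good \<omega>" "th \<in> \<Theta>" "th' \<in> \<Theta>" "1 \<le> k" "1 \<le> T" "\<mu> \<in> cond_pmfs"
  shows "\<bar>Q_fin Mo \<mu> T th' th \<omega> - Q_bar Mo \<nu>f M th' th\<bar> \<le>
     2 * B * forget k + B * (2 * real k) / real T + B * freq_dev (1 - int k) (1 + int k) T \<omega>"
proof -
  have "\<bar>(\<Sum>t<T. local_ll k th' th (\<lambda>i. \<omega> (i + int t))) / real T - (\<integral>\<omega>. local_ll k th' th \<omega> \<partial>M)\<bar> \<le>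
    B * freq_dev (1 - int k) (1 + int k) T \<omega>"
    using assms by (intro time_average_dev local_ll_window local_ll_abs) auto
  then show ?thesis using Q_fin_approx[OF assms] Q_bar_approx[OF assms(2,3,4)] by linarith
qed

lemma Q_uniform_in_prob:
  assumes eps: "\<epsilon> > 0" and q: "q > 0"
  obtains T0 where "1 \<le> T0" "\<And>T. T \<ge> T0 \<Longrightarrow> \<exists>A\<in>sets M. prob A \<ge> 1 - q \<and>
     (\<forall>\<omega>\<in>A. \<forall>th\<in>\<Theta>. \<forall>th'\<in>\<Theta>. \<forall>\<mu>\<in>cond_pmfs. good \<omega> \<longrightarrow> \<bar>Q_fin Mo \<mu> T th' th \<omega> - Q_bar Mo \<nu>f M th' th\<bar> \<le> \<epsilon>)"
proof -
  have "(\<lambda>k. 2 * B * forget k) \<longlonglongrightarrow> 2 * B * 0" by (intro tendsto_intros forget_tendsto)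
  then have "eventually (\<lambda>k. 2 * B * forget k < \<epsilon> / 3) sequentially" using eps by (intro order_tendstoD) auto
  then obtain k0 where k0: "\<And>k. k \<ge> k0 \<Longrightarrow> 2 * B * forget k < \<epsilon> / 3" unfolding eventually_sequentially by blast
  define k where "k = max k0 1"
  have k: "1 \<le> k" "2 * B * forget k < \<epsilon> / 3" using k0 by (auto simp: k_def)
  define \<eta> where "\<eta> = \<epsilon> / (3 * (B + 1))"
  have eta: "\<eta> > 0" "B * \<eta> \<le> \<epsilon> / 3" using eps B_nonneg by (auto simp: \<eta>_def field_simps)
  let ?S = "\<lambda>T. {\<omega>\<in>space M. \<eta> \<le> freq_dev (1 - int k) (1 + int k) T \<omega>}"
  have "(\<lambda>T. prob (?S T)) \<longlonglongrightarrow> 0" by (rule freq_dev_tendsto_in_prob) (use eta in auto)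
  then have "eventually (\<lambda>T. prob (?S T) < q) sequentially" using q by (intro order_tendstoD) auto
  then obtain T1 where T1: "\<And>T. T \<ge> T1 \<Longrightarrow> prob (?S T) < q" unfolding eventually_sequentially by blast
  have "(\<lambda>T. B * (2 * real k) / real T) \<longlonglongrightarrow> 0" by (intro lim_const_over_n)
  then have "eventually (\<lambda>T. B * (2 * real k) / real T < \<epsilon> / 3) sequentially" using eps by (intro order_tendstoD) auto
  then obtain T2 where T2: "\<And>T. T \<ge> T2 \<Longrightarrow> B * (2 * real k) / real T < \<epsilon> / 3" unfolding eventually_sequentially by blast
  show ?thesis
  proof (rule that[of "max 1 (max T1 T2)"])
    fix T assume T: "T \<ge> max 1 (max T1 T2)"
    have S: "?S T \<in> sets M"
    proof -
      have [measurable]: "freq (1 - int k) (1 + int k) x T \<in> borel_measurable M" for x unfolding freq_def by measurable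
      show ?thesis unfolding freq_dev_def by measurable
    qed
    show "\<exists>A\<in>sets M. prob A \<ge> 1 - q \<and>
     (\<forall>\<omega>\<in>A. \<forall>th\<in>\<Theta>. \<forall>th'\<in>\<Theta>. \<forall>\<mu>\<in>cond_pmfs. good \<omega> \<longrightarrow> \<bar>Q_fin Mo \<mu> T th' th \<omega> - Q_bar Mo \<nu>f M th' th\<bar> \<le> \<epsilon>)"
    proof (intro bexI[of _ "space M - ?S T"] conjI ballI impI)
      show "1 - q \<le> prob (space M - ?S T)" using T1[of T] T S by (subst prob_compl) auto
      fix \<omega> th th' and \<mu> :: "'s \<Rightarrow> 'o \<Rightarrow> real"
      assume *: "\<omega> \<in> space M - ?S T" "th \<in> \<Theta>" "th' \<in> \<Theta>" "\<mu> \<in> cond_pmfs" "good \<omega>"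
      have "\<bar>Q_fin Mo \<mu> T th' th \<omega> - Q_bar Mo \<nu>f M th' th\<bar> \<le>
        2 * B * forget k + B * (2 * real k) / real T + B * freq_dev (1 - int k) (1 + int k) T \<omega>"
        using * T k by (intro Q_uniform) auto
      moreover have "B * freq_dev (1 - int k) (1 + int k) T \<omega> \<le> B * \<eta>"
        using * B_nonneg by (intro mult_left_mono) auto
      ultimately show "\<bar>Q_fin Mo \<mu> T th' th \<omega> - Q_bar Mo \<nu>f M th' th\<bar> \<le> \<epsilon>"
        using k(2) eta(2) T2[of T] T by linarith
    qed (use S in auto)
  qed simp
qed

end

section \<open>Optimality of the true parameter\<close>

lemma sum_PiE_pair:
  fixes F :: "('i \<Rightarrow> 'x \<times> 'y) \<Rightarrow> real"
  assumes F: "\<And>f g. (\<forall>i\<in>I. f i = g i) \<Longrightarrow> F f = F g"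
  shows "(\<Sum>f\<in>PiE I (\<lambda>_. UNIV). F f) = (\<Sum>u\<in>PiE I (\<lambda>_. UNIV). \<Sum>v\<in>PiE I (\<lambda>_. UNIV). F (\<lambda>i. (u i, v i)))"
proof -
  have "(\<Sum>u\<in>PiE I (\<lambda>_. UNIV). \<Sum>v\<in>PiE I (\<lambda>_. UNIV). F (\<lambda>i. (u i, v i))) =
    (\<Sum>(u, v)\<in>PiE I (\<lambda>_. UNIV) \<times> PiE I (\<lambda>_. UNIV). F (\<lambda>i. (u i, v i)))"
    by (rule sum.cartesian_product)
  also have "\<dots> = (\<Sum>f\<in>PiE I (\<lambda>_. UNIV). F f)"
  proof (rule sum.reindex_bij_witness[of _ "\<lambda>f. (restrict (fst \<circ> f) I, restrict (snd \<circ> f) I)"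
        "\<lambda>(u, v). restrict (\<lambda>i. (u i, v i)) I"])
    fix a :: "('i \<Rightarrow> 'x) \<times> ('i \<Rightarrow> 'y)"
    assume a: "a \<in> PiE I (\<lambda>_. UNIV) \<times> PiE I (\<lambda>_. UNIV)"
    show "(\<lambda>f. (restrict (fst \<circ> f) I, restrict (snd \<circ> f) I)) (case a of (u, v) \<Rightarrow> restrict (\<lambda>i. (u i, v i)) I) = a"
      using a by (cases a) (auto simp: fun_eq_iff restrict_def PiE_iff extensional_def)
    show "F (case a of (u, v) \<Rightarrow> restrict (\<lambda>i. (u i, v i)) I) = (case a of (u, v) \<Rightarrow> F (\<lambda>i. (u i, v i)))"
      by (cases a) (auto intro!: F)
  next
    fix f :: "'i \<Rightarrow> 'x \<times> 'y" assume f: "f \<in> PiE I (\<lambda>_. UNIV)"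
    show "(case (restrict (fst \<circ> f) I, restrict (snd \<circ> f) I) of (u, v) \<Rightarrow> restrict (\<lambda>i. (u i, v i)) I) = f"
      using f by (auto simp: fun_eq_iff restrict_def PiE_iff extensional_def)
  qed (auto split: prod.splits)
  finally show ?thesis ..
qed

lemma linear_functional_inner:
  fixes D :: "'e::euclidean_space \<Rightarrow> real"
  assumes "linear D"
  shows "D h = inner h (\<Sum>i\<in>Basis. D i *\<^sub>R i)"
proof -
  have "D h = D (\<Sum>i\<in>Basis. inner h i *\<^sub>R i)" by (simp add: euclidean_representation)
  also have "\<dots> = (\<Sum>i\<in>Basis. inner h i * D i)" using assms by (simp add: linear_sum linear_scale)
  finally show ?thesis by (simp add: inner_sum_right mult.commute)
qed

lemma first_order_condition:
  fixes f :: "'e::euclidean_space \<Rightarrow> real"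
  assumes D: "(f has_derivative (\<lambda>h. inner h D)) (at x)" and S: "convex S" "x \<in> S" "y \<in> S"
    and max: "\<And>z. z \<in> S \<Longrightarrow> f z \<le> f x"
  shows "inner (y - x) D \<le> 0"
proof (rule ccontr)
  assume "\<not> ?thesis"
  then have pos: "0 < inner (y - x) D" by simp
  let ?\<phi> = "\<lambda>t::real. f (x + t *\<^sub>R (y - x))"
  have "((\<lambda>t::real. x + t *\<^sub>R (y - x)) has_derivative (\<lambda>t. t *\<^sub>R (y - x))) (at 0)"
    by (auto intro!: derivative_eq_intros)
  moreover have "(f has_derivative (\<lambda>h. inner h D)) (at (x + 0 *\<^sub>R (y - x)))" using D by simp
  ultimately have "(?\<phi> has_derivative (\<lambda>t. inner (t *\<^sub>R (y - x)) D)) (at 0)"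
    by (rule has_derivative_compose)
  then have "DERIV ?\<phi> 0 :> inner (y - x) D"
    unfolding has_field_derivative_def by (simp add: mult_commute_abs)
  from DERIV_pos_inc_right[OF this pos] obtain d where d: "0 < d" "\<And>h. 0 < h \<Longrightarrow> h < d \<Longrightarrow> ?\<phi> 0 < ?\<phi> (0 + h)" by blast
  define h where "h = min (d / 2) 1"
  have h: "0 < h" "h < d" "h \<le> 1" using d(1) by (auto simp: h_def)
  have "x + h *\<^sub>R (y - x) = (1 - h) *\<^sub>R x + h *\<^sub>R y" by (simp add: algebra_simps)
  also have "\<dots> \<in> S" using S h by (intro convexD) auto
  finally have "f (x + h *\<^sub>R (y - x)) \<le> f x" by (rule max)
  then show False using d(2)[of h] h by simp
qed

context owf_setting
begin

lemma window_integral_components: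
  assumes "window_fun {m..n} f"
  shows "(\<integral>\<omega>. f \<omega> \<partial>M) = (\<Sum>s\<in>PiE {m..n} (\<lambda>_. UNIV). \<Sum>a\<in>PiE {m..n} (\<lambda>_. UNIV).
     \<Sum>oc\<in>PiE {m..n} (\<lambda>_. UNIV). \<Sum>b\<in>PiE {m..n} (\<lambda>_. UNIV).
     f (\<lambda>t. (s t, a t, oc t, b t)) * prob (cyl {m..n} (\<lambda>t. (s t, a t, oc t, b t))))"
proof -
  let ?F = "\<lambda>x. f x * prob (cyl {m..n} x)"
  have F: "?F x = ?F y" if "\<forall>i\<in>{m..n}. x i = y i" for x y
  proof -
    have "f x = f y" using assms that unfolding window_fun_def by blast
    moreover have "cyl {m..n} x = cyl {m..n} y" using that by (auto simp: cyl_def)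
    ultimately show ?thesis by simp
  qed
  have "(\<integral>\<omega>. f \<omega> \<partial>M) = (\<Sum>x\<in>PiE {m..n} (\<lambda>_. UNIV). ?F x)"
    by (rule window_fun_integral[OF _ assms]) simp
  also have "\<dots> = (\<Sum>s\<in>PiE {m..n} (\<lambda>_. UNIV). \<Sum>y\<in>PiE {m..n} (\<lambda>_. UNIV). ?F (\<lambda>t. (s t, y t)))"
    by (rule sum_PiE_pair) (rule F)
  also have "\<dots> = (\<Sum>s\<in>PiE {m..n} (\<lambda>_. UNIV). \<Sum>a\<in>PiE {m..n} (\<lambda>_. UNIV). \<Sum>y\<in>PiE {m..n} (\<lambda>_. UNIV).
     ?F (\<lambda>t. (s t, a t, y t)))"
    by (rule sum.cong[OF refl], rule sum_PiE_pair) (rule F, simp)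
  also have "\<dots> = (\<Sum>s\<in>PiE {m..n} (\<lambda>_. UNIV). \<Sum>a\<in>PiE {m..n} (\<lambda>_. UNIV).
     \<Sum>oc\<in>PiE {m..n} (\<lambda>_. UNIV). \<Sum>b\<in>PiE {m..n} (\<lambda>_. UNIV). ?F (\<lambda>t. (s t, a t, oc t, b t)))"
    by (rule sum.cong[OF refl], rule sum.cong[OF refl], rule sum_PiE_pair) (rule F, simp)
  finally show ?thesis .
qed

lemma hidden_ev_eq_prob:
  assumes "m \<le> t - 1" "t \<le> n"
  shows "hidden_ev Mo th_star (\<lambda>i. \<nu> $ (i, s m)) m n s a t \<phi> =
    (\<Sum>oc\<in>PiE {m..n} (\<lambda>_. UNIV). \<Sum>b\<in>PiE {m..n} (\<lambda>_. UNIV).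
      of_bool (\<phi> (oc (t - 1)) (oc t) (b t)) * prob (cyl {m..n} (\<lambda>t. (s t, a t, oc t, b t))))"
proof -
  let ?J = "\<lambda>oc b. joint_w Mo th_star (\<lambda>i. \<nu> $ (i, s m)) m n s a oc b"
  have mn: "m \<le> n" using assms by simp
  have I: "{m - 1..n} = insert (m - 1) {m..n}" using mn by auto
  have pr: "prob (cyl {m..n} (\<lambda>t. (s t, a t, oc t, b t))) = (\<Sum>i\<in>UNIV. ?J (oc(m - 1 := i)) b)" for oc b
  proof -
    have "prob (cyl {m..n} (\<lambda>t. (s t, a t, oc t, b t))) = fd_prob Mo th_star \<nu>f m n (\<lambda>t. (s t, a t, oc t, b t))"
      using fd_prob_eq[OF mn] prob_cyl[OF mn] by simp
    also have "\<dots> = (\<Sum>i\<in>UNIV. ?J (oc(m - 1 := i)) b)"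
      by (simp add: fd_prob_def obs_s_def[abs_def] obs_a_def[abs_def] path_o_def[abs_def] path_b_def[abs_def])
    finally show ?thesis .
  qed
  have "hidden_ev Mo th_star (\<lambda>i. \<nu> $ (i, s m)) m n s a t \<phi> =
    (\<Sum>i\<in>UNIV. \<Sum>oc\<in>PiE {m..n} (\<lambda>_. UNIV). \<Sum>b\<in>PiE {m..n} (\<lambda>_. UNIV).
      if \<phi> ((oc(m - 1 := i)) (t - 1)) ((oc(m - 1 := i)) t) (b t) then ?J (oc(m - 1 := i)) b else 0)"
    unfolding hidden_ev_def hidden_sum_def I by (rule sum_PiE_insert) auto
  also have "\<dots> = (\<Sum>i\<in>UNIV. \<Sum>oc\<in>PiE {m..n} (\<lambda>_. UNIV). \<Sum>b\<in>PiE {m..n} (\<lambda>_. UNIV).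
      of_bool (\<phi> (oc (t - 1)) (oc t) (b t)) * ?J (oc(m - 1 := i)) b)"
    using assms by (intro sum.cong refl) auto
  also have "\<dots> = (\<Sum>oc\<in>PiE {m..n} (\<lambda>_. UNIV). \<Sum>b\<in>PiE {m..n} (\<lambda>_. UNIV). \<Sum>i\<in>UNIV.
      of_bool (\<phi> (oc (t - 1)) (oc t) (b t)) * ?J (oc(m - 1 := i)) b)"
    by (rule trans[OF sum.swap], rule sum.cong[OF refl], rule sum.swap)
  finally show ?thesis unfolding pr sum_distrib_left .
qed

lemma post_ev_times_total:
  assumes "th \<in> \<Theta>" "\<And>i. 0 \<le> w i" "m \<le> t" "t \<le> n"
  shows "post_ev Mo th w m n s a t \<phi> * hidden_ev Mo th w m n s a t (\<lambda>_ _ _. True) = hidden_ev Mo th w m n s a t \<phi>"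
  using hidden_ev_nonneg[of th w m t n s a \<phi>] hidden_ev_le[of th w m t n s a \<phi>] assms
  by (cases "hidden_ev Mo th w m n s a t (\<lambda>_ _ _. True) = 0") (auto simp: post_ev_def)

text \<open>Under the true parameter the smoothing weights are the conditional probabilities of the hidden
  variables given the observations in the window.\<close>
lemma posterior_integral:
  assumes k: "1 \<le> k"
  shows "(\<integral>\<omega>. post_ev Mo th_star (\<lambda>i. \<nu> $ (i, obs_s \<omega> (1 - int k))) (1 - int k) (1 + int k) (obs_s \<omega>) (obs_a \<omega>) 1 \<phi>
      * g (obs_s \<omega> 1) (obs_a \<omega> 1) \<partial>M) =
    (\<integral>\<omega>. of_bool (\<phi> (path_o \<omega> 0) (path_o \<omega> 1) (path_b \<omega> 1)) * g (obs_s \<omega> 1) (obs_a \<omega> 1) \<partial>M)"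
    (is "(\<integral>\<omega>. ?f \<omega> \<partial>M) = (\<integral>\<omega>. ?h \<omega> \<partial>M)")
proof -
  define m n where "m = 1 - int k" and "n = 1 + int k"
  have mn: "m \<le> 1 - 1" "m \<le> 1" "1 \<le> n" using k by (auto simp: m_def n_def)
  let ?X = "\<lambda>s a oc b t. (s t :: 's, a t :: 'a, oc t :: 'o, b t :: bool)"
  let ?pr = "\<lambda>s a oc b. prob (cyl {m..n} (?X s a oc b))"
  let ?po = "\<lambda>s a. post_ev Mo th_star (\<lambda>i. \<nu> $ (i, s m)) m n s a 1 \<phi>"
  have wf: "window_fun {m..n} ?f"
    unfolding window_fun_def m_def[symmetric] n_def[symmetric]
  proof (intro allI impI)
    fix \<omega> \<omega>' :: "('s, 'a, 'o) path" assume a: "\<forall>i\<in>{m..n}. \<omega> i = \<omega>' i"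
    then have "\<omega> 1 = \<omega>' 1" using mn by simp
    then show "post_ev Mo th_star (\<lambda>i. \<nu> $ (i, obs_s \<omega> m)) m n (obs_s \<omega>) (obs_a \<omega>) 1 \<phi> * g (obs_s \<omega> 1) (obs_a \<omega> 1) =
      post_ev Mo th_star (\<lambda>i. \<nu> $ (i, obs_s \<omega>' m)) m n (obs_s \<omega>') (obs_a \<omega>') 1 \<phi> * g (obs_s \<omega>' 1) (obs_a \<omega>' 1)"
      using post_ev_window[OF a mn(2,3), where w = "\<lambda>s i. \<nu> $ (i, s)"] by (simp add: obs_s_def obs_a_def)
  qed
  have wh: "window_fun {m..n} ?h"
    unfolding window_fun_def
  proof (intro allI impI)
    fix \<omega> \<omega>' :: "('s, 'a, 'o) path" assume "\<forall>i\<in>{m..n}. \<omega> i = \<omega>' i"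
    then have "\<omega> 1 = \<omega>' 1" "\<omega> 0 = \<omega>' 0" using mn by auto
    then show "?h \<omega> = ?h \<omega>'" by (simp add: obs_s_def obs_a_def path_o_def path_b_def)
  qed
  have o: "obs_s (?X s a oc b) = s" "obs_a (?X s a oc b) = a" "path_o (?X s a oc b) = oc" "path_b (?X s a oc b) = b" for s a oc b
    by (auto simp: obs_s_def obs_a_def path_o_def path_b_def)
  have key: "(\<Sum>oc\<in>PiE {m..n} (\<lambda>_. UNIV). \<Sum>b\<in>PiE {m..n} (\<lambda>_. UNIV). ?po s a * g (s 1) (a 1) * ?pr s a oc b) =
    (\<Sum>oc\<in>PiE {m..n} (\<lambda>_. UNIV). \<Sum>b\<in>PiE {m..n} (\<lambda>_. UNIV). of_bool (\<phi> (oc 0) (oc 1) (b 1)) * g (s 1) (a 1) * ?pr s a oc b)" for s a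
  proof -
    have "(\<Sum>oc\<in>PiE {m..n} (\<lambda>_. UNIV). \<Sum>b\<in>PiE {m..n} (\<lambda>_. UNIV). ?po s a * g (s 1) (a 1) * ?pr s a oc b) =
      g (s 1) (a 1) * (?po s a * hidden_ev Mo th_star (\<lambda>i. \<nu> $ (i, s m)) m n s a 1 (\<lambda>_ _ _. True))"
      unfolding hidden_ev_eq_prob[OF mn(1,3)] by (simp add: sum_distrib_left mult_ac)
    also have "?po s a * hidden_ev Mo th_star (\<lambda>i. \<nu> $ (i, s m)) m n s a 1 (\<lambda>_ _ _. True) =
      hidden_ev Mo th_star (\<lambda>i. \<nu> $ (i, s m)) m n s a 1 \<phi>"
      by (rule post_ev_times_total[OF th_star nu_nonneg mn(2,3)])
    finally show ?thesis unfolding hidden_ev_eq_prob[OF mn(1,3)] by (simp add: sum_distrib_left mult_ac)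
  qed
  show ?thesis
    unfolding window_integral_components[OF wf] window_integral_components[OF wh]
    unfolding o m_def[symmetric] n_def[symmetric] key ..
qed

definition comp_ll :: "'h \<times> 'l \<times> 'b \<Rightarrow> ('s, 'a, 'o) path \<Rightarrow> real" where
  "comp_ll th \<omega> = ln (pi_b Mo (th_b th) (obs_s \<omega> 1) (path_o \<omega> 0) (path_b \<omega> 1))
     + ln (pi_lo Mo (th_lo th) (obs_s \<omega> 1) (path_o \<omega> 1) (obs_a \<omega> 1))
     + (if path_b \<omega> 1 then ln (pi_hi Mo (th_hi th) (obs_s \<omega> 1) (path_o \<omega> 1)) else 0)"

lemma comp_ll_eq_ell:
  "comp_ll th \<omega> = weighted_ll th (obs_s \<omega> 1) (obs_a \<omega> 1)
     (\<lambda>z. of_bool (path_o \<omega> 1 = fst z \<and> path_b \<omega> 1 = snd z)) (\<lambda>z. of_bool (path_o \<omega> 0 = fst z \<and> path_b \<omega> 1 = snd z))"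
  by (cases "path_b \<omega> 1") (auto simp: comp_ll_def weighted_ll_def UNIV_bool of_bool_def if_distrib if_distribR cong: if_cong)

lemma integral_ell:
  assumes "\<And>z f. integrable M (\<lambda>\<omega>. G \<omega> z * f (obs_s \<omega> 1) (obs_a \<omega> 1))"
    "\<And>z f. integrable M (\<lambda>\<omega>. Gt \<omega> z * f (obs_s \<omega> 1) (obs_a \<omega> 1))"
  shows "(\<integral>\<omega>. weighted_ll th (obs_s \<omega> 1) (obs_a \<omega> 1) (G \<omega>) (Gt \<omega>) \<partial>M) =
     (\<Sum>i\<in>UNIV. \<Sum>b\<in>UNIV. \<integral>\<omega>. Gt \<omega> (i, b) * ln (pi_b Mo (th_b th) (obs_s \<omega> 1) i b) \<partial>M)
     + (\<Sum>j\<in>UNIV. \<Sum>b\<in>UNIV. \<integral>\<omega>. G \<omega> (j, b) * ln (pi_lo Mo (th_lo th) (obs_s \<omega> 1) j (obs_a \<omega> 1)) \<partial>M)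
     + (\<Sum>j\<in>UNIV. \<integral>\<omega>. G \<omega> (j, True) * ln (pi_hi Mo (th_hi th) (obs_s \<omega> 1) j) \<partial>M)"
proof -
  have 1: "integrable M (\<lambda>\<omega>. Gt \<omega> (i, b) * ln (pi_b Mo (th_b th) (obs_s \<omega> 1) i b))" for i b by (rule assms(2))
  have 2: "integrable M (\<lambda>\<omega>. G \<omega> (j, b) * ln (pi_lo Mo (th_lo th) (obs_s \<omega> 1) j (obs_a \<omega> 1)))" for j b by (rule assms(1))
  have 3: "integrable M (\<lambda>\<omega>. G \<omega> (j, True) * ln (pi_hi Mo (th_hi th) (obs_s \<omega> 1) j))" for j by (rule assms(1))
  show ?thesis unfolding weighted_ll_def
    by (simp only: Bochner_Integration.integral_add Bochner_Integration.integral_sum Bochner_Integration.integrable_sum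
        Bochner_Integration.integrable_add 1 2 3)
qed

lemma integral_local_ll_star:
  assumes k: "1 \<le> k"
  shows "(\<integral>\<omega>. local_ll k th' th_star \<omega> \<partial>M) = (\<integral>\<omega>. comp_ll th' \<omega> \<partial>M)"
proof -
  let ?W = "{1 - int k..1 + int k}"
  have I: "integrable M (\<lambda>\<omega>. H \<omega> * f (obs_s \<omega> 1) (obs_a \<omega> 1))" if "window_fun ?W H"
    for H :: "('s, 'a, 'o) path \<Rightarrow> real" and f
  proof (rule window_fun_integrable[of ?W])
    show "window_fun ?W (\<lambda>\<omega>. H \<omega> * f (obs_s \<omega> 1) (obs_a \<omega> 1))"
      unfolding window_fun_def
    proof (intro allI impI)
      fix \<omega> \<omega>' :: "('s, 'a, 'o) path" assume a: "\<forall>i\<in>?W. \<omega> i = \<omega>' i"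
      then have "\<omega> 1 = \<omega>' 1" by simp
      moreover have "H \<omega> = H \<omega>'" using that a unfolding window_fun_def by blast
      ultimately show "H \<omega> * f (obs_s \<omega> 1) (obs_a \<omega> 1) = H \<omega>' * f (obs_s \<omega>' 1) (obs_a \<omega>' 1)"
        by (simp add: obs_s_def obs_a_def)
    qed
  qed simp
  have g: "window_fun ?W (\<lambda>\<omega>. gamma_k Mo \<nu>f th_star \<omega> k z)" "window_fun ?W (\<lambda>\<omega>. gamma_tilde_k Mo \<nu>f th_star \<omega> k z)" for z
    unfolding window_fun_def using gamma_k_window[where th = th_star and k = k] by metis+
  have h: "window_fun ?W (\<lambda>\<omega>. of_bool (path_o \<omega> 1 = fst z \<and> path_b \<omega> 1 = snd z) :: real)"
    "window_fun ?W (\<lambda>\<omega>. of_bool (path_o \<omega> 0 = fst z \<and> path_b \<omega> 1 = snd z) :: real)" for z :: "'o \<times> bool"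
    unfolding window_fun_def
  proof -
    have eq: "path_o \<omega> 1 = path_o \<omega>' 1 \<and> path_b \<omega> 1 = path_b \<omega>' 1 \<and> path_o \<omega> 0 = path_o \<omega>' 0"
      if "\<forall>i\<in>?W. \<omega> i = \<omega>' i" for \<omega> \<omega>' :: "('s, 'a, 'o) path"
      using that k by (auto simp: path_o_def path_b_def)
    show "\<forall>\<omega> \<omega>'. (\<forall>i\<in>?W. \<omega> i = (\<omega>' :: ('s, 'a, 'o) path) i) \<longrightarrow>
       (of_bool (path_o \<omega> 1 = fst z \<and> path_b \<omega> 1 = snd z) :: real) = of_bool (path_o \<omega>' 1 = fst z \<and> path_b \<omega>' 1 = snd z)"
      "\<forall>\<omega> \<omega>'. (\<forall>i\<in>?W. \<omega> i = (\<omega>' :: ('s, 'a, 'o) path) i) \<longrightarrow>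
       (of_bool (path_o \<omega> 0 = fst z \<and> path_b \<omega> 1 = snd z) :: real) = of_bool (path_o \<omega>' 0 = fst z \<and> path_b \<omega>' 1 = snd z)"
      by (intro allI impI, drule eq, simp)+
  qed
  show ?thesis
    unfolding local_ll_def comp_ll_eq_ell integral_ell[OF I[OF g(1)] I[OF g(2)]] integral_ell[OF I[OF h(1)] I[OF h(2)]]
    unfolding gamma_k_eq gamma_tilde_k_eq
    by (intro arg_cong2[of _ _ _ _ "(+)"] sum.cong refl
        posterior_integral[OF k, where g = "\<lambda>s a. ln (pi_b Mo (th_b th') s _ _)"]
        posterior_integral[OF k, where g = "\<lambda>s a. ln (pi_lo Mo (th_lo th') s _ a)"]
        posterior_integral[OF k, where g = "\<lambda>s a. ln (pi_hi Mo (th_hi th') s _)"])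
qed

lemma step_prob_ratio:
  assumes "th \<in> \<Theta>'" "th' \<in> \<Theta>'"
  shows "step_prob Mo th' s a i j b = step_prob Mo th s a i j b * exp
    ((ln (pi_b Mo (th_b th') s i b) + ln (pi_lo Mo (th_lo th') s j a) + (if b then ln (pi_hi Mo (th_hi th') s j) else 0))
    - (ln (pi_b Mo (th_b th) s i b) + ln (pi_lo Mo (th_lo th) s j a) + (if b then ln (pi_hi Mo (th_hi th) s j) else 0)))"
proof -
  note pos = pos_b[OF assms(1), of s i b] pos_lo[OF assms(1), of s j a] pos_hi[OF assms(1), of s j]
    pos_b[OF assms(2), of s i b] pos_lo[OF assms(2), of s j a] pos_hi[OF assms(2), of s j]
  show ?thesis
    using pos by (cases b) (simp_all add: step_prob_def pibar_hi_def exp_diff exp_add)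
qed

lemma comp_ll_le:
  assumes th': "th' \<in> \<Theta>"
  shows "(\<integral>\<omega>. comp_ll th' \<omega> \<partial>M) \<le> (\<integral>\<omega>. comp_ll th_star \<omega> \<partial>M)"
proof -
  let ?W = "{0..1::int}"
  have W: "?W = insert 1 (insert 0 {})" by auto
  have wf: "window_fun ?W (comp_ll th)" for th
    unfolding window_fun_def
  proof (intro allI impI)
    fix \<omega> \<omega>' :: "('s, 'a, 'o) path" assume "\<forall>i\<in>?W. \<omega> i = \<omega>' i"
    then have "\<omega> 1 = \<omega>' 1" "\<omega> 0 = \<omega>' 0" by auto
    then show "comp_ll th \<omega> = comp_ll th \<omega>'" by (simp add: comp_ll_def obs_s_def obs_a_def path_o_def path_b_def)
  qed
  have int: "(\<integral>\<omega>. comp_ll th \<omega> \<partial>M) = (\<Sum>x\<in>PiE ?W (\<lambda>_. UNIV). comp_ll th x * (p (x 0) * K th_star (x 0) (x 1)))" for th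
    using window_fun_integral[OF _ wf, of th] by (simp add: prob_cyl)
  have pw: "comp_ll th' x * (p (x 0) * K th_star (x 0) (x 1)) - comp_ll th_star x * (p (x 0) * K th_star (x 0) (x 1)) \<le>
    p (x 0) * (K th' (x 0) (x 1) - K th_star (x 0) (x 1))" for x
  proof -
    obtain s a i b where x0: "x 0 = (s, a, i, b)" by (cases "x 0")
    obtain s' a' i' b' where x1: "x 1 = (s', a', i', b')" by (cases "x 1")
    define u where "u = comp_ll th' x - comp_ll th_star x"
    have "step_prob Mo th' s' a' i i' b' = step_prob Mo th_star s' a' i i' b' * exp u"
      unfolding u_def using step_prob_ratio[OF Theta'[OF th_star] Theta'[OF th']]
      by (simp add: comp_ll_def obs_s_def obs_a_def path_o_def path_b_def x0 x1)
    then have "K th' (x 0) (x 1) = K th_star (x 0) (x 1) * exp u" by (simp add: K_def x0 x1)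
    moreover have "K th_star (x 0) (x 1) * (1 + u) \<le> K th_star (x 0) (x 1) * exp u"
      by (intro mult_left_mono exp_ge_add_one_self K_nonneg)
    ultimately have "u * K th_star (x 0) (x 1) \<le> K th' (x 0) (x 1) - K th_star (x 0) (x 1)" by (simp add: algebra_simps)
    then have "p (x 0) * (u * K th_star (x 0) (x 1)) \<le> p (x 0) * (K th' (x 0) (x 1) - K th_star (x 0) (x 1))"
      by (intro mult_left_mono p_nonneg)
    then show ?thesis by (simp add: u_def algebra_simps)
  qed
  have tot: "(\<Sum>x\<in>PiE ?W (\<lambda>_. UNIV). p (x 0) * (K th' (x 0) (x 1) - K th_star (x 0) (x 1))) = 0"
  proof -
    have K1: "(\<Sum>y\<in>UNIV. K th x y) = 1" if "th \<in> \<Theta>" for th x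
      using stochastic_kernel.K_sum[OF stochastic_K[OF Theta'[OF that]]] .
    have "(\<Sum>x\<in>PiE ?W (\<lambda>_. UNIV). p (x 0) * (K th' (x 0) (x 1) - K th_star (x 0) (x 1))) =
      (\<Sum>y\<in>UNIV. \<Sum>x\<in>UNIV. p x * (K th' x y - K th_star x y))"
      unfolding W by (simp add: sum_PiE_insert)
    also have "\<dots> = (\<Sum>x\<in>UNIV. p x * (\<Sum>y\<in>UNIV. K th' x y - K th_star x y))"
      by (subst sum.swap) (simp add: sum_distrib_left)
    also have "\<dots> = 0" by (simp add: sum_subtractf K1[OF th'] K1[OF th_star])
    finally show ?thesis .
  qed
  have "(\<integral>\<omega>. comp_ll th' \<omega> \<partial>M) - (\<integral>\<omega>. comp_ll th_star \<omega> \<partial>M) \<le> 0"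
    unfolding int sum_subtractf[symmetric] tot[symmetric] by (intro sum_mono pw)
  then show ?thesis by simp
qed

lemma Q_bar_star_max:
  assumes th': "th' \<in> \<Theta>"
  shows "Q_bar Mo \<nu>f M th' th_star \<le> Q_bar Mo \<nu>f M th_star th_star"
proof (rule field_le_epsilon)
  fix e :: real assume e: "0 < e"
  have "(\<lambda>k. 2 * (B * forget k)) \<longlonglongrightarrow> 2 * (B * 0)" by (intro tendsto_intros forget_tendsto)
  then have "eventually (\<lambda>k. 2 * (B * forget k) < e) sequentially" using e by (intro order_tendstoD) auto
  then have "eventually (\<lambda>k. 2 * (B * forget k) < e \<and> 1 \<le> k) sequentially"
    using eventually_ge_at_top[of 1] by eventually_elim auto
  then obtain k where k: "2 * (B * forget k) < e" "1 \<le> k" unfolding eventually_sequentially by blast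
  have "\<bar>(\<integral>\<omega>. local_ll k th' th_star \<omega> \<partial>M) - Q_bar Mo \<nu>f M th' th_star\<bar> \<le> B * forget k"
    "\<bar>(\<integral>\<omega>. local_ll k th_star th_star \<omega> \<partial>M) - Q_bar Mo \<nu>f M th_star th_star\<bar> \<le> B * forget k"
    using th' th_star k by (auto intro!: Q_bar_approx)
  then show "Q_bar Mo \<nu>f M th' th_star \<le> Q_bar Mo \<nu>f M th_star th_star + e"
    using comp_ll_le[OF th'] k(1) unfolding integral_local_ll_star[OF k(2)] by linarith
qed

end

section \<open>Contraction and the main theorem\<close>

lemma C1_on_differentiable: "C1_on f S \<Longrightarrow> x \<in> S \<Longrightarrow> f differentiable (at x)"
  unfolding C1_on_def differentiable_def by blast

lemma C1_on_continuous_on: "C1_on f S \<Longrightarrow> T \<subseteq> S \<Longrightarrow> continuous_on T f"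
  by (auto intro!: continuous_at_imp_continuous_on differentiable_imp_continuous_within dest: C1_on_differentiable)

lemma differentiable_ln:
  fixes f :: "'e::real_normed_vector \<Rightarrow> real"
  shows "f differentiable (at x) \<Longrightarrow> 0 < f x \<Longrightarrow> (\<lambda>x. ln (f x)) differentiable (at x)"
  unfolding differentiable_def by (blast intro: has_derivative_ln)

lemma compact_uniform_lower_bound:
  fixes f :: "'i::finite \<Rightarrow> 'p::topological_space \<Rightarrow> real"
  assumes S: "compact S" and cont: "\<And>i. continuous_on S (f i)" and pos: "\<And>i x. x \<in> S \<Longrightarrow> 0 < f i x"
  shows "\<exists>c>0. \<forall>i. \<forall>x\<in>S. c \<le> f i x"
proof -
  have "\<exists>c>0. \<forall>x\<in>S. c \<le> f i x" for i
  proof (cases "S = {}")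
    case False
    then obtain y where "y \<in> S" "\<forall>x\<in>S. f i y \<le> f i x" using continuous_attains_inf[OF S _ cont] by blast
    then show ?thesis using pos by blast
  qed (auto intro: exI[of _ 1])
  then obtain c where c: "\<And>i. 0 < c i" "\<And>i x. x \<in> S \<Longrightarrow> c i \<le> f i x" by metis
  show ?thesis
  proof (intro exI[of _ "Min (range c)"] conjI allI ballI)
    show "Min (range c) \<le> f i x" if "x \<in> S" for i x
      using c(2)[OF that] by (rule order_trans[rotated]) simp
  qed (use c(1) in simp)
qed

context owf_setting
begin

lemma gamma_inf_integrable:
  assumes th: "th \<in> \<Theta>"
  shows "integrable M (\<lambda>\<omega>. gamma_inf Mo \<nu>f th \<omega> z * f (obs_s \<omega> 1) (obs_a \<omega> 1))"
    "integrable M (\<lambda>\<omega>. gamma_tilde_inf Mo \<nu>f th \<omega> z * f (obs_s \<omega> 1) (obs_a \<omega> 1))"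
proof -
  define C where "C = (\<Sum>z\<in>UNIV. \<bar>f (fst z) (snd z)\<bar>)"
  have C: "\<bar>f s a\<bar> \<le> C" for s a
    unfolding C_def using member_le_sum[of "(s, a)" UNIV "\<lambda>z. \<bar>f (fst z) (snd z)\<bar>"] by simp
  have *: "integrable M (\<lambda>\<omega>. H \<omega> * f (obs_s \<omega> 1) (obs_a \<omega> 1))"
    if [measurable]: "H \<in> borel_measurable M" and H: "AE \<omega> in M. \<bar>H \<omega>\<bar> \<le> 1 + forget 1" for H
  proof (rule integrable_const_bound)
    show "AE \<omega> in M. norm (H \<omega> * f (obs_s \<omega> 1) (obs_a \<omega> 1)) \<le> (1 + forget 1) * C"
      using H
    proof eventually_elim
      case (elim \<omega>)
      then show ?case unfolding real_norm_def abs_mult using forget_nonneg[of 1] by (intro mult_mono C) auto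
    qed
    show "(\<lambda>\<omega>. H \<omega> * f (obs_s \<omega> 1) (obs_a \<omega> 1)) \<in> borel_measurable M"
      by (intro borel_measurable_times obs1_measurable) measurable
  qed
  have "AE \<omega> in M. \<bar>gamma_inf Mo \<nu>f th \<omega> z\<bar> \<le> 1 + forget 1 \<and> \<bar>gamma_tilde_inf Mo \<nu>f th \<omega> z\<bar> \<le> 1 + forget 1"
    using AE_good
  proof eventually_elim
    case (elim \<omega>)
    show ?case
      using gamma_inf_forget[OF elim th, of 1 z] gamma_k_abs[OF th, of \<omega> 1 z] by (auto simp: abs_le_iff)
  qed
  then have "AE \<omega> in M. \<bar>gamma_inf Mo \<nu>f th \<omega> z\<bar> \<le> 1 + forget 1" "AE \<omega> in M. \<bar>gamma_tilde_inf Mo \<nu>f th \<omega> z\<bar> \<le> 1 + forget 1"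
    by auto
  then show "integrable M (\<lambda>\<omega>. gamma_inf Mo \<nu>f th \<omega> z * f (obs_s \<omega> 1) (obs_a \<omega> 1))"
    "integrable M (\<lambda>\<omega>. gamma_tilde_inf Mo \<nu>f th \<omega> z * f (obs_s \<omega> 1) (obs_a \<omega> 1))"
    by (auto intro!: *)
qed

lemma integral_obs_differentiable:
  fixes H :: "('s, 'a, 'o) path \<Rightarrow> real" and g :: "'e::real_normed_vector \<Rightarrow> 's \<Rightarrow> 'a \<Rightarrow> real"
  assumes H: "\<And>f. integrable M (\<lambda>\<omega>. H \<omega> * f (obs_s \<omega> 1) (obs_a \<omega> 1))"
    and g: "\<And>s a. (\<lambda>x. g x s a) differentiable (at x)"
  shows "(\<lambda>x. \<integral>\<omega>. H \<omega> * g x (obs_s \<omega> 1) (obs_a \<omega> 1) \<partial>M) differentiable (at x)"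
proof -
  define C where "C s a = (\<integral>\<omega>. H \<omega> * of_bool (obs_s \<omega> 1 = s \<and> obs_a \<omega> 1 = a) \<partial>M)" for s a
  have I: "integrable M (\<lambda>\<omega>. H \<omega> * of_bool (obs_s \<omega> 1 = s \<and> obs_a \<omega> 1 = a))" for s a
    using H[of "\<lambda>s' a'. of_bool (s' = s \<and> a' = a)"] .
  have eq: "(\<integral>\<omega>. H \<omega> * g x (obs_s \<omega> 1) (obs_a \<omega> 1) \<partial>M) = (\<Sum>s\<in>UNIV. \<Sum>a\<in>UNIV. C s a * g x s a)" for x
  proof -
    have "H \<omega> * g x (obs_s \<omega> 1) (obs_a \<omega> 1) =
      (\<Sum>s\<in>UNIV. \<Sum>a\<in>UNIV. H \<omega> * of_bool (obs_s \<omega> 1 = s \<and> obs_a \<omega> 1 = a) * g x s a)" for \<omega>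
    proof -
      have "(\<Sum>a\<in>UNIV. H \<omega> * of_bool (obs_s \<omega> 1 = s \<and> obs_a \<omega> 1 = a) * g x s a) =
        (if obs_s \<omega> 1 = s then H \<omega> * g x s (obs_a \<omega> 1) else 0)" for s
      proof (cases "obs_s \<omega> 1 = s")
        case True
        then have "(\<Sum>a\<in>UNIV. H \<omega> * of_bool (obs_s \<omega> 1 = s \<and> obs_a \<omega> 1 = a) * g x s a) =
          (\<Sum>a\<in>UNIV. if obs_a \<omega> 1 = a then H \<omega> * g x s a else 0)"
          by (intro sum.cong) auto
        then show ?thesis using True by simp
      qed simp
      then show ?thesis by simp
    qed
    then show ?thesis unfolding C_def using I by (simp add: Bochner_Integration.integral_sum Bochner_Integration.integrable_sum)
  qed
  show ?thesis unfolding eq by (intro differentiable_sum ballI differentiable_mult differentiable_const g finite)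
qed

lemma Q_bar_differentiable:
  assumes th: "th \<in> \<Theta>" and x: "x \<in> \<Theta>'"
  shows "(\<lambda>x. Q_bar Mo \<nu>f M x th) differentiable (at x)"
proof -
  have b: "(\<lambda>x. ln (pi_b Mo (th_b x) s i b)) differentiable (at x)" for s i b
    using x by (intro differentiable_ln C1_on_differentiable[OF C1_b] pos_b)
  have l: "(\<lambda>x. ln (pi_lo Mo (th_lo x) s i a)) differentiable (at x)" for s i a
    using x by (intro differentiable_ln C1_on_differentiable[OF C1_lo] pos_lo)
  have h: "(\<lambda>x. ln (pi_hi Mo (th_hi x) s i)) differentiable (at x)" for s i
    using x by (intro differentiable_ln C1_on_differentiable[OF C1_hi] pos_hi)
  show ?thesis
    unfolding Q_bar_eq limit_ll_def integral_ell[OF gamma_inf_integrable[OF th]]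
    by (intro differentiable_add differentiable_sum ballI finite
        integral_obs_differentiable[OF gamma_inf_integrable(1)[OF th], where g = "\<lambda>x s a. ln (pi_lo Mo (th_lo x) s _ a)"]
        integral_obs_differentiable[OF gamma_inf_integrable(1)[OF th], where g = "\<lambda>x s a. ln (pi_hi Mo (th_hi x) s _)"]
        integral_obs_differentiable[OF gamma_inf_integrable(2)[OF th], where g = "\<lambda>x s a. ln (pi_b Mo (th_b x) s _ _)"]
        b l h)
qed

lemma Q_bar_has_gradient:
  assumes "th \<in> \<Theta>" "x \<in> \<Theta>'"
  shows "((\<lambda>x. Q_bar Mo \<nu>f M x th) has_derivative (\<lambda>h. inner h (grad_Q_bar Mo \<nu>f M x th))) (at x)"
proof -
  let ?P = "\<lambda>D. ((\<lambda>x. Q_bar Mo \<nu>f M x th) has_derivative (\<lambda>h. inner h D)) (at x)"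
  obtain D where D: "((\<lambda>x. Q_bar Mo \<nu>f M x th) has_derivative D) (at x)"
    using Q_bar_differentiable[OF assms] unfolding differentiable_def by blast
  have "D = (\<lambda>h. inner h (\<Sum>i\<in>Basis. D i *\<^sub>R i))"
    using linear_functional_inner[OF has_derivative_linear[OF D]] by blast
  then have "?P (\<Sum>i\<in>Basis. D i *\<^sub>R i)" using D by simp
  moreover have "D1 = D2" if "?P D1" "?P D2" for D1 D2
    using has_derivative_unique[OF that] by (metis vector_eq_ldot)
  ultimately have "\<exists>!D. ?P D" by blast
  then show ?thesis unfolding grad_Q_bar_def by (rule theI')
qed

lemma argmax_contraction:
  assumes conv: "convex \<Theta>" and lam: "lam > 0"
    and A4: "\<And>th1 th2. th1 \<in> \<Theta> \<Longrightarrow> th2 \<in> \<Theta> \<Longrightarrow>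
       Q_bar Mo \<nu>f M th1 th_star - Q_bar Mo \<nu>f M th2 th_star - inner (grad_Q_bar Mo \<nu>f M th2 th_star) (th1 - th2)
         \<le> - (lam / 2) * (norm (th1 - th2))\<^sup>2"
    and th: "th \<in> \<Theta>" and y: "is_argmax_on (\<lambda>x. Q_bar Mo \<nu>f M x th) \<Theta> y"
    and gam: "norm (grad_Q_bar Mo \<nu>f M y th - grad_Q_bar Mo \<nu>f M y th_star) \<le> \<gamma> * norm (th - th_star)"
  shows "norm (y - th_star) \<le> \<gamma> / lam * norm (th - th_star)"
proof -
  let ?g = "grad_Q_bar Mo \<nu>f M" and ?n = "norm (y - th_star)"
  have yT: "y \<in> \<Theta>" and ymax: "\<And>z. z \<in> \<Theta> \<Longrightarrow> Q_bar Mo \<nu>f M z th \<le> Q_bar Mo \<nu>f M y th"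
    using y by (auto simp: is_argmax_on_def)
  have 1: "inner (th_star - y) (?g y th) \<le> 0"
    by (rule first_order_condition[OF Q_bar_has_gradient[OF th Theta'[OF yT]] conv yT th_star ymax])
  have 2: "inner (y - th_star) (?g th_star th_star) \<le> 0"
    by (rule first_order_condition[OF Q_bar_has_gradient[OF th_star Theta'[OF th_star]] conv th_star yT Q_bar_star_max])
  have "lam * ?n\<^sup>2 \<le> inner (?g y th_star) (th_star - y)"
    using A4[OF yT th_star] A4[OF th_star yT] 2 by (simp add: inner_commute norm_minus_commute)
  also have "\<dots> \<le> inner (?g y th_star - ?g y th) (th_star - y)"
    using 1 by (simp add: inner_diff_left inner_diff_right inner_commute)
  also have "\<dots> \<le> norm (?g y th_star - ?g y th) * norm (th_star - y)" by (rule norm_cauchy_schwarz)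
  also have "\<dots> \<le> (\<gamma> * norm (th - th_star)) * ?n"
    using gam by (simp add: norm_minus_commute mult_right_mono)
  finally have le: "(lam * ?n) * ?n \<le> (\<gamma> * norm (th - th_star)) * ?n" by (simp add: power2_eq_square)
  have "lam * ?n \<le> \<gamma> * norm (th - th_star)"
  proof (cases "?n = 0")
    case True
    then show ?thesis using order_trans[OF norm_ge_zero gam] by simp
  next
    case False
    then show ?thesis using mult_right_le_imp_le[OF le] by simp
  qed
  then show ?thesis using lam by (simp add: field_simps)
qed

lemma Q_fin_window:
  assumes T: "1 \<le> T" and eq: "\<forall>i\<in>{1..int T}. \<omega> i = \<omega>' i"
  shows "Q_fin Mo \<mu> T x th \<omega> = Q_fin Mo \<mu> T x th \<omega>'"
proof -
  have "post_ev Mo th (\<mu> (obs_s \<omega> 1)) 1 (int T) (obs_s \<omega>) (obs_a \<omega>) (1 + int t) \<phi> =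
    post_ev Mo th (\<mu> (obs_s \<omega>' 1)) 1 (int T) (obs_s \<omega>') (obs_a \<omega>') (1 + int t) \<phi>" if "t < T" for t \<phi>
    by (rule post_ev_window[OF eq]) (use that in auto)
  moreover have "obs_s \<omega> (1 + int t) = obs_s \<omega>' (1 + int t)" "obs_a \<omega> (1 + int t) = obs_a \<omega>' (1 + int t)" if "t < T" for t
    using eq that by (auto simp: obs_s_def obs_a_def)
  ultimately show ?thesis
    unfolding Q_fin_eq[OF T] weighted_ll_def post_ob_eq_post_ev post_prev_ob_eq_post_ev
    by (intro arg_cong2[of _ _ _ _ "(/)"] sum.cong refl) (auto cong: if_cong)
qed

text \<open>This removes the dependence of the null sets in the uniqueness hypothesis on \<open>\<theta>\<close> and \<open>\<mu>\<close>.\<close>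
lemma good_of_AE:
  assumes ae: "AE \<omega> in M. P \<omega>" and P: "window_fun {m..n} P" and g: "good \<omega>" and mn: "m \<le> n"
  shows "P \<omega>"
proof (rule ccontr)
  assume n: "\<not> P \<omega>"
  have "\<not> P \<omega>'" if "\<omega>' \<in> cyl {m..n} \<omega>" for \<omega>'
    using that n P unfolding window_fun_def cyl_def by blast
  then have "AE \<omega>' in M. \<omega>' \<notin> cyl {m..n} \<omega>" using ae by (auto elim!: eventually_mono)
  then have "prob (cyl {m..n} \<omega>) = 0" using prob_eq_0[OF cyl_sets[of "{m..n}" \<omega>]] by simp
  then show False using g mn unfolding good_def by (metis order_less_irrefl)
qed

end

theorem theorem4:
  fixes Mo :: "('h::euclidean_space, 'l::euclidean_space, 'b::euclidean_space,
                's::finite, 'a::finite, 'o::finite) owf_model"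
    and \<Theta>h :: "'h set" and \<Theta>l :: "'l set" and \<Theta>b :: "'b set"
    and \<Theta> \<Theta>' :: "('h \<times> 'l \<times> 'b) set"
    and th_star :: "'h \<times> 'l \<times> 'b"
    and \<nu> :: "real ^ ('o \<times> 's)"
    and M :: "('s, 'a, 'o) path measure"
    and lam r \<gamma> :: real
  defines "\<nu>f \<equiv> (\<lambda>x. \<nu> $ x)"
  defines "Qb \<equiv> Q_bar Mo \<nu>f M"
  defines "Mb \<equiv> M_bar Mo \<nu>f M \<Theta>"
  defines "\<Theta>r \<equiv> {th \<in> \<Theta>. norm (th - th_star) \<le> r}"
  defines "\<kappa> \<equiv> \<gamma> / lam"
  \<comment> \<open>setting\<close>
  assumes Theta: "\<Theta> = \<Theta>h \<times> \<Theta>l \<times> \<Theta>b" "convex \<Theta>" "compact \<Theta>"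
    and zeta: "0 < zeta Mo" "zeta Mo < 1"
    and kern: "\<And>s a s'. kern Mo s a s' \<ge> 0" "\<And>s a. (\<Sum>s'\<in>UNIV. kern Mo s a s') = 1"
    and pmf_hi: "\<And>th s. th \<in> \<Theta>' \<Longrightarrow> (\<Sum>oc\<in>UNIV. pi_hi Mo (th_hi th) s oc) = 1"
    and pmf_lo: "\<And>th s oc. th \<in> \<Theta>' \<Longrightarrow> (\<Sum>a\<in>UNIV. pi_lo Mo (th_lo th) s oc a) = 1"
    and pmf_b: "\<And>th s oc. th \<in> \<Theta>' \<Longrightarrow> (\<Sum>b\<in>UNIV. pi_b Mo (th_b th) s oc b) = 1"
  \<comment> \<open>(A1)\<close>
    and A1: "open \<Theta>'" "\<Theta> \<subseteq> \<Theta>'"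
      "\<And>th s oc. th \<in> \<Theta>' \<Longrightarrow> pi_hi Mo (th_hi th) s oc > 0"
      "\<And>th s oc a. th \<in> \<Theta>' \<Longrightarrow> pi_lo Mo (th_lo th) s oc a > 0"
      "\<And>th s oc b. th \<in> \<Theta>' \<Longrightarrow> pi_b Mo (th_b th) s oc b > 0"
  \<comment> \<open>(A2)\<close>
    and A2: "\<And>s oc. C1_on (\<lambda>th. pi_hi Mo (th_hi th) s oc) \<Theta>'"
      "\<And>s oc a. C1_on (\<lambda>th. pi_lo Mo (th_lo th) s oc a) \<Theta>'"
      "\<And>s oc b. C1_on (\<lambda>th. pi_b Mo (th_b th) s oc b) \<Theta>'"
  \<comment> \<open>(A3)\<close>
    and A3: "th_star \<in> \<Theta>" "\<nu> extreme_point_of (stationary_dists Mo th_star)"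
    and law: "is_stationary_law Mo th_star \<nu>f M"
  \<comment> \<open>(A4)\<close>
    and lam: "lam > 0"
    and A4: "\<And>th1 th2. th1 \<in> \<Theta> \<Longrightarrow> th2 \<in> \<Theta> \<Longrightarrow>
       Qb th1 th_star - Qb th2 th_star - inner (grad_Q_bar Mo \<nu>f M th2 th_star) (th1 - th2)
         \<le> - (lam / 2) * (norm (th1 - th2))\<^sup>2"
  \<comment> \<open>(A5)\<close>
    and r: "r > 0"
    and A5i_unique: "\<And>th. th \<in> \<Theta>r \<Longrightarrow> \<exists>!th'. is_argmax_on (\<lambda>x. Qb x th) \<Theta> th'"
    and A5i_sep: "\<And>\<epsilon>. \<epsilon> > 0 \<Longrightarrow> \<exists>\<delta>>0. \<forall>th\<in>\<Theta>r. \<forall>th'\<in>\<Theta>.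
       norm (th' - Mb th) \<ge> \<epsilon> \<longrightarrow> Qb th' th \<le> Qb (Mb th) th - \<delta>"
    and A5ii: "\<And>th T \<mu>. th \<in> \<Theta>r \<Longrightarrow> T \<ge> 2 \<Longrightarrow> \<mu> \<in> cond_pmfs \<Longrightarrow>
       AE \<omega> in M. \<exists>!th'. is_argmax_on (\<lambda>x. Q_fin Mo \<mu> T x th \<omega>) \<Theta> th'"
  \<comment> \<open>contraction constant\<close>
    and gam: "\<gamma> > 0"
    and gam_bound: "\<And>th. th \<in> \<Theta>r \<Longrightarrow>
       norm (grad_Q_bar Mo \<nu>f M (Mb th) th - grad_Q_bar Mo \<nu>f M (Mb th) th_star)
         \<le> \<gamma> * norm (th - th_star)"
    and kappa: "\<kappa> < 1"
  shows "\<forall>\<Delta> q. 0 < \<Delta> \<and> \<Delta> \<le> (1 - \<kappa>) * r \<and> 0 < q \<and> q < 1 \<longrightarrow>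
     (\<exists>T0::nat. T0 \<ge> 1 \<and>
       (\<forall>T\<ge>T0. measure M {\<omega> \<in> space M. \<forall>th\<in>\<Theta>r. \<forall>\<mu>\<in>cond_pmfs.
            norm (M_fin Mo \<Theta> \<mu> T th \<omega> - Mb th) \<le> \<Delta>} \<ge> 1 - q) \<and>
       (\<forall>T\<ge>T0. \<forall>\<mu>\<in>cond_pmfs. \<forall>th0\<in>\<Theta>r.
          measure M {\<omega> \<in> space M. \<forall>ths::nat \<Rightarrow> 'h \<times> 'l \<times> 'b.
              (ths 0 = th0 \<and> (\<forall>n\<ge>1. is_argmax_on (\<lambda>x. Q_fin Mo \<mu> T x (ths (n - 1)) \<omega>) \<Theta> (ths n)))
              \<longrightarrow> (\<forall>n\<ge>1. norm (ths n - th_star)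
                      \<le> \<kappa> ^ n * norm (th0 - th_star) + \<Delta> / (1 - \<kappa>))} \<ge> 1 - q))"
proof -
  have Th': "\<And>th. th \<in> \<Theta> \<Longrightarrow> th \<in> \<Theta>'" using A1(2) by blast
  obtain c1 where c1: "c1 > 0" "\<And>s oc th. th \<in> \<Theta> \<Longrightarrow> c1 \<le> pi_hi Mo (th_hi th) s oc"
    using compact_uniform_lower_bound[OF Theta(3), of "\<lambda>(s, oc) th. pi_hi Mo (th_hi th) s oc"]
      C1_on_continuous_on[OF A2(1) A1(2)] A1(3) Th' by fastforce
  obtain c2 where c2: "c2 > 0" "\<And>s oc a th. th \<in> \<Theta> \<Longrightarrow> c2 \<le> pi_lo Mo (th_lo th) s oc a"
    using compact_uniform_lower_bound[OF Theta(3), of "\<lambda>(s, oc, a) th. pi_lo Mo (th_lo th) s oc a"]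
      C1_on_continuous_on[OF A2(2) A1(2)] A1(4) Th' by fastforce
  obtain c3 where c3: "c3 > 0" "\<And>s oc b th. th \<in> \<Theta> \<Longrightarrow> c3 \<le> pi_b Mo (th_b th) s oc b"
    using compact_uniform_lower_bound[OF Theta(3), of "\<lambda>(s, oc, b) th. pi_b Mo (th_b th) s oc b"]
      C1_on_continuous_on[OF A2(3) A1(2)] A1(5) Th' by fastforce
  define c0 where "c0 = min (min c1 c2) (min c3 (zeta Mo / real CARD('o)))"
  interpret owf_setting Mo \<Theta> \<Theta>' th_star \<nu> M c0
  proof
    show "0 < c0" using c1 c2 c3 zeta by (simp add: c0_def)
    show "c0 \<le> pi_hi Mo (th_hi th) s oc" if "th \<in> \<Theta>" for th s oc using c1(2)[OF that, of s oc] by (simp add: c0_def)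
    show "c0 \<le> pi_lo Mo (th_lo th) s oc a" if "th \<in> \<Theta>" for th s oc a using c2(2)[OF that, of s oc a] by (simp add: c0_def)
    show "c0 \<le> pi_b Mo (th_b th) s oc b" if "th \<in> \<Theta>" for th s oc b using c3(2)[OF that, of s oc b] by (simp add: c0_def)
    show "c0 \<le> zeta Mo / real CARD('o)" by (simp add: c0_def)
    show "is_stationary_law Mo th_star (($) \<nu>) M" using law by (simp add: \<nu>f_def)
  qed (fact zeta kern pmf_hi pmf_lo pmf_b A1 A2 A3)+
  have k0: "0 \<le> \<kappa>" using gam lam by (simp add: \<kappa>_def)
  have rT: "th \<in> \<Theta>" if "th \<in> \<Theta>r" for th using that by (simp add: \<Theta>r_def)
  have Mb: "is_argmax_on (\<lambda>x. Qb x th) \<Theta> (Mb th)" if "th \<in> \<Theta>r" for th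
    unfolding Mb_def M_bar_def Qb_def[symmetric] using A5i_unique[OF that] by (rule theI')
  have MbT: "Mb th \<in> \<Theta>" if "th \<in> \<Theta>r" for th using Mb[OF that] by (simp add: is_argmax_on_def)
  have contr: "norm (Mb th - th_star) \<le> \<kappa> * norm (th - th_star)" if "th \<in> \<Theta>r" for th
    unfolding \<kappa>_def
    using argmax_contraction[OF Theta(2) lam A4[unfolded Qb_def \<nu>f_def] rT[OF that]
        Mb[OF that, unfolded Qb_def \<nu>f_def] gam_bound[OF that, unfolded \<nu>f_def]] .
  show ?thesis
  proof (intro allI impI, elim conjE)
    fix \<Delta> q :: real
    assume Delta: "0 < \<Delta>" "\<Delta> \<le> (1 - \<kappa>) * r" and q: "0 < q" "q < 1"
    obtain \<delta> where delta: "\<delta> > 0" "\<And>th th'. th \<in> \<Theta>r \<Longrightarrow> th' \<in> \<Theta> \<Longrightarrow> norm (th' - Mb th) \<ge> \<Delta> \<Longrightarrow>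
        Qb th' th \<le> Qb (Mb th) th - \<delta>"
      using A5i_sep[OF Delta(1)] by blast
    have "\<delta> / 3 > 0" using delta(1) by simp
    then obtain T1 where T1: "1 \<le> T1" "\<And>T. T \<ge> T1 \<Longrightarrow> \<exists>A\<in>sets M. prob A \<ge> 1 - q \<and>
       (\<forall>\<omega>\<in>A. \<forall>th\<in>\<Theta>. \<forall>th'\<in>\<Theta>. \<forall>\<mu>\<in>cond_pmfs. good \<omega> \<longrightarrow>
          \<bar>Q_fin Mo \<mu> T th' th \<omega> - Q_bar Mo (\<lambda>x. \<nu> $ x) M th' th\<bar> \<le> \<delta> / 3)"
      using Q_uniform_in_prob[OF _ q(1)] by blast
    define T0 where "T0 = max T1 2"
    have main: "\<exists>A\<in>sets M. prob A \<ge> 1 - q \<and> (\<forall>\<omega>\<in>A. good \<omega> \<longrightarrow> (\<forall>th\<in>\<Theta>r. \<forall>\<mu>\<in>cond_pmfs. \<forall>y.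
        is_argmax_on (\<lambda>x. Q_fin Mo \<mu> T x th \<omega>) \<Theta> y \<longrightarrow> norm (y - Mb th) \<le> \<Delta>))" if T: "T \<ge> T0" for T
    proof -
      have "T \<ge> T1" using T by (simp add: T0_def)
      from T1(2)[OF this] obtain A where A: "A \<in> sets M" "prob A \<ge> 1 - q"
        "\<And>\<omega> th th' \<mu>. \<omega> \<in> A \<Longrightarrow> good \<omega> \<Longrightarrow> th \<in> \<Theta> \<Longrightarrow> th' \<in> \<Theta> \<Longrightarrow> \<mu> \<in> cond_pmfs \<Longrightarrow>
          \<bar>Q_fin Mo \<mu> T th' th \<omega> - Qb th' th\<bar> \<le> \<delta> / 3"
        unfolding Qb_def \<nu>f_def by blast
      have "norm (y - Mb th) \<le> \<Delta>" if w: "\<omega> \<in> A" "good \<omega>" and th: "th \<in> \<Theta>r" and mu: "\<mu> \<in> cond_pmfs"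
        and y: "is_argmax_on (\<lambda>x. Q_fin Mo \<mu> T x th \<omega>) \<Theta> y" for \<omega> th \<mu> y
      proof (rule ccontr)
        assume "\<not> norm (y - Mb th) \<le> \<Delta>"
        have yT: "y \<in> \<Theta>" and le: "Q_fin Mo \<mu> T (Mb th) th \<omega> \<le> Q_fin Mo \<mu> T y th \<omega>"
          using y MbT[OF th] by (auto simp: is_argmax_on_def)
        then have "Qb y th \<le> Qb (Mb th) th - \<delta>"
          using \<open>\<not> norm (y - Mb th) \<le> \<Delta>\<close> by (intro delta(2)[OF th]) auto
        moreover have "\<bar>Q_fin Mo \<mu> T y th \<omega> - Qb y th\<bar> \<le> \<delta> / 3" "\<bar>Q_fin Mo \<mu> T (Mb th) th \<omega> - Qb (Mb th) th\<bar> \<le> \<delta> / 3"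
          using A(3)[OF w rT[OF th] _ mu] yT MbT[OF th] by auto
        ultimately show False using le delta(1) by linarith
      qed
      then show ?thesis using A(1,2) by blast
    qed
    have prob_ge: "prob {\<omega> \<in> space M. P \<omega>} \<ge> 1 - q"
      if T: "T \<ge> T0" and P: "window_fun {1..int T} P"
        and imp: "\<And>\<omega>. good \<omega> \<Longrightarrow> (\<And>th \<mu> y. th \<in> \<Theta>r \<Longrightarrow> \<mu> \<in> cond_pmfs \<Longrightarrow>
          is_argmax_on (\<lambda>x. Q_fin Mo \<mu> T x th \<omega>) \<Theta> y \<Longrightarrow> norm (y - Mb th) \<le> \<Delta>) \<Longrightarrow> P \<omega>" for T P
    proof -
      obtain A where A: "A \<in> sets M" "prob A \<ge> 1 - q"
        and cl: "\<forall>\<omega>\<in>A. good \<omega> \<longrightarrow> (\<forall>th\<in>\<Theta>r. \<forall>\<mu>\<in>cond_pmfs. \<forall>y.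
          is_argmax_on (\<lambda>x. Q_fin Mo \<mu> T x th \<omega>) \<Theta> y \<longrightarrow> norm (y - Mb th) \<le> \<Delta>)"
        using main[OF T] by blast
      have AP: "P \<omega>" if "\<omega> \<in> A" "good \<omega>" for \<omega>
        by (rule imp[OF that(2)]) (use cl that in blast)
      have "AE \<omega> in M. \<omega> \<in> A \<longrightarrow> \<omega> \<in> {\<omega>. P \<omega>}" using AE_good by eventually_elim (simp add: AP)
      then have "prob A \<le> prob {\<omega>. P \<omega>}"
        by (rule finite_measure_mono_AE) (rule window_event[OF _ P], simp)
      then show ?thesis using A(2) by (simp add: space_M)
    qed
    show "\<exists>T0::nat. T0 \<ge> 1 \<and>
       (\<forall>T\<ge>T0. measure M {\<omega> \<in> space M. \<forall>th\<in>\<Theta>r. \<forall>\<mu>\<in>cond_pmfs.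
            norm (M_fin Mo \<Theta> \<mu> T th \<omega> - Mb th) \<le> \<Delta>} \<ge> 1 - q) \<and>
       (\<forall>T\<ge>T0. \<forall>\<mu>\<in>cond_pmfs. \<forall>th0\<in>\<Theta>r.
          measure M {\<omega> \<in> space M. \<forall>ths::nat \<Rightarrow> 'h \<times> 'l \<times> 'b.
              (ths 0 = th0 \<and> (\<forall>n\<ge>1. is_argmax_on (\<lambda>x. Q_fin Mo \<mu> T x (ths (n - 1)) \<omega>) \<Theta> (ths n)))
              \<longrightarrow> (\<forall>n\<ge>1. norm (ths n - th_star)
                      \<le> \<kappa> ^ n * norm (th0 - th_star) + \<Delta> / (1 - \<kappa>))} \<ge> 1 - q)"
    proof (intro exI[of _ T0] conjI allI impI ballI)
      show "1 \<le> T0" by (simp add: T0_def)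
    next
      fix T assume T: "T0 \<le> T"
      have T2: "2 \<le> T" "1 \<le> T" using T by (auto simp: T0_def)
      show "1 - q \<le> prob {\<omega> \<in> space M. \<forall>th\<in>\<Theta>r. \<forall>\<mu>\<in>cond_pmfs. norm (M_fin Mo \<Theta> \<mu> T th \<omega> - Mb th) \<le> \<Delta>}"
      proof (rule prob_ge[OF T])
        show "window_fun {1..int T} (\<lambda>\<omega>. \<forall>th\<in>\<Theta>r. \<forall>\<mu>\<in>cond_pmfs. norm (M_fin Mo \<Theta> \<mu> T th \<omega> - Mb th) \<le> \<Delta>)"
          unfolding window_fun_def M_fin_def by (intro allI impI) (simp only: Q_fin_window[OF T2(2)])
        fix \<omega> assume g: "good \<omega>" and close: "\<And>th \<mu> y. th \<in> \<Theta>r \<Longrightarrow> \<mu> \<in> cond_pmfs \<Longrightarrow>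
          is_argmax_on (\<lambda>x. Q_fin Mo \<mu> T x th \<omega>) \<Theta> y \<Longrightarrow> norm (y - Mb th) \<le> \<Delta>"
        show "\<forall>th\<in>\<Theta>r. \<forall>\<mu>\<in>cond_pmfs. norm (M_fin Mo \<Theta> \<mu> T th \<omega> - Mb th) \<le> \<Delta>"
        proof (intro ballI)
          fix th \<mu> assume th: "th \<in> \<Theta>r" and mu: "(\<mu> :: 's \<Rightarrow> 'o \<Rightarrow> real) \<in> cond_pmfs"
          have "\<exists>!th'. is_argmax_on (\<lambda>x. Q_fin Mo \<mu> T x th \<omega>) \<Theta> th'"
          proof (rule good_of_AE[OF A5ii[OF th T2(1) mu] _ g])
            show "window_fun {1..int T} (\<lambda>\<omega>. \<exists>!th'. is_argmax_on (\<lambda>x. Q_fin Mo \<mu> T x th \<omega>) \<Theta> th')"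
              unfolding window_fun_def by (intro allI impI) (simp only: Q_fin_window[OF T2(2)])
          qed (use T2 in auto)
          then have "is_argmax_on (\<lambda>x. Q_fin Mo \<mu> T x th \<omega>) \<Theta> (M_fin Mo \<Theta> \<mu> T th \<omega>)"
            unfolding M_fin_def by (rule theI')
          then show "norm (M_fin Mo \<Theta> \<mu> T th \<omega> - Mb th) \<le> \<Delta>" by (rule close[OF th mu])
        qed
      qed
    next
      fix T and \<mu> :: "'s \<Rightarrow> 'o \<Rightarrow> real" and th0
      assume T: "T0 \<le> T" and mu: "\<mu> \<in> cond_pmfs" and th0: "th0 \<in> \<Theta>r"
      have T2: "1 \<le> T" using T by (auto simp: T0_def)
      let ?P = "\<lambda>\<omega>. \<forall>ths::nat \<Rightarrow> 'h \<times> 'l \<times> 'b.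
              (ths 0 = th0 \<and> (\<forall>n\<ge>1. is_argmax_on (\<lambda>x. Q_fin Mo \<mu> T x (ths (n - 1)) \<omega>) \<Theta> (ths n)))
              \<longrightarrow> (\<forall>n\<ge>1. norm (ths n - th_star) \<le> \<kappa> ^ n * norm (th0 - th_star) + \<Delta> / (1 - \<kappa>))"
      show "1 - q \<le> prob {\<omega> \<in> space M. ?P \<omega>}"
      proof (rule prob_ge[OF T])
        show "window_fun {1..int T} ?P"
          unfolding window_fun_def by (intro allI impI) (simp only: Q_fin_window[OF T2])
        fix \<omega> assume g: "good \<omega>" and close: "\<And>th \<mu> y. th \<in> \<Theta>r \<Longrightarrow> \<mu> \<in> cond_pmfs \<Longrightarrow>
          is_argmax_on (\<lambda>x. Q_fin Mo \<mu> T x th \<omega>) \<Theta> y \<Longrightarrow> norm (y - Mb th) \<le> \<Delta>"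
        show "?P \<omega>"
        proof (intro allI impI, elim conjE)
          fix ths :: "nat \<Rightarrow> 'h \<times> 'l \<times> 'b" and n :: nat
          assume ths0: "ths 0 = th0"
            and it: "\<forall>n\<ge>1. is_argmax_on (\<lambda>x. Q_fin Mo \<mu> T x (ths (n - 1)) \<omega>) \<Theta> (ths n)"
          have step: "norm (ths (Suc n) - th_star) \<le> \<kappa> * norm (ths n - th_star) + \<Delta>" "ths (Suc n) \<in> \<Theta>"
            if "ths n \<in> \<Theta>r" for n
          proof -
            have am: "is_argmax_on (\<lambda>x. Q_fin Mo \<mu> T x (ths n) \<omega>) \<Theta> (ths (Suc n))" using it[rule_format, of "Suc n"] by simp
            then show "ths (Suc n) \<in> \<Theta>" by (simp add: is_argmax_on_def)
            have "norm (ths (Suc n) - th_star) \<le> norm (ths (Suc n) - Mb (ths n)) + norm (Mb (ths n) - th_star)"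
              using norm_triangle_ineq[of "ths (Suc n) - Mb (ths n)" "Mb (ths n) - th_star"] by simp
            then show "norm (ths (Suc n) - th_star) \<le> \<kappa> * norm (ths n - th_star) + \<Delta>"
              using close[OF that mu am] contr[OF that] by linarith
          qed
          have "ths n \<in> \<Theta>r \<and> norm (ths n - th_star) \<le> \<kappa> ^ n * norm (th0 - th_star) + \<Delta> / (1 - \<kappa>)" for n
          proof (induction n)
            case 0
            show ?case using th0 ths0 Delta kappa by simp
          next
            case (Suc n)
            then have rn: "ths n \<in> \<Theta>r" by simp
            then have "\<kappa> * norm (ths n - th_star) \<le> \<kappa> * r" using k0 by (intro mult_left_mono) (auto simp: \<Theta>r_def)
            then have "norm (ths (Suc n) - th_star) \<le> r" using step(1)[OF rn] Delta(2) by (simp add: algebra_simps)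
            moreover have "\<kappa> * norm (ths n - th_star) \<le> \<kappa> * (\<kappa> ^ n * norm (th0 - th_star) + \<Delta> / (1 - \<kappa>))"
              using Suc k0 by (intro mult_left_mono) auto
            moreover have "\<kappa> * (\<kappa> ^ n * norm (th0 - th_star) + \<Delta> / (1 - \<kappa>)) + \<Delta> =
              \<kappa> ^ Suc n * norm (th0 - th_star) + \<Delta> / (1 - \<kappa>)"
              using kappa by (simp add: field_simps)
            ultimately show ?case using step[OF rn] by (simp add: \<Theta>r_def)
          qed
          then show "norm (ths n - th_star) \<le> \<kappa> ^ n * norm (th0 - th_star) + \<Delta> / (1 - \<kappa>)" by blast
        qed
      qed
    qed
  qed
qed

end
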